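(* There exists a polynomial-time algorithm that, for every $n$-vertex unweighted undirected graph $G=(V,E)$ and source $s\in V$, constructs a 1-edge $(1,4)$ FT-ABFS structure $H$ with respect to $s$ with $O(n^{4/3})$ edges; that is, $H\subseteq G$ is spanning, $|E(H)|=O(n^{4/3})$, and for every $v\in V$ and every edge $e\in E$, $\mathrm{dist}(s,v,H\setminus\{e\})\le \mathrm{dist}(s,v,G\setminus\{e\})+4$.
   Context: For a graph $G'$ and vertices $u,v$, $\mathrm{dist}(u,v,G')$ denotes the number of edges on a shortest $u$–$v$ path in $G'$. For an edge $e$, $G\setminus\{e\}$ is the graph with $e$ deleted. A 1-edge $(\alpha,\beta)$ FT-ABFS structure with respect to $s$ is a spanning subgraph $H\subseteq G$ such that $\mathrm{dist}(s,v,H\setminus\{e\})\le\alpha\cdot\mathrm{dist}(s,v,G\setminus\{e\})+\beta$ for every vertex $v$ and edge $e$. *)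

theory Defs
  imports
    "HOL-Library.Extended_Nat"
    "HOL-Library.Landau_Symbols"
    "HOL-Computational_Algebra.Polynomial"
begin

section \<open>Undirected graphs, distances and fault-tolerant structures\<close>

type_synonym 'a ugraph = "'a set \<times> 'a set set"

abbreviation verts :: "'a ugraph \<Rightarrow> 'a set" where "verts \<equiv> fst"
abbreviation edges :: "'a ugraph \<Rightarrow> 'a set set" where "edges \<equiv> snd"

definition simple_graph :: "'a ugraph \<Rightarrow> bool" where
  "simple_graph G \<longleftrightarrow> finite (verts G) \<and> (\<forall>e\<in>edges G. e \<subseteq> verts G \<and> card e = 2)"

definition spanning_subgraph :: "'a ugraph \<Rightarrow> 'a ugraph \<Rightarrow> bool" where
  "spanning_subgraph H G \<longleftrightarrow> verts H = verts G \<and> edges H \<subseteq> edges G"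

definition delete_edge :: "'a ugraph \<Rightarrow> 'a set \<Rightarrow> 'a ugraph" where
  "delete_edge G e = (verts G, edges G - {e})"

definition is_path :: "'a ugraph \<Rightarrow> 'a \<Rightarrow> 'a list \<Rightarrow> 'a \<Rightarrow> bool" where
  "is_path G u p v \<longleftrightarrow>
     p \<noteq> [] \<and> hd p = u \<and> last p = v \<and> distinct p \<and> set p \<subseteq> verts G \<and>
     (\<forall>i. Suc i < length p \<longrightarrow> {p ! i, p ! Suc i} \<in> edges G)"

text \<open>The distance is infinite if there is no path: the infimum of the empty set is the top
  element of \<^typ>\<open>enat\<close>.\<close>

definition gdist :: "'a \<Rightarrow> 'a \<Rightarrow> 'a ugraph \<Rightarrow> enat" where
  "gdist u v G = (INF p\<in>{p. is_path G u p v}. enat (length p - 1))"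

definition ft_abfs :: "nat \<Rightarrow> nat \<Rightarrow> 'a ugraph \<Rightarrow> 'a \<Rightarrow> 'a ugraph \<Rightarrow> bool" where
  "ft_abfs \<alpha> \<beta> G s H \<longleftrightarrow>
     spanning_subgraph H G \<and>
     (\<forall>v\<in>verts G. \<forall>e\<in>edges G.
        gdist s v (delete_edge H e) \<le> enat \<alpha> * gdist s v (delete_edge G e) + enat \<beta>)"


section \<open>A deterministic random access machine with structured control flow\<close>

text \<open>
  The memory consists of named multi-dimensional arrays of natural numbers; a scalar variable is
  an array of dimension zero. Each evaluated syntax node costs one unit of time. The only
  arithmetic is addition and truncated subtraction, so that in \<open>t\<close> steps the bit length of the
  numbers grows by at most \<open>t\<close> (lemma \<open>exec_values_bounded\<close> below). Hence polynomial time in this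
  model agrees with polynomial time on Turing machines. Multiplication at unit cost would
  destroy this property.
\<close>

type_synonym store = "string \<Rightarrow> nat list \<Rightarrow> nat"

datatype aexp = Const nat | Read string "aexp list" | Plus aexp aexp | Minus aexp aexp

datatype bexp = Less aexp aexp | Equal aexp aexp | Neg bexp | Conj bexp bexp

datatype com =
    Skip
  | Assign string "aexp list" aexp
  | Seq com com
  | If bexp com com
  | While bexp com

fun aval :: "aexp \<Rightarrow> store \<Rightarrow> nat" where
  "aval (Const k) \<sigma> = k"
| "aval (Read x es) \<sigma> = \<sigma> x (map (\<lambda>e. aval e \<sigma>) es)"
| "aval (Plus a b) \<sigma> = aval a \<sigma> + aval b \<sigma>"
| "aval (Minus a b) \<sigma> = aval a \<sigma> - aval b \<sigma>"

fun bval :: "bexp \<Rightarrow> store \<Rightarrow> bool" where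
  "bval (Less a b) \<sigma> \<longleftrightarrow> aval a \<sigma> < aval b \<sigma>"
| "bval (Equal a b) \<sigma> \<longleftrightarrow> aval a \<sigma> = aval b \<sigma>"
| "bval (Neg b) \<sigma> \<longleftrightarrow> \<not> bval b \<sigma>"
| "bval (Conj b c) \<sigma> \<longleftrightarrow> bval b \<sigma> \<and> bval c \<sigma>"

fun acost :: "aexp \<Rightarrow> nat" where
  "acost (Const k) = 1"
| "acost (Read x es) = 1 + sum_list (map acost es)"
| "acost (Plus a b) = 1 + acost a + acost b"
| "acost (Minus a b) = 1 + acost a + acost b"

fun bcost :: "bexp \<Rightarrow> nat" where
  "bcost (Less a b) = 1 + acost a + acost b"
| "bcost (Equal a b) = 1 + acost a + acost b"
| "bcost (Neg b) = 1 + bcost b"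
| "bcost (Conj b c) = 1 + bcost b + bcost c"

text \<open>\<open>exec c \<sigma> t \<tau>\<close>: started in store \<open>\<sigma>\<close>, the program \<open>c\<close> halts after exactly \<open>t\<close> time units
  in store \<open>\<tau>\<close>.\<close>

inductive exec :: "com \<Rightarrow> store \<Rightarrow> nat \<Rightarrow> store \<Rightarrow> bool" where
  Skip: "exec Skip \<sigma> 1 \<sigma>"
| Assign: "exec (Assign x es a) \<sigma> (1 + sum_list (map acost es) + acost a)
             (\<sigma>(x := (\<sigma> x)(map (\<lambda>e. aval e \<sigma>) es := aval a \<sigma>)))"
| Seq: "exec c1 \<sigma>1 t1 \<sigma>2 \<Longrightarrow> exec c2 \<sigma>2 t2 \<sigma>3 \<Longrightarrow> exec (Seq c1 c2) \<sigma>1 (t1 + t2) \<sigma>3"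
| IfTrue: "bval b \<sigma> \<Longrightarrow> exec c1 \<sigma> t \<tau> \<Longrightarrow> exec (If b c1 c2) \<sigma> (1 + bcost b + t) \<tau>"
| IfFalse: "\<not> bval b \<sigma> \<Longrightarrow> exec c2 \<sigma> t \<tau> \<Longrightarrow> exec (If b c1 c2) \<sigma> (1 + bcost b + t) \<tau>"
| WhileFalse: "\<not> bval b \<sigma> \<Longrightarrow> exec (While b c) \<sigma> (1 + bcost b) \<sigma>"
| WhileTrue: "bval b \<sigma>1 \<Longrightarrow> exec c \<sigma>1 t1 \<sigma>2 \<Longrightarrow> exec (While b c) \<sigma>2 t2 \<sigma>3 \<Longrightarrow>
              exec (While b c) \<sigma>1 (1 + bcost b + t1 + t2) \<sigma>3"

inductive_cases exec_SkipE: "exec Skip \<sigma> t \<tau>"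
inductive_cases exec_AssignE: "exec (Assign x es a) \<sigma> t \<tau>"
inductive_cases exec_SeqE: "exec (Seq c1 c2) \<sigma> t \<tau>"
inductive_cases exec_IfE: "exec (If b c1 c2) \<sigma> t \<tau>"
inductive_cases exec_WhileE: "exec (While b c) \<sigma> t \<tau>"

lemma exec_deterministic:
  "exec c \<sigma> t \<tau> \<Longrightarrow> exec c \<sigma> t' \<tau>' \<Longrightarrow> t' = t \<and> \<tau>' = \<tau>"
proof (induction arbitrary: t' \<tau>' rule: exec.induct)
  case (Skip \<sigma>)
  then show ?case by (rule exec_SkipE) simp
next
  case (Assign x es a \<sigma>)
  then show ?case by (rule exec_AssignE) simp
next
  case (Seq c1 \<sigma>1 t1 \<sigma>2 c2 t2 \<sigma>3)
  from Seq.prems show ?case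
    by (rule exec_SeqE) (metis Seq.IH)
next
  case (IfTrue b \<sigma> c1 t \<tau> c2)
  from IfTrue.prems show ?case
    by (rule exec_IfE) (use IfTrue.IH IfTrue.hyps(1) in \<open>metis plus_1_eq_Suc add_Suc\<close>)+
next
  case (IfFalse b \<sigma> c2 t \<tau> c1)
  from IfFalse.prems show ?case
    by (rule exec_IfE) (use IfFalse.IH IfFalse.hyps(1) in \<open>metis plus_1_eq_Suc add_Suc\<close>)+
next
  case (WhileFalse b \<sigma> c)
  from WhileFalse.prems show ?case
    by (rule exec_WhileE) (use WhileFalse.hyps in simp)+
next
  case (WhileTrue b \<sigma>1 c t1 \<sigma>2 t2 \<sigma>3)
  from WhileTrue.prems show ?case
    by (rule exec_WhileE) (use WhileTrue.IH WhileTrue.hyps(1) in \<open>metis plus_1_eq_Suc add_Suc\<close>)+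
qed

fun aconsts :: "aexp \<Rightarrow> nat set" where
  "aconsts (Const k) = {k}"
| "aconsts (Read x es) = (\<Union>e\<in>set es. aconsts e)"
| "aconsts (Plus a b) = aconsts a \<union> aconsts b"
| "aconsts (Minus a b) = aconsts a \<union> aconsts b"

text \<open>Only constants on right-hand sides of assignments matter for the size of the stored
  numbers.\<close>

fun com_consts :: "com \<Rightarrow> nat set" where
  "com_consts Skip = {}"
| "com_consts (Assign x es a) = aconsts a"
| "com_consts (Seq c1 c2) = com_consts c1 \<union> com_consts c2"
| "com_consts (If b c1 c2) = com_consts c1 \<union> com_consts c2"
| "com_consts (While b c) = com_consts c"

lemma aval_bounded:
  assumes "\<And>x is. \<sigma> x is \<le> M" and "\<forall>k\<in>aconsts a. k \<le> M"
  shows "aval a \<sigma> \<le> M * 2 ^ acost a"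
  using assms(2)
proof (induction a)
  case (Const k)
  then show ?case by simp
next
  case (Read x es)
  have "M * 1 \<le> M * 2 ^ acost (Read x es)" by (intro mult_le_mono2) simp
  with assms(1) show ?case by (metis aval.simps(2) le_trans mult.right_neutral)
next
  case (Plus a b)
  have "M * 2 ^ acost a \<le> M * 2 ^ (acost a + acost b)"
    and "M * 2 ^ acost b \<le> M * 2 ^ (acost a + acost b)"
    by (intro mult_le_mono2 power_increasing; simp)+
  moreover have "aval a \<sigma> \<le> M * 2 ^ acost a" and "aval b \<sigma> \<le> M * 2 ^ acost b"
    using Plus by simp_all
  ultimately have "aval a \<sigma> + aval b \<sigma> \<le> 2 * (M * 2 ^ (acost a + acost b))" by linarith
  then show ?case by simp
next
  case (Minus a b)
  have "M * 2 ^ acost a \<le> M * 2 ^ acost (Minus a b)"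
    by (intro mult_le_mono2 power_increasing) auto
  moreover have "aval a \<sigma> \<le> M * 2 ^ acost a" using Minus by simp
  ultimately show ?case unfolding aval.simps by linarith
qed

lemma exec_values_bounded:
  assumes "exec c \<sigma> t \<tau>" and "\<And>x is. \<sigma> x is \<le> M" and "\<forall>k\<in>com_consts c. k \<le> M"
  shows "\<tau> x is \<le> M * 2 ^ t"
  using assms
proof (induction arbitrary: M x "is" rule: exec.induct)
  case (Skip \<sigma>)
  show ?case using Skip(1)[of x "is"] by simp
next
  case (Assign y es a \<sigma>)
  let ?t = "1 + sum_list (map acost es) + acost a"
  have "aval a \<sigma> \<le> M * 2 ^ acost a" using Assign by (intro aval_bounded) auto
  also have "\<dots> \<le> M * 2 ^ ?t" by (intro mult_le_mono2 power_increasing) auto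
  finally have 1: "aval a \<sigma> \<le> M * 2 ^ ?t" .
  have "M * 1 \<le> M * 2 ^ ?t" by (intro mult_le_mono2) simp
  then have 2: "\<sigma> z js \<le> M * 2 ^ ?t" for z js using Assign(1)[of z js] by linarith
  show ?case unfolding fun_upd_def using 1 2 by presburger
next
  case (Seq c1 \<sigma>1 t1 \<sigma>2 c2 t2 \<sigma>3)
  have "M * 1 \<le> M * 2 ^ t1" by (intro mult_le_mono2) simp
  then have "\<forall>k\<in>com_consts c2. k \<le> M * 2 ^ t1" using Seq.prems(2) by (auto intro: order_trans)
  then have "\<sigma>3 x is \<le> M * 2 ^ t1 * 2 ^ t2" using Seq by simp
  then show ?case by (simp add: power_add mult.assoc)
next
  case (IfTrue b \<sigma> c1 t \<tau> c2)
  have "\<tau> x is \<le> M * 2 ^ t" using IfTrue by simp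
  also have "\<dots> \<le> M * 2 ^ (1 + bcost b + t)" by (intro mult_le_mono2 power_increasing) auto
  finally show ?case .
next
  case (IfFalse b \<sigma> c2 t \<tau> c1)
  have "\<tau> x is \<le> M * 2 ^ t" using IfFalse by simp
  also have "\<dots> \<le> M * 2 ^ (1 + bcost b + t)" by (intro mult_le_mono2 power_increasing) auto
  finally show ?case .
next
  case (WhileFalse b \<sigma> c)
  have "M * 1 \<le> M * 2 ^ (1 + bcost b)" by (intro mult_le_mono2) simp
  with WhileFalse.prems(1)[of x "is"] show ?case by linarith
next
  case (WhileTrue b \<sigma>1 c t1 \<sigma>2 t2 \<sigma>3)
  have "M * 1 \<le> M * 2 ^ t1" by (intro mult_le_mono2) simp
  then have "\<forall>k\<in>com_consts (While b c). k \<le> M * 2 ^ t1" using WhileTrue.prems(2) by (auto intro: order_trans)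
  then have "\<sigma>3 x is \<le> M * 2 ^ t1 * 2 ^ t2" using WhileTrue by simp
  also have "\<dots> = M * 2 ^ (t1 + t2)" by (simp add: power_add)
  also have "\<dots> \<le> M * 2 ^ (1 + bcost b + t1 + t2)"
    by (intro mult_le_mono2 power_increasing) auto
  finally show ?case .
qed


section \<open>Graphs as inputs and outputs\<close>

text \<open>Graphs handed to a program have vertex set \<open>{..<n}\<close> and are given by their adjacency
  matrix. The input has length polynomial in \<open>n\<close>, so polynomial time means time polynomial
  in \<open>n\<close>.\<close>

definition adj_matrix :: "nat ugraph \<Rightarrow> nat \<Rightarrow> nat \<Rightarrow> nat" where
  "adj_matrix G u v = (if {u, v} \<in> edges G then 1 else 0)"

definition input_store :: "nat ugraph \<Rightarrow> nat \<Rightarrow> store" where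
  "input_store G s = (\<lambda>x is.
     if x = ''n'' \<and> is = [] then card (verts G)
     else if x = ''s'' \<and> is = [] then s
     else if x = ''G'' \<and> length is = 2 then adj_matrix G (is ! 0) (is ! 1)
     else 0)"

definition outputs_graph :: "store \<Rightarrow> nat ugraph \<Rightarrow> bool" where
  "outputs_graph \<tau> H \<longleftrightarrow> (\<forall>u\<in>verts H. \<forall>v\<in>verts H. \<tau> ''H'' [u, v] = adj_matrix H u v)"

end

theory Submission
  imports Defs
begin

text \<open>
  Only failures of edges of a breadth-first tree matter. For the tree edge above \<open>q\<close> fix the
  canonical shortest paths \<open>P\<^sub>q\<^sub>,\<^sub>v\<close> that avoid it and use a tree edge as last edge whenever possible.
  Let \<open>L\<close> be the cube root of \<open>n\<close>, rounded up. The initial structure \<open>H\<close> consists of the tree,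
  greedily chosen disjoint stars (clusters) of at least \<open>L\<close> leaves attached by non-tree edges, so
  that stars never fail, all edges with an unclustered end, and the last edges of all \<open>P\<^sub>q\<^sub>,\<^sub>w\<close>
  where \<open>w\<close> is at most \<open>L\<close> levels below \<open>q\<close>. Then, in order of non-increasing depth of \<open>q\<close>, the
  whole of \<open>P\<^sub>q\<^sub>,\<^sub>v\<close> is added if its last edge is missing and \<open>v\<close> is still too far away.

  Let \<open>R\<close> be a residue class of levels modulo \<open>L\<close> with at most \<open>n / L\<close> vertices. Missing edges of
  an added path lie more than \<open>L\<close> levels below \<open>q\<close>, so the path meets some \<open>r\<close> in \<open>R\<close> before its
  first missing edge. If a missing edge ends in a cluster \<open>F\<close>, and earlier added paths contain
  pieces from \<open>r\<close> to \<open>F\<close> and from \<open>F\<close> to the cluster \<open>C\<close> of \<open>v\<close> that are not longer than those of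
  \<open>P\<^sub>q\<^sub>,\<^sub>v\<close>, then joining them by two stars shows that \<open>v\<close> is within additive error 4; the order of
  processing ensures that the old pieces avoid the failing edge. Hence each missing edge
  shortens the record of \<open>(r, F)\<close> or that of \<open>(F, C)\<close>. All recorded lengths of a pair lie within a
  constant window, so \<open>O((n / L)\<^sup>2)\<close> edges are added.
\<close>


section \<open>Walks and distances\<close>

text \<open>The value of \<open>L\<close> balances the budget: the initial structure has
  \<open>O(n L)\<close> edges, there are at most \<open>n / L\<close> clusters and at most
  \<open>n / L\<close> anchors in \<open>R\<close>, and \<open>(n / L)^2\<close> equals
  \<open>n L\<close> at the cube root of \<open>n\<close>. Anchors replace \<open>s\<close> as
  starting points because an older path may use the edge that fails now, so its piece from
  \<open>s\<close> cannot be reused; a piece that starts at depth at least \<open>dep q\<close> can.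
  The last edges stored close below \<open>q\<close> keep \<open>L\<close> consecutive levels free
  of missing edges, so one of these levels has the residue of \<open>R\<close> whatever the depth of
  \<open>q\<close>. The window rests on optimality: an older piece is a shortest walk avoiding its
  own tree edge, and the newer piece, lengthened by stars, competes with it. The obstacle is a newer
  piece that runs through the older tree edge. The preference for tree edges makes this harmless:
  the end of the path then lies outside the subtree cut off by that edge, where distances are still
  depths.\<close>

definition reach :: "'a set set \<Rightarrow> nat \<Rightarrow> 'a \<Rightarrow> 'a \<Rightarrow> bool" where
  "reach F k u v \<longleftrightarrow> (\<exists>m\<le>k. (u, v) \<in> {(x, y). {x, y} \<in> F} ^^ m)"

lemma reach_refl [simp]: "reach F k u u"
  unfolding reach_def by (intro exI[of _ 0]) simp

lemma reach_edge: "{u, v} \<in> F \<Longrightarrow> reach F 1 u v"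
  unfolding reach_def by (intro exI[of _ 1]) simp

lemma reach_mono: "reach F k u v \<Longrightarrow> F \<subseteq> F' \<Longrightarrow> k \<le> k' \<Longrightarrow> reach F' k' u v"
proof -
  assume a: "reach F k u v" "F \<subseteq> F'" "k \<le> k'"
  then obtain m where "m \<le> k" "(u, v) \<in> {(x, y). {x, y} \<in> F} ^^ m"
    unfolding reach_def by blast
  moreover have "{(x, y). {x, y} \<in> F} ^^ m \<subseteq> {(x, y). {x, y} \<in> F'} ^^ m"
    using a(2) by (induction m) auto
  ultimately show ?thesis using a(3) unfolding reach_def by (meson le_trans subsetD)
qed

lemma reach_trans:
  assumes "reach F j u v" "reach F k v w" "j + k \<le> l"
  shows "reach F l u w"
proof -
  obtain a b where "a \<le> j" "(u, v) \<in> {(x, y). {x, y} \<in> F} ^^ a"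
    "b \<le> k" "(v, w) \<in> {(x, y). {x, y} \<in> F} ^^ b"
    using assms unfolding reach_def by blast
  then have "a + b \<le> l" "(u, w) \<in> {(x, y). {x, y} \<in> F} ^^ (a + b)"
    using assms(3) by (auto simp: relpow_add)
  then show ?thesis unfolding reach_def by blast
qed

lemma reach_0: "reach F 0 u v \<longleftrightarrow> u = v"
  unfolding reach_def by auto

lemma reach_SucE:
  assumes "reach F (Suc k) u v" "\<not> reach F k u v"
  obtains w where "reach F k u w" "{w, v} \<in> F"
proof -
  obtain m where m: "m \<le> Suc k" "(u, v) \<in> {(x, y). {x, y} \<in> F} ^^ m"
    using assms(1) unfolding reach_def by blast
  with assms(2) have "m = Suc k" unfolding reach_def by (metis le_Suc_eq)
  with m obtain w where "(u, w) \<in> {(x, y). {x, y} \<in> F} ^^ k" "{w, v} \<in> F" by auto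
  then show ?thesis using that unfolding reach_def by blast
qed

text \<open>Unreachable vertices get the value \<open>n + 5\<close>, which exceeds every finite distance by more than the
  admitted error 4.\<close>

definition sdist :: "nat \<Rightarrow> nat \<Rightarrow> nat set set \<Rightarrow> nat \<Rightarrow> nat" where
  "sdist n s F v = (if \<exists>k. reach F k s v then LEAST k. reach F k s v else n + 5)"

lemma sdist_le: "reach F k s v \<Longrightarrow> sdist n s F v \<le> k"
  unfolding sdist_def by (auto intro: Least_le)

lemma reach_sdist: "sdist n s F v < n + 5 \<Longrightarrow> reach F (sdist n s F v) s v"
  unfolding sdist_def by (auto intro: LeastI split: if_splits)

lemma sdist_source [simp]: "sdist n s F s = 0"
  using sdist_le[of F 0 s s n] by simp

lemma sdist_eq_0: "sdist n s F v = 0 \<longleftrightarrow> v = s"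
  using reach_sdist[of n s F v] by (auto simp: reach_0)

text \<open>Walks are shortened to paths on the fly: if the next vertex already occurs, the path is
  cut at that occurrence instead of being extended.\<close>

lemma reach_imp_path:
  assumes F: "\<And>e. e \<in> F \<Longrightarrow> e \<subseteq> V" and u: "u \<in> V"
  shows "reach F k u v \<Longrightarrow> \<exists>p. is_path (V, F) u p v \<and> length p - 1 \<le> k"
proof (induction k arbitrary: v)
  case 0
  then show ?case using u by (intro exI[of _ "[u]"]) (auto simp: is_path_def reach_0)
next
  case (Suc k)
  show ?case
  proof (cases "reach F k u v")
    case True
    then show ?thesis using Suc.IH le_Suc_eq by blast
  next
    case False
    with Suc.prems obtain w where w: "reach F k u w" "{w, v} \<in> F" by (rule reach_SucE)
    then obtain p where p: "is_path (V, F) u p w" "length p - 1 \<le> k" using Suc.IH by blast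
    show ?thesis
    proof (cases "v \<in> set p")
      case True
      then obtain i where i: "i < length p" "p ! i = v" by (auto simp: in_set_conv_nth)
      have "last (take (Suc i) p) = v" using i by (simp add: take_Suc_conv_app_nth)
      then have "is_path (V, F) u (take (Suc i) p) v"
        using p(1) i unfolding is_path_def by (auto dest: in_set_takeD)
      then show ?thesis using p(2) i by (intro exI[of _ "take (Suc i) p"]) auto
    next
      case False
      have "{(p @ [v]) ! i, (p @ [v]) ! Suc i} \<in> F" if "Suc i < length (p @ [v])" for i
      proof (cases "Suc i = length p")
        case True
        then have "p ! i = w" using p(1) unfolding is_path_def by (metis diff_Suc_1 last_conv_nth)
        then show ?thesis using True w(2) by (simp add: nth_append)
      next
        case False
        then have "Suc i < length p" using that by simp
        then show ?thesis using p(1) unfolding is_path_def by (simp add: nth_append)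
      qed
      moreover have "v \<in> V" using F[OF w(2)] by simp
      ultimately have "is_path (V, F) u (p @ [v]) v"
        using p(1) False unfolding is_path_def by simp
      moreover have "p \<noteq> []" using p(1) unfolding is_path_def by simp
      ultimately show ?thesis using p(2)
        by (intro exI[of _ "p @ [v]"]) (auto simp: Suc_le_eq Suc_diff_le)
    qed
  qed
qed

lemma path_imp_reach:
  assumes "is_path (V, F) u p v"
  shows "reach F (length p - 1) u v"
proof -
  have "i < length p \<Longrightarrow> reach F i u (p ! i)" for i
  proof (induction i)
    case 0
    then have "p ! 0 = u" using assms unfolding is_path_def by (metis hd_conv_nth)
    then show ?case by simp
  next
    case (Suc i)
    then have "{p ! i, p ! Suc i} \<in> F" using assms unfolding is_path_def by simp
    then show ?case using Suc by (auto intro: reach_trans reach_edge)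
  qed
  then show ?thesis using assms unfolding is_path_def by (metis diff_less last_conv_nth length_greater_0_conv less_one)
qed

text \<open>Bridge between the distances of the theorem and bounded walks. The combinatorial part
  speaks only of \<open>reach\<close>, where concatenation needs no distinctness.\<close>

lemma gdist_le_iff:
  assumes "\<And>e. e \<in> F \<Longrightarrow> e \<subseteq> V" and "u \<in> V"
  shows "gdist u v (V, F) \<le> enat k \<longleftrightarrow> reach F k u v"
proof
  assume "gdist u v (V, F) \<le> enat k"
  then have "gdist u v (V, F) < enat (Suc k)" by (metis enat_ord_simps(2) le_less_trans lessI)
  then obtain p where "is_path (V, F) u p v" "length p - 1 < Suc k"
    unfolding gdist_def by (auto simp: INF_less_iff)
  then show "reach F k u v" using path_imp_reach reach_mono by (metis less_Suc_eq_le order_refl)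
next
  assume "reach F k u v"
  then obtain p where "is_path (V, F) u p v" "length p - 1 \<le> k"
    using reach_imp_path assms by metis
  then show "gdist u v (V, F) \<le> enat k"
    unfolding gdist_def by (intro INF_lower2[of p]) auto
qed

text \<open>A path has at most \<open>n\<close> vertices. Hence \<open>sdist n s F v < n\<close>
  serves throughout as the test for reachability.\<close>

lemma sdist_less:
  assumes "\<And>e. e \<in> F \<Longrightarrow> e \<subseteq> {..<n}" and "s < n" and "reach F k s v"
  shows "sdist n s F v < n"
proof -
  obtain p where p: "is_path ({..<n}, F) s p v"
    using reach_imp_path[of F "{..<n}"] assms by blast
  then have "length p \<le> n"
    unfolding is_path_def using card_mono[of "{..<n}" "set p"] by (simp add: distinct_card)
  with assms(2) have "length p - 1 < n" by linarith
  then show ?thesis using sdist_le[OF path_imp_reach[OF p]] by (metis le_less_trans)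
qed

text \<open>The members of one fibre of \<open>g\<close> have distinct values, all within
  \<open>c\<close> of the smallest one. The keys will be pairs of an anchor and a cluster or of two
  clusters, the values lengths of path segments.\<close>

lemma window_card:
  fixes val :: "'a \<Rightarrow> nat"
  assumes "finite Y" "finite X" "\<And>x. x \<in> X \<Longrightarrow> g x \<in> Y"
    and "\<And>x y. x \<in> X \<Longrightarrow> y \<in> X \<Longrightarrow> g x = g y \<Longrightarrow> val x = val y \<Longrightarrow> x = y"
    and win: "\<And>x y. x \<in> X \<Longrightarrow> y \<in> X \<Longrightarrow> g x = g y \<Longrightarrow> val x \<le> val y + c"
  shows "card X \<le> Suc c * card Y"
proof -
  have "card {x \<in> X. g x = y} \<le> Suc c" for y
  proof (cases "{x \<in> X. g x = y} = {}")
    case False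
    define m where "m = Min (val ` {x \<in> X. g x = y})"
    have "m \<in> val ` {x \<in> X. g x = y}"
      unfolding m_def using False assms(2) by (intro Min_in) auto
    then obtain x where x: "x \<in> X" "g x = y" "m = val x" by auto
    have "m \<le> val x'" if "x' \<in> X" "g x' = y" for x'
      unfolding m_def using that assms(2) by (intro Min_le) auto
    then have "val ` {x \<in> X. g x = y} \<subseteq> {m..m + c}" using x win by force
    then have "card (val ` {x \<in> X. g x = y}) \<le> card {m..m + c}" by (intro card_mono) auto
    moreover have "inj_on val {x \<in> X. g x = y}" using assms(4) by (auto simp: inj_on_def)
    ultimately show ?thesis by (simp add: card_image)
  next
    case True
    then show ?thesis by (simp only: card.empty)
  qed
  then have "(\<Sum>y\<in>Y. card {x \<in> X. g x = y}) \<le> (\<Sum>y\<in>Y. Suc c)"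
    by (intro sum_mono) auto
  moreover have "X = (\<Union>y\<in>Y. {x \<in> X. g x = y})" using assms(3) by auto
  then have "card X \<le> (\<Sum>y\<in>Y. card {x \<in> X. g x = y})"
    using card_UN_le[OF assms(1), of "\<lambda>y. {x \<in> X. g x = y}"] by simp
  ultimately show ?thesis by (simp add: mult.commute)
qed


section \<open>Canonical replacement paths\<close>

definition tree_edge :: "(nat \<Rightarrow> nat) \<Rightarrow> nat \<Rightarrow> nat set" where
  "tree_edge par q = {par q, q}"

definition trace :: "(nat \<Rightarrow> nat) \<Rightarrow> nat \<Rightarrow> nat \<Rightarrow> nat set set" where
  "trace f k v = (\<lambda>m. {f ((f ^^ m) v), (f ^^ m) v}) ` {..<k}"

text \<open>\<open>pr_par\<close> is the preference for tree edges. It excludes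
  \<open>v = q\<close>, whose tree edge is the deleted one, since otherwise it could clash with
  \<open>pr_E\<close>.\<close>

locale replacement_paths =
  fixes n s :: nat and E :: "nat set set" and par :: "nat \<Rightarrow> nat" and pr :: "nat \<Rightarrow> nat \<Rightarrow> nat"
  assumes E_sub: "\<And>e. e \<in> E \<Longrightarrow> e \<subseteq> {..<n}"
    and s_less: "s < n"
    and par_s: "par s = s"
    and par_E: "\<And>v. v \<noteq> s \<Longrightarrow> sdist n s E v < n \<Longrightarrow> {par v, v} \<in> E"
    and par_dep: "\<And>v. v \<noteq> s \<Longrightarrow> sdist n s E v < n \<Longrightarrow> Suc (sdist n s E (par v)) = sdist n s E v"
    and pr_E: "\<And>q v. v \<noteq> s \<Longrightarrow> sdist n s (E - {tree_edge par q}) v < n \<Longrightarrow> {pr q v, v} \<in> E - {tree_edge par q}"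
    and pr_dist: "\<And>q v. v \<noteq> s \<Longrightarrow> sdist n s (E - {tree_edge par q}) v < n \<Longrightarrow>
      Suc (sdist n s (E - {tree_edge par q}) (pr q v)) = sdist n s (E - {tree_edge par q}) v"
    and pr_par: "\<And>q v. v \<noteq> q \<Longrightarrow> sdist n s (E - {tree_edge par q}) v < n \<Longrightarrow>
      Suc (sdist n s (E - {tree_edge par q}) (par v)) = sdist n s (E - {tree_edge par q}) v \<Longrightarrow> pr q v = par v"
begin

abbreviation "dep \<equiv> sdist n s E"
abbreviation "tree q \<equiv> tree_edge par q"
abbreviation "dq q \<equiv> sdist n s (E - {tree q})"
abbreviation "Q \<equiv> {q. q \<noteq> s \<and> dep q < n}"

lemma edge_less: "{u, v} \<in> E \<Longrightarrow> u < n \<and> v < n"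
  using E_sub by fastforce

lemma dep_vertex: "dep v < n \<Longrightarrow> v < n"
  using par_E[of v] edge_less s_less by (cases "v = s") auto

lemma dep_reach: "dep v < n \<Longrightarrow> reach E (dep v) s v"
  using reach_sdist[of n s E v] by simp

lemma dep_less: "reach E k s v \<Longrightarrow> dep v < n"
  by (rule sdist_less) (use E_sub s_less in auto)

lemma dq_reach: "dq q v < n \<Longrightarrow> reach (E - {tree q}) (dq q v) s v"
  using reach_sdist[of n s "E - {tree q}" v] by simp

lemma dq_less: "reach (E - {tree q}) k s v \<Longrightarrow> dq q v < n"
  by (rule sdist_less) (use E_sub s_less in auto)

lemma dep_le_dq: "dq q v < n \<Longrightarrow> dep v \<le> dq q v"
  by (meson dq_reach sdist_le reach_mono Diff_subset order_refl)

lemma dq_dep_less: "dq q v < n \<Longrightarrow> dep v < n"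
  using dep_le_dq by fastforce

lemma dep_lip: "reach E k u v \<Longrightarrow> dep u < n \<Longrightarrow> dep v \<le> dep u + k"
  by (meson dep_reach sdist_le reach_trans order_refl)

lemma dq_lip: "reach (E - {tree q}) k u v \<Longrightarrow> dq q u < n \<Longrightarrow> dq q v \<le> dq q u + k"
  by (meson dq_reach sdist_le reach_trans order_refl)

lemma reach_sym: "reach F k u v \<Longrightarrow> reach F k v u"
proof (induction k arbitrary: v)
  case 0
  then show ?case by (simp add: reach_0)
next
  case (Suc k)
  show ?case
  proof (cases "reach F k u v")
    case True
    then show ?thesis by (meson Suc.IH le_Suc_eq order_refl reach_mono)
  next
    case False
    with Suc.prems obtain w where w: "reach F k u w" "{w, v} \<in> F" by (rule reach_SucE)
    then have "reach F 1 v w" using reach_edge[of v w F] by (simp add: insert_commute)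
    then show ?thesis using Suc.IH[OF w(1)] by (rule reach_trans) simp
  qed
qed

section \<open>Ancestors and descendants in the breadth-first tree\<close>

definition desc :: "nat \<Rightarrow> nat \<Rightarrow> bool" where
  "desc q w \<longleftrightarrow> (\<exists>k. (par ^^ k) w = q)"

lemma par_fix: "(par ^^ k) s = s"
  by (induction k) (simp_all add: par_s)

lemma desc_refl [simp]: "desc q q"
  unfolding desc_def by (intro exI[of _ 0]) simp

lemma desc_par: "desc q w \<longleftrightarrow> w = q \<or> desc q (par w)"
  unfolding desc_def
  by (metis funpow_0 funpow_Suc_right o_apply not0_implies_Suc)

lemma par_reach: "dep v < n \<Longrightarrow> dep (par v) < n"
  using par_dep[of v] par_s by (cases "v = s") auto

lemma desc_dep: "desc q w \<Longrightarrow> dep w < n \<Longrightarrow> dep q \<le> dep w \<and> dep q < n"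
proof (induction "dep w" arbitrary: w rule: less_induct)
  case less
  show ?case
  proof (cases "w = q \<or> w = s")
    case True
    then have "w = q"
      using less.prems(1) par_s unfolding desc_def by (metis par_fix)
    then show ?thesis using less.prems by simp
  next
    case False
    then have "desc q (par w)" using less.prems desc_par by blast
    then show ?thesis using less.hyps[of "par w"] par_dep[of w] par_reach[of w] less.prems False by auto
  qed
qed

lemma desc_eq: "desc q w \<Longrightarrow> dep w < n \<Longrightarrow> dep w \<le> dep q \<Longrightarrow> w = q"
proof -
  assume a: "desc q w" "dep w < n" "dep w \<le> dep q"
  show "w = q"
  proof (rule ccontr)
    assume ne: "w \<noteq> q"
    then have d: "desc q (par w)" using a desc_par by blast
    show False
    proof (cases "w = s")
      case True
      then have "q = s" using a(1) par_s unfolding desc_def by (metis par_fix)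
      then show False using ne True by simp
    next
      case False
      then show False using desc_dep[OF d] par_dep[of w] par_reach[of w] a by linarith
    qed
  qed
qed

text \<open>The ancestors of \<open>w\<close> form a chain ordered by depth; climb from
  \<open>w\<close> until one of the two is met.\<close>

lemma desc_comparable:
  assumes "desc q w" "desc y w" "dep w < n" "dep q \<le> dep y"
  shows "desc q y"
  using assms
proof (induction "dep w" arbitrary: w rule: less_induct)
  case less
  show ?case
  proof (cases "w = y \<or> w = q \<or> w = s")
    case True
    moreover have "desc q y" if "w = q"
      using that less.prems desc_dep[of y w] desc_eq[of y w] by (metis desc_refl)
    moreover have "desc q y" if "w = s"
      using that less.prems par_s unfolding desc_def by (metis par_fix)
    ultimately show ?thesis using less.prems by blast
  next
    case False
    then have "desc q (par w)" "desc y (par w)" using less.prems desc_par by blast+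
    then show ?thesis using less.hyps[of "par w"] par_dep[of w] par_reach[of w] less.prems False by auto
  qed
qed

lemma tree_eq_iff: "q \<in> Q \<Longrightarrow> w \<in> Q \<Longrightarrow> tree w = tree q \<longleftrightarrow> w = q"
proof
  assume a: "q \<in> Q" "w \<in> Q" "tree w = tree q"
  show "w = q"
  proof (rule ccontr)
    assume "w \<noteq> q"
    then have "w = par q" "q = par w" using a(3) unfolding tree_edge_def by (metis doubleton_eq_iff)+
    then show False using par_dep[of w] par_dep[of q] a by fastforce
  qed
qed simp

lemma tree_path:
  assumes "desc y w" "dep w < n" "\<And>x. desc y x \<Longrightarrow> desc x w \<Longrightarrow> x \<noteq> y \<Longrightarrow> tree x \<in> F"
  shows "reach F (dep w - dep y) y w"
  using assms
proof (induction "dep w" arbitrary: w rule: less_induct)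
  case less
  show ?case
  proof (cases "w = y")
    case False
    then have d: "desc y (par w)" using less.prems desc_par by blast
    have ns: "w \<noteq> s"
      using less.prems(1) False par_s unfolding desc_def by (metis par_fix)
    have dp: "Suc (dep (par w)) = dep w" "dep (par w) < n"
      using par_dep par_reach ns less.prems by auto
    have "reach F (dep (par w) - dep y) y (par w)"
    proof (rule less.hyps[OF _ d dp(2)])
      fix x assume "desc y x" "desc x (par w)" "x \<noteq> y"
      then show "tree x \<in> F" using less.prems(3) desc_par by blast
    qed (use dp in simp)
    moreover have "{par w, w} \<in> F" using less.prems False unfolding tree_edge_def by simp
    ultimately have "reach F (dep (par w) - dep y + 1) y w"
      using reach_edge reach_trans order_refl by metis
    moreover have "dep y \<le> dep (par w)" using desc_dep d dp by blast
    then have "dep (par w) - dep y + 1 = dep w - dep y" using dp by linarith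
    ultimately show ?thesis by simp
  qed simp
qed

lemma desc_source: "dep w < n \<Longrightarrow> desc s w"
proof (induction "dep w" arbitrary: w rule: less_induct)
  case less
  then show ?case using par_dep[of w] par_reach[of w] desc_par[of s w] by (cases "w = s") auto
qed

lemma desc_Q: "desc x w \<Longrightarrow> dep w < n \<Longrightarrow> x \<noteq> s \<Longrightarrow> x \<in> Q"
  using desc_dep by auto

lemma desc_trans: "desc x y \<Longrightarrow> desc y z \<Longrightarrow> desc x z"
  unfolding desc_def by (metis funpow_add o_apply)

section \<open>Vertices outside the subtree cut off by a failing tree edge\<close>

lemma outside_reach:
  assumes "q \<in> Q" "dep w < n" "\<not> desc q w" "\<And>x. x \<in> Q \<Longrightarrow> tree x \<in> F"
  shows "reach (F - {tree q}) (dep w) s w"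
proof -
  have "reach (F - {tree q}) (dep w - dep s) s w"
  proof (rule tree_path[OF desc_source])
    fix x assume x: "desc s x" "desc x w" "x \<noteq> s"
    then have "x \<in> Q" using desc_Q assms(2) by blast
    moreover have "x \<noteq> q" using x assms(3) by blast
    ultimately show "tree x \<in> F - {tree q}" using assms tree_eq_iff by auto
  qed (rule assms)+
  then show ?thesis by simp
qed

lemma tree_E: "x \<in> Q \<Longrightarrow> tree x \<in> E"
  unfolding tree_edge_def using par_E by auto

lemma outside_dq:
  assumes "q \<in> Q" "dep w < n" "\<not> desc q w"
  shows "dq q w = dep w"
proof -
  have r: "reach (E - {tree q}) (dep w) s w" using outside_reach[OF assms] tree_E by blast
  then have "dq q w \<le> dep w" by (rule sdist_le)
  moreover have "dep w \<le> dq q w" using dep_le_dq dq_less[OF r] by blast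
  ultimately show ?thesis by simp
qed

text \<open>Distances outside the subtree of \<open>q\<close> do not change, so the parent is still
  a shortest predecessor and the preference for tree edges selects it.\<close>

lemma outside_pr:
  assumes "q \<in> Q" "dep w < n" "\<not> desc q w" "w \<noteq> s"
  shows "pr q w = par w"
proof (rule pr_par)
  have "\<not> desc q (par w)" using assms desc_par by blast
  then have "dq q (par w) = dep (par w)" using outside_dq assms par_reach by blast
  then show "Suc (dq q (par w)) = dq q w" using outside_dq[OF assms(1-3)] par_dep assms by simp
  show "dq q w < n" using outside_dq[OF assms(1-3)] assms(2) by simp
qed (use assms in auto)

text \<open>\<open>on_path q y v\<close>: the vertex \<open>y\<close> lies on the canonical path from \<open>s\<close> to \<open>v\<close> that avoids the
  tree edge above \<open>q\<close>.\<close>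

inductive on_path :: "nat \<Rightarrow> nat \<Rightarrow> nat \<Rightarrow> bool" for q y where
  refl: "on_path q y y"
| step: "on_path q y (pr q v) \<Longrightarrow> v \<noteq> s \<Longrightarrow> on_path q y v"

section \<open>Order and distances along a canonical path\<close>

lemma on_path_trans: "on_path q y w \<Longrightarrow> on_path q x y \<Longrightarrow> on_path q x w"
  by (induction rule: on_path.induct) (auto intro: on_path.step)

lemma pr_less: "v \<noteq> s \<Longrightarrow> dq q v < n \<Longrightarrow> dq q (pr q v) < n"
  using pr_dist by fastforce

lemma on_path_le: "on_path q y v \<Longrightarrow> dq q v < n \<Longrightarrow> dq q y \<le> dq q v"
proof (induction rule: on_path.induct)
  case (step v)
  then show ?case using pr_dist[of v q] pr_less[of v q] by auto
qed simp

lemma on_path_less: "on_path q y v \<Longrightarrow> dq q v < n \<Longrightarrow> dq q y < n"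
  using on_path_le by fastforce

lemma on_path_linear:
  "on_path q y v \<Longrightarrow> on_path q x v \<Longrightarrow> dq q v < n \<Longrightarrow> dq q x \<le> dq q y \<Longrightarrow> on_path q x y"
proof (induction rule: on_path.induct)
  case (step v)
  show ?case
  proof (cases "x = v")
    case True
    then show ?thesis
      using on_path_le[OF step.hyps(1)] pr_less[of v q] pr_dist[of v q] step by auto
  next
    case False
    then have "on_path q x (pr q v)" using step.prems(1) on_path.cases by metis
    then show ?thesis using step pr_less by blast
  qed
qed

lemma on_path_eq: "on_path q y v \<Longrightarrow> dq q v < n \<Longrightarrow> dq q v \<le> dq q y \<Longrightarrow> y = v"
proof (induction rule: on_path.cases)
  case (step v)
  then show ?case
      using on_path_le[OF step(2)] pr_less[of v q] pr_dist[of v q] step by auto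
qed simp

lemma on_path_inj: "on_path q y v \<Longrightarrow> on_path q x v \<Longrightarrow> dq q v < n \<Longrightarrow> dq q x = dq q y \<Longrightarrow> x = y"
  using on_path_eq[OF on_path_linear[of q y v x] on_path_less[of q y v]] by simp

lemma on_path_reach:
  assumes "on_path q w v" "dq q v < n"
    and "\<And>y. on_path q y v \<Longrightarrow> on_path q w y \<Longrightarrow> dq q w < dq q y \<Longrightarrow> {pr q y, y} \<in> F"
  shows "reach F (dq q v - dq q w) w v"
  using assms
proof (induction rule: on_path.induct)
  case (step v)
  have l: "dq q w \<le> dq q (pr q v)" using step.hyps step.prems pr_less on_path_le by blast
  have d: "Suc (dq q (pr q v)) = dq q v" using pr_dist step by blast
  have "{pr q v, v} \<in> F"
    using step.prems(2)[of v] l d step.hyps on_path.intros by auto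
  moreover have "reach F (dq q (pr q v) - dq q w) w (pr q v)"
    using step pr_less on_path.step by blast
  ultimately have "reach F (dq q (pr q v) - dq q w + 1) w v"
    using reach_edge reach_trans order_refl by metis
  then show ?case using l d by (metis Suc_diff_le Suc_eq_plus1)
qed simp

lemma on_path_reach_E:
  assumes "on_path q w v" "dq q v < n"
  shows "reach (E - {tree q}) (dq q v - dq q w) w v"
proof (rule on_path_reach[OF assms])
  fix y assume "on_path q y v" "dq q w < dq q y"
  then show "{pr q y, y} \<in> E - {tree q}"
    using pr_E[of y q] on_path_less assms sdist_source by (metis not_less0)
qed

lemma on_path_source: "dq q v < n \<Longrightarrow> on_path q s v"
proof (induction "dq q v" arbitrary: v rule: less_induct)
  case less
  then show ?case using pr_dist[of v q] pr_less[of v q]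
    by (cases "v = s") (auto intro: on_path.intros)
qed

lemma on_path_dep:
  assumes "on_path q w v" "dq q v < n" shows "dep v \<le> dep w + (dq q v - dq q w)"
proof (rule dep_lip)
  show "reach E (dq q v - dq q w) w v"
    using on_path_reach_E[OF assms] reach_mono Diff_subset order_refl by metis
  show "dep w < n" using assms on_path_less dq_dep_less by blast
qed

text \<open>A discrete intermediate value argument: one step back along the path lowers the depth by
  at most one, and the path starts at depth 0.\<close>

lemma on_path_depth_ivt:
  "dq q v < n \<Longrightarrow> l \<le> dep v \<Longrightarrow> \<exists>r. on_path q r v \<and> dep r = l"
proof (induction "dq q v" arbitrary: v rule: less_induct)
  case less
  show ?case
  proof (cases "l = dep v")
    case True
    then show ?thesis using on_path.refl by blast
  next
    case False
    then have "dep v \<noteq> 0" using less.prems(2) by linarith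
    then have ns: "v \<noteq> s" by (simp add: sdist_eq_0)
    then have "on_path q (pr q v) v" using on_path.step[OF on_path.refl] by simp
    from on_path_dep[OF this less.prems(1)]
    have "l \<le> dep (pr q v)"
      using pr_dist[OF ns less.prems(1)] False less.prems by linarith
    moreover have "dq q (pr q v) < dq q v" using pr_dist[OF ns less.prems(1)] by linarith
    ultimately obtain r where "on_path q r (pr q v)" "dep r = l"
      using less.hyps[OF _ pr_less[OF ns less.prems(1)]] by blast
    then show ?thesis using on_path.step[of q r v] ns by (intro exI[of _ r]) simp
  qed
qed

text \<open>Read contrapositively: a canonical path that has entered the subtree of \<open>q\<close>
  never leaves it.\<close>

lemma on_path_outside:
  "on_path q y v \<Longrightarrow> dq q v < n \<Longrightarrow> q \<in> Q \<Longrightarrow> \<not> desc q v \<Longrightarrow> \<not> desc q y"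
proof (induction rule: on_path.induct)
  case (step v)
  then show ?case using outside_pr[of q v] dq_dep_less desc_par pr_less[of v q] by metis
qed

text \<open>Here the preference for tree edges pays off. If \<open>y\<close> were below
  \<open>q\<close>, the tree path from \<open>y\<close> to \<open>w\<close> would avoid the deleted
  edge, and no segment from \<open>y\<close> to \<open>w\<close> is shorter than the difference of
  depths. So \<open>par w\<close> would be a shortest predecessor of \<open>w\<close>, and
  \<open>pr_par\<close> would have chosen it.\<close>

lemma new_ending:
  assumes q: "q \<in> Q" and w: "dq q w < n" "w \<noteq> s" "{pr q w, w} \<noteq> tree w"
    and y: "on_path q y w" "y \<noteq> w" and d: "desc y w"
  shows "\<not> desc q y"
proof
  assume qy: "desc q y"
  have dw: "dep w < n" using w dq_dep_less by blast
  have qw: "desc q w" using desc_trans qy d by blast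
  have dy: "dq q y < n" using y w on_path_less by blast
  have le: "dep y \<le> dep w" using desc_dep d dw by blast
  have ydw: "dep y < dep w" using desc_eq[OF d dw] le y(2) by linarith
  have pd: "Suc (dep (par w)) = dep w" "dep (par w) < n"
    using par_dep[OF w(2) dw] par_reach[OF dw] by auto
  have dyp: "desc y (par w)" using d y(2) desc_par[of y w] by simp
  have "reach (E - {tree q}) (dep (par w) - dep y) y (par w)"
  proof (rule tree_path[OF dyp pd(2)])
    fix x assume x: "desc y x" "desc x (par w)" "x \<noteq> y"
    have dx: "dep x < n" using x desc_dep pd by blast
    have "x \<noteq> s" using x par_s unfolding desc_def by (metis par_fix)
    then have xQ: "x \<in> Q" using dx by simp
    have "x \<noteq> q" using x(3) desc_eq[OF x(1) dx] desc_dep[OF qy dq_dep_less[OF dy]] by auto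
    then show "tree x \<in> E - {tree q}" using xQ q tree_eq_iff tree_E by auto
  qed
  then have a: "dq q (par w) \<le> dq q y + (dep (par w) - dep y)" using dq_lip dy by blast
  have "dep w \<le> dep y + (dq q w - dq q y)" using on_path_dep y w by blast
  moreover have "dq q y \<le> dq q w" using on_path_le y w by blast
  ultimately have "Suc (dq q (par w)) \<le> dq q w" using a pd ydw by linarith
  moreover have wq: "w \<noteq> q" using desc_dep[OF qy] dq_dep_less[OF dy] ydw by auto
  moreover have "dq q w \<le> Suc (dq q (par w))"
  proof -
    have "tree w \<in> E - {tree q}" using wq q w dw tree_eq_iff tree_E by auto
    then have "reach (E - {tree q}) 1 (par w) w" unfolding tree_edge_def by (rule reach_edge)
    then show ?thesis using dq_lip[of q 1 "par w" w] \<open>Suc (dq q (par w)) \<le> dq q w\<close> w by auto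
  qed
  ultimately have "pr q w = par w" using pr_par w by auto
  then show False using w(3) unfolding tree_edge_def by simp
qed

end


section \<open>Adding replacement paths\<close>

text \<open>If the last edge is present, \<open>v\<close> inherits the error bound of
  \<open>pr q v\<close>, so nothing has to be added. Conversely, a missing last edge makes the
  target itself clustered, which the counting of cluster pairs relies on.\<close>

definition augment :: "nat \<Rightarrow> nat \<Rightarrow> nat set set \<Rightarrow> (nat \<Rightarrow> nat) \<Rightarrow> (nat \<Rightarrow> nat \<Rightarrow> nat) \<Rightarrow>
    nat \<times> nat \<Rightarrow> nat set set \<Rightarrow> nat set set" where
  "augment n s E par pr = (\<lambda>(q, v) H.
     if sdist n s (E - {tree_edge par q}) v < n \<and> v \<noteq> s \<and> {pr q v, v} \<notin> H \<and>
        \<not> reach (H - {tree_edge par q}) (sdist n s (E - {tree_edge par q}) v + 4) s v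
     then H \<union> trace (pr q) (sdist n s (E - {tree_edge par q}) v) v else H)"

lemma trace_Suc: "trace f (Suc k) v = insert {f v, v} (trace f k (f v))"
proof -
  have "trace f (Suc k) v = insert {f v, v} ((\<lambda>m. {f ((f ^^ Suc m) v), (f ^^ Suc m) v}) ` {..<k})"
    unfolding trace_def lessThan_Suc_eq_insert_0 by (simp add: image_image)
  then show ?thesis unfolding trace_def by (simp add: funpow_swap1)
qed

text \<open>\<open>cl v\<close> is \<open>0\<close> for an unclustered \<open>v\<close> and
  otherwise one more than the centre of its star. The assumptions isolate what correctness and
  counting use of the initial structure and of the order of events.\<close>

locale augmentation = replacement_paths +
  fixes L :: nat and cl :: "nat \<Rightarrow> nat" and H0 :: "nat set set" and evs :: "(nat \<times> nat) list"
  assumes H0_sub: "H0 \<subseteq> E"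
    and tree_H0: "\<And>q. q \<in> Q \<Longrightarrow> tree q \<in> H0"
    and light: "\<And>u v. {u, v} \<in> E \<Longrightarrow> cl u = 0 \<Longrightarrow> {u, v} \<in> H0"
    and star: "\<And>v. cl v \<noteq> 0 \<Longrightarrow> {cl v - 1, v} \<in> H0"
    and star_tree: "\<And>v q. cl v \<noteq> 0 \<Longrightarrow> q \<in> Q \<Longrightarrow> {cl v - 1, v} \<noteq> tree q"
    and bottom: "\<And>q w. q \<in> Q \<Longrightarrow> dq q w < n \<Longrightarrow> w \<noteq> s \<Longrightarrow> dep w \<le> dep q + L \<Longrightarrow> {pr q w, w} \<in> H0"
    and evs_Q: "\<And>q v. (q, v) \<in> set evs \<Longrightarrow> q \<in> Q"
    and evs_sorted: "\<And>i j. i < j \<Longrightarrow> j < length evs \<Longrightarrow> dep (fst (evs ! j)) \<le> dep (fst (evs ! i))"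
    and evs_complete: "\<And>q v. q \<in> Q \<Longrightarrow> v < n \<Longrightarrow> (q, v) \<in> set evs"
begin

lemma trace_eq:
  "dq q v < n \<Longrightarrow> trace (pr q) (dq q v) v = {{pr q y, y} | y. on_path q y v \<and> y \<noteq> s}"
proof (induction "dq q v" arbitrary: v rule: less_induct)
  case less
  show ?case
  proof (cases "v = s")
    case True
    have "on_path q y s \<Longrightarrow> y = s" for y by (erule on_path.cases) auto
    then show ?thesis using True by (auto simp: trace_def)
  next
    case False
    have d: "Suc (dq q (pr q v)) = dq q v" using pr_dist False less.prems by blast
    have "on_path q y v \<longleftrightarrow> y = v \<or> on_path q y (pr q v)" for y
      using False on_path.refl[of q v] on_path.step[of q y v] by (auto elim: on_path.cases)
    moreover have "trace (pr q) (dq q v) v = insert {pr q v, v} (trace (pr q) (dq q (pr q v)) (pr q v))"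
      using trace_Suc[of "pr q" "dq q (pr q v)" v] d by simp
    moreover have "trace (pr q) (dq q (pr q v)) (pr q v) = {{pr q y, y} |y. on_path q y (pr q v) \<and> y \<noteq> s}"
      using less.hyps[of "pr q v"] d pr_less[OF False less.prems] by simp
    ultimately show ?thesis using False by auto
  qed
qed

section \<open>The structure before each event\<close>

definition Hs :: "nat \<Rightarrow> nat set set" where
  "Hs k = fold (augment n s E par pr) (take k evs) H0"

abbreviation "qs k \<equiv> fst (evs ! k)"
abbreviation "vs k \<equiv> snd (evs ! k)"

definition buys :: "nat \<Rightarrow> bool" where
  "buys k \<longleftrightarrow> k < length evs \<and> dq (qs k) (vs k) < n \<and> vs k \<noteq> s \<and> {pr (qs k) (vs k), vs k} \<notin> Hs k \<and>
     \<not> reach (Hs k - {tree (qs k)}) (dq (qs k) (vs k) + 4) s (vs k)"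

text \<open>A missing edge is represented by its end farther from \<open>s\<close> on the path, so
  that it can be located by a distance.\<close>

definition miss :: "nat \<Rightarrow> nat set" where
  "miss k = {w. on_path (qs k) w (vs k) \<and> w \<noteq> s \<and> {pr (qs k) w, w} \<notin> Hs k}"

lemma Hs_0: "Hs 0 = H0" by (simp add: Hs_def)

lemma Hs_Suc: "k < length evs \<Longrightarrow> Hs (Suc k) = augment n s E par pr (evs ! k) (Hs k)"
  by (simp add: Hs_def take_Suc_conv_app_nth)

lemma Hs_buys: "buys k \<Longrightarrow> Hs (Suc k) = Hs k \<union> {{pr (qs k) y, y} | y. on_path (qs k) y (vs k) \<and> y \<noteq> s}"
  using Hs_Suc[of k] trace_eq[of "qs k" "vs k"] unfolding buys_def augment_def
  by (simp add: case_prod_unfold)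

lemma Hs_not_buys: "\<not> buys k \<Longrightarrow> Hs (Suc k) = Hs k"
proof (cases "k < length evs")
  case True
  assume "\<not> buys k"
  then show ?thesis
    using True Hs_Suc[of k] unfolding buys_def augment_def by (auto simp add: case_prod_unfold)
next
  case False
  then show ?thesis by (simp add: Hs_def)
qed

lemma Hs_Suc_mono: "Hs k \<subseteq> Hs (Suc k)"
  using Hs_buys Hs_not_buys by (cases "buys k") auto

lemma Hs_mono: "i \<le> k \<Longrightarrow> Hs i \<subseteq> Hs k"
  by (rule lift_Suc_mono_le[of Hs]) (use Hs_Suc_mono in auto)

lemma H0_Hs: "H0 \<subseteq> Hs k" using Hs_mono[of 0 k] Hs_0 by simp

lemma qs_Q: "buys k \<Longrightarrow> qs k \<in> Q"
  unfolding buys_def by (metis evs_Q nth_mem prod.collapse)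

lemma buys_dq: "buys k \<Longrightarrow> dq (qs k) (vs k) < n" unfolding buys_def by simp

lemma Hs_E: "Hs k \<subseteq> E"
proof (induction k)
  case 0
  then show ?case using H0_sub Hs_0 by simp
next
  case (Suc k)
  show ?case
  proof (cases "buys k")
    case True
    have "{pr (qs k) y, y} \<in> E" if "on_path (qs k) y (vs k)" "y \<noteq> s" for y
      using that pr_E[of y "qs k"] on_path_less buys_dq[OF True] by blast
    then show ?thesis using Suc Hs_buys[OF True] by auto
  next
    case False
    then show ?thesis using Suc Hs_not_buys[OF False] by simp
  qed
qed

lemma dep_sorted: "i \<le> k \<Longrightarrow> buys k \<Longrightarrow> dep (qs k) \<le> dep (qs i)"
  using evs_sorted[of i k] unfolding buys_def by (cases "i = k") auto

lemma bought: "buys i \<Longrightarrow> i < k \<Longrightarrow> on_path (qs i) y (vs i) \<Longrightarrow> y \<noteq> s \<Longrightarrow> {pr (qs i) y, y} \<in> Hs k"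
  using Hs_buys[of i] Hs_mono[of "Suc i" k] by auto

section \<open>Where the missing edges of an added path lie\<close>

lemma vs_miss: "buys k \<Longrightarrow> vs k \<in> miss k"
  unfolding buys_def miss_def using on_path.refl by blast

lemma miss_dq: "buys k \<Longrightarrow> w \<in> miss k \<Longrightarrow> dq (qs k) w < n"
  unfolding miss_def using on_path_less buys_dq by blast

lemma miss_dep: "buys k \<Longrightarrow> w \<in> miss k \<Longrightarrow> dep w < n"
  using miss_dq dq_dep_less by blast

lemma miss_ne: "buys k \<Longrightarrow> w \<in> miss k \<Longrightarrow> w \<noteq> s \<and> {pr (qs k) w, w} \<noteq> tree w"
  using tree_H0[of w] H0_Hs[of k] miss_dep[of k w] unfolding miss_def by auto

text \<open>Outside the subtree of the failing edge the path consists of tree edges, and these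
  belong to \<open>H0\<close>.\<close>

lemma miss_desc: "buys k \<Longrightarrow> w \<in> miss k \<Longrightarrow> desc (qs k) w"
  using outside_pr[OF qs_Q, of k w] miss_ne[of k w] miss_dep[of k w] unfolding tree_edge_def by metis

lemma after_miss_desc: "buys k \<Longrightarrow> w \<in> miss k \<Longrightarrow> on_path (qs k) w y \<Longrightarrow> dq (qs k) y < n \<Longrightarrow> desc (qs k) y"
  using on_path_outside[of "qs k" w y] miss_desc qs_Q by blast

lemma miss_clustered: "buys k \<Longrightarrow> w \<in> miss k \<Longrightarrow> cl w \<noteq> 0"
  using light[of w "pr (qs k) w"] pr_E[of w "qs k"] miss_dq[of k w] miss_ne[of k w] H0_Hs[of k]
  unfolding miss_def by (auto simp: insert_commute)

lemma miss_deep: "buys k \<Longrightarrow> w \<in> miss k \<Longrightarrow> dep (qs k) + L < dep w"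
  using bottom[of "qs k" w] qs_Q[of k] miss_dq[of k w] miss_ne[of k w] H0_Hs[of k]
  unfolding miss_def by fastforce

text \<open>Each star used to join or compare path segments costs the 2 edges through its centre;
  the constants 2 and 4 in the comparisons are made of these.\<close>

lemma star_reach:
  assumes "cl x = cl y" "cl x \<noteq> 0" "q \<in> Q" "H0 \<subseteq> F"
  shows "reach (F - {tree q}) 2 x y"
proof -
  have "{cl x - 1, x} \<in> F - {tree q}" "{cl x - 1, y} \<in> F - {tree q}"
    using star[of x] star[of y] star_tree[of x q] star_tree[of y q] assms by auto
  then have "reach (F - {tree q}) 1 x (cl x - 1)" "reach (F - {tree q}) 1 (cl x - 1) y"
    using reach_edge by (metis insert_commute)+
  then show ?thesis by (rule reach_trans) simp
qed

text \<open>Let \<open>u\<close> be the missing vertex nearest to \<open>s\<close> on the path. It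
  lies more than \<open>L\<close> levels below the failing edge, so the part before \<open>u\<close>
  meets every level of the stated range, and all edges of that part are present already.\<close>

lemma anchor_exists:
  assumes b: "buys k" and l: "dep (qs k) \<le> l" "l < dep (qs k) + L"
  shows "\<exists>r. on_path (qs k) r (vs k) \<and> dep r = l \<and> reach (Hs k - {tree (qs k)}) (dq (qs k) r) s r \<and>
    (\<forall>w\<in>miss k. on_path (qs k) r w)"
proof -
  let ?q = "qs k"
  define u where "u = arg_min (dq ?q) (\<lambda>w. w \<in> miss k)"
  have u: "u \<in> miss k" unfolding u_def using vs_miss[OF b] by (rule arg_min_natI)
  have umin: "dq ?q u \<le> dq ?q w" if "w \<in> miss k" for w
    unfolding u_def using that by (rule arg_min_nat_le)
  have du: "dq ?q u < n" using miss_dq b u by blast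
  have onu: "on_path ?q u (vs k)" using u unfolding miss_def by simp
  obtain r where r: "on_path ?q r u" "dep r = l"
    using on_path_depth_ivt[OF du, of l] miss_deep[OF b u] l by auto
  have "r \<noteq> u" using miss_deep[OF b u] r l by auto
  then have ru: "dq ?q r < dq ?q u" using on_path_eq[OF r(1) du] by linarith
  have dr: "dq ?q r < n" using ru du by simp
  have rv: "on_path ?q r (vs k)" using on_path_trans onu r(1) by blast
  have "reach (Hs k - {tree ?q}) (dq ?q r - dq ?q s) s r"
  proof (rule on_path_reach[OF on_path_source[OF dr] dr])
    fix y assume y: "on_path ?q y r" "dq ?q s < dq ?q y"
    have "y \<noteq> s" using y(2) by auto
    moreover have dy: "dq ?q y \<le> dq ?q r" using on_path_le y(1) dr by blast
    moreover have "on_path ?q y (vs k)" using y(1) rv on_path_trans by blast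
    moreover have "y \<notin> miss k" using umin[of y] dy ru by auto
    ultimately have "{pr ?q y, y} \<in> Hs k" unfolding miss_def by blast
    moreover have "{pr ?q y, y} \<noteq> tree ?q" using pr_E[of y ?q] \<open>y \<noteq> s\<close> dy dr by auto
    ultimately show "{pr ?q y, y} \<in> Hs k - {tree ?q}" by blast
  qed
  then have "reach (Hs k - {tree ?q}) (dq ?q r) s r" by simp
  moreover have "on_path ?q r w" if w: "w \<in> miss k" for w
  proof (rule on_path_linear[OF _ rv buys_dq[OF b]])
    show "on_path ?q w (vs k)" using w unfolding miss_def by simp
    show "dq ?q r \<le> dq ?q w" using umin[OF w] ru by simp
  qed
  ultimately show ?thesis using rv r by blast
qed

section \<open>Comparing segments of older and newer paths\<close>

lemma seg_E:
  assumes "on_path q w v" "dq q v < n" "\<And>y. on_path q y v \<Longrightarrow> on_path q w y \<Longrightarrow> dq q w < dq q y \<Longrightarrow> {pr q y, y} \<noteq> e"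
  shows "reach (E - {e}) (dq q v - dq q w) w v"
proof (rule on_path_reach[OF assms(1,2)])
  fix y assume y: "on_path q y v" "on_path q w y" "dq q w < dq q y"
  then have "y \<noteq> s" by auto
  then show "{pr q y, y} \<in> E - {e}" using pr_E[of y q] on_path_less[OF y(1) assms(2)] assms(3)[OF y] by auto
qed

text \<open>Otherwise the path would meet the tree path of its own target below the failing edge, and its
  last edge would be a tree edge.\<close>

lemma segment_hits:
  assumes k: "buys k" and x: "x \<in> miss k" and q': "q' \<in> Q" "dep (qs k) \<le> dep q'"
    and y: "on_path (qs k) y x" "y \<noteq> s" "{pr (qs k) y, y} = tree q'"
  shows "\<not> desc q' x"
proof
  assume d: "desc q' x"
  let ?q = "qs k"
  have dx: "dep x < n" "dq ?q x < n" using miss_dep miss_dq k x by blast+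
  have dy: "dq ?q y < n" using on_path_less y dx by blast
  have "par q' \<in> {pr ?q y, y}" using y unfolding tree_edge_def by blast
  then have on: "on_path ?q (par q') x"
    using y(1) on_path_trans on_path.step[OF on_path.refl y(2), of ?q] by (metis insertE singletonD)
  have dpx: "desc (par q') x" using d desc_trans[of "par q'" q' x] desc_par[of "par q'" q'] by simp
  have "par q' \<noteq> x"
    using par_dep[of q'] q' desc_dep[OF d dx(1)] by fastforce
  moreover have "desc ?q (par q')"
  proof -
    have "tree q' \<noteq> tree ?q" using pr_E[OF y(2) dy] y(3) by auto
    then have "q' \<noteq> ?q" by auto
    moreover have "desc ?q q'" using desc_comparable[OF miss_desc[OF k x] d dx(1)] q' by simp
    ultimately show ?thesis using desc_par[of ?q q'] by simp
  qed
  ultimately show False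
    using new_ending[OF qs_Q[OF k] dx(2) _ _ on _ dpx] miss_ne[OF k x] by blast
qed

text \<open>The older segment is shortest among walks avoiding the edge above \<open>qs i\<close>.
  If the newer segment avoids that edge too, following it and then one star costs at most 2 more.
  Otherwise \<open>segment_hits\<close> puts \<open>w\<close> outside the subtree of
  \<open>qs i\<close>, where distances equal depths, and comparing depths gives the same
  bound.\<close>

lemma pre_window:
  assumes i: "buys i" "w' \<in> miss i" and k: "buys k" "w \<in> miss k" and ik: "i \<le> k"
    and r: "on_path (qs i) r w'" "on_path (qs k) r w" and c: "cl w' = cl w"
  shows "dq (qs i) w' - dq (qs i) r \<le> dq (qs k) w - dq (qs k) r + 2"
proof -
  let ?q = "qs k" and ?q' = "qs i"
  have dw: "dq ?q w < n" "dep w < n" "dq ?q' w' < n" using miss_dep miss_dq k i by blast+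
  have Q': "?q' \<in> Q" "dep ?q \<le> dep ?q'" using qs_Q i dep_sorted[OF ik k(1)] by auto
  have st: "reach (E - {tree ?q'}) 2 w w'"
    using star_reach[OF c[symmetric] miss_clustered[OF k] Q'(1) H0_sub] .
  have r': "dq ?q' r < n" using on_path_less[OF r(1)] dw by blast
  show ?thesis
  proof (cases "\<forall>y. on_path ?q y w \<longrightarrow> on_path ?q r y \<longrightarrow> dq ?q r < dq ?q y \<longrightarrow> {pr ?q y, y} \<noteq> tree ?q'")
    case True
    then have "reach (E - {tree ?q'}) (dq ?q w - dq ?q r) r w"
      using seg_E[OF r(2) dw(1)] by blast
    then have "reach (E - {tree ?q'}) (dq ?q w - dq ?q r + 2) r w'"
      using st by (rule reach_trans) simp
    then show ?thesis using dq_lip r' by fastforce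
  next
    case False
    then obtain y where y: "on_path ?q y w" "dq ?q r < dq ?q y" "{pr ?q y, y} = tree ?q'" by blast
    have ys: "y \<noteq> s" using y(2) by auto
    have nd: "\<not> desc ?q' w" using segment_hits[OF k Q' y(1) ys y(3)] .
    have "dq ?q' w = dep w" using outside_dq[OF Q'(1) dw(2) nd] .
    then have "dq ?q' w' \<le> dep w + 2" using dq_lip[OF st] dw by simp
    moreover have "dep w \<le> dep r + (dq ?q w - dq ?q r)" using on_path_dep[OF r(2) dw(1)] .
    moreover have "dep r \<le> dq ?q' r" using dep_le_dq r' by blast
    ultimately show ?thesis by linarith
  qed
qed

text \<open>As in \<open>pre_window\<close>, but a star is needed at both ends, hence 4. If the
  newer segment uses the edge above \<open>qs i\<close>, then \<open>vs k\<close> lies outside the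
  subtree of \<open>qs i\<close>. The tree and a star, both in \<open>H0\<close>, then reach
  \<open>vs i\<close> within error 4, so event \<open>i\<close> would have added nothing.\<close>

lemma suf_window:
  assumes i: "buys i" "w' \<in> miss i" and k: "buys k" "w \<in> miss k" and ik: "i \<le> k"
    and c: "cl w' = cl w" and cv: "cl (vs i) = cl (vs k)"
  shows "dq (qs i) (vs i) - dq (qs i) w' \<le> dq (qs k) (vs k) - dq (qs k) w + 4"
proof -
  let ?q = "qs k" and ?q' = "qs i"
  have onw: "on_path ?q w (vs k)" and onw': "on_path ?q' w' (vs i)" using k i unfolding miss_def by auto
  have dv: "dq ?q (vs k) < n" "dep (vs k) < n" "dq ?q' (vs i) < n" "dq ?q' w' < n"
    using buys_dq i k vs_miss miss_dep miss_dq by blast+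
  have Q': "?q' \<in> Q" "dep ?q \<le> dep ?q'" using qs_Q i dep_sorted[OF ik k(1)] by auto
  have st: "reach (E - {tree ?q'}) 2 w' w"
    using star_reach[OF c miss_clustered[OF i] Q'(1) H0_sub] .
  have stH: "reach (Hs i - {tree ?q'}) 2 (vs k) (vs i)"
    using star_reach[OF cv[symmetric] miss_clustered[OF k(1) vs_miss[OF k(1)]] Q'(1) H0_Hs] .
  then have stv: "reach (E - {tree ?q'}) 2 (vs k) (vs i)"
    by (rule reach_mono) (use Hs_E in auto)
  show ?thesis
  proof (cases "\<forall>y. on_path ?q y (vs k) \<longrightarrow> on_path ?q w y \<longrightarrow> dq ?q w < dq ?q y \<longrightarrow> {pr ?q y, y} \<noteq> tree ?q'")
    case True
    then have "reach (E - {tree ?q'}) (dq ?q (vs k) - dq ?q w) w (vs k)"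
      using seg_E[OF onw dv(1)] by blast
    then have "reach (E - {tree ?q'}) (2 + (dq ?q (vs k) - dq ?q w)) w' (vs k)"
      by (rule reach_trans[OF st _ order_refl])
    then have "reach (E - {tree ?q'}) (dq ?q (vs k) - dq ?q w + 4) w' (vs i)"
      using stv by (rule reach_trans) simp
    then show ?thesis using dq_lip dv by fastforce
  next
    case False
    then obtain y where y: "on_path ?q y (vs k)" "dq ?q w < dq ?q y" "{pr ?q y, y} = tree ?q'" by blast
    have ys: "y \<noteq> s" using y(2) by auto
    have nd: "\<not> desc ?q' (vs k)" using segment_hits[OF k(1) vs_miss[OF k(1)] Q' y(1) ys y(3)] .
    have "reach (Hs i - {tree ?q'}) (dep (vs k)) s (vs k)"
      by (rule outside_reach[OF Q'(1) dv(2) nd]) (use tree_H0 H0_Hs in blast)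
    then have R: "reach (Hs i - {tree ?q'}) (dep (vs k) + 2) s (vs i)"
      using stH by (rule reach_trans) simp
    \<comment> \<open>The star read backwards: \<open>vs k\<close> is at most 2 farther away than
      \<open>vs i\<close>. Both uses of the star together make the error 4.\<close>
    have "reach (E - {tree ?q'}) 2 (vs i) (vs k)" by (rule reach_sym[OF stv])
    then have "dep (vs k) \<le> dq ?q' (vs i) + 2"
      using dq_lip[of ?q' 2 "vs i" "vs k"] dv(3) outside_dq[OF Q'(1) dv(2) nd] by simp
    then have "reach (Hs i - {tree ?q'}) (dq ?q' (vs i) + 4) s (vs i)"
      using R by (elim reach_mono) auto
    then show ?thesis using i unfolding buys_def by blast
  qed
qed

text \<open>A use of the edge above \<open>qs k\<close> would put its upper end
  \<open>par (qs k)\<close> on the segment after \<open>w\<close>. By the order of events this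
  vertex is too shallow to lie below \<open>qs i\<close>. If \<open>w\<close> was missing, the path
  is already inside the subtree of \<open>qs i\<close> and cannot leave it. If \<open>w\<close> has
  depth at least \<open>dep (qs k)\<close>, it is farther from \<open>s\<close> than
  \<open>par (qs k)\<close>, so it cannot precede it.\<close>

lemma bought_segment_avoids:
  assumes ik: "i < k" and i: "buys i" and k: "buys k"
    and v: "on_path (qs i) v (vs i)" and w: "on_path (qs i) w v"
    and h: "w \<in> miss i \<or> dep (qs k) \<le> dep w"
  shows "reach (Hs k - {tree (qs k)}) (dq (qs i) v - dq (qs i) w) w v"
proof (rule on_path_reach[OF w])
  let ?q = "qs k" and ?q' = "qs i"
  show dv: "dq ?q' v < n" using on_path_less[OF v] buys_dq[OF i] .
  have Q': "?q \<in> Q" "?q' \<in> Q" "dep ?q \<le> dep ?q'" using qs_Q i k dep_sorted[OF _ k] ik by auto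
  have pq: "Suc (dep (par ?q)) = dep ?q" "dep (par ?q) < n" using par_dep par_reach Q' by auto
  fix y assume y: "on_path ?q' y v" "on_path ?q' w y" "dq ?q' w < dq ?q' y"
  have ys: "y \<noteq> s" using y by auto
  have "{pr ?q' y, y} \<in> Hs k" using bought[OF i ik on_path_trans[OF v y(1)] ys] .
  moreover have "{pr ?q' y, y} \<noteq> tree ?q"
  proof
    assume "{pr ?q' y, y} = tree ?q"
    then have "par ?q \<in> {pr ?q' y, y}" unfolding tree_edge_def by blast
    moreover have "on_path ?q' w (pr ?q' y)"
      using y(2,3) by (auto elim: on_path.cases)
    ultimately have wp: "on_path ?q' w (par ?q)" and pv: "on_path ?q' (par ?q) v"
      using y(1,2) on_path_trans on_path.step[OF on_path.refl ys, of ?q'] by (metis insertE singletonD)+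
    have dp: "dq ?q' (par ?q) < n" using on_path_less[OF pv dv] .
    have nd: "\<not> desc ?q' (par ?q)" using desc_dep[of ?q' "par ?q"] pq Q' by linarith
    from h show False
    proof
      assume "w \<in> miss i"
      then show False using after_miss_desc[OF i _ wp dp] nd by blast
    next
      assume dw: "dep ?q \<le> dep w"
      have "dq ?q' (par ?q) = dep (par ?q)" using outside_dq Q' pq nd by blast
      moreover have "dq ?q' w \<le> dq ?q' (par ?q)" using on_path_le[OF wp dp] .
      moreover have "dep w \<le> dq ?q' w" using dep_le_dq on_path_less[OF w dv] by blast
      ultimately show False using dw pq by linarith
    qed
  qed
  ultimately show "{pr ?q' y, y} \<in> Hs k - {tree ?q}" by blast
qed

text \<open>The two old pieces may come from different events \<open>i\<close> and \<open>j\<close>;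
  only their clusters have to match, first at \<open>w\<close> and then at the target. The composed
  walk contradicts the decision to buy at event \<open>k\<close>.\<close>

lemma no_shortcut:
  assumes k: "buys k" and w: "w \<in> miss k"
    and r: "dep (qs k) \<le> dep r" "on_path (qs k) r w" "reach (Hs k - {tree (qs k)}) (dq (qs k) r) s r"
    and i: "i < k" "buys i" "x \<in> miss i" "on_path (qs i) r x" "cl x = cl w"
      "dq (qs i) x - dq (qs i) r \<le> dq (qs k) w - dq (qs k) r"
    and j: "j < k" "buys j" "y \<in> miss j" "cl y = cl w" "cl (vs j) = cl (vs k)"
      "dq (qs j) (vs j) - dq (qs j) y \<le> dq (qs k) (vs k) - dq (qs k) w"
  shows False
proof -
  let ?H = "Hs k - {tree (qs k)}"
  have on: "on_path (qs i) x (vs i)" "on_path (qs j) y (vs j)" "on_path (qs k) w (vs k)"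
    using i j w unfolding miss_def by auto
  have le: "dq (qs k) r \<le> dq (qs k) w" "dq (qs k) w \<le> dq (qs k) (vs k)"
    using on_path_le r on miss_dq[OF k w] buys_dq[OF k] by blast+
  have "reach ?H (dq (qs i) x - dq (qs i) r) r x"
    using bought_segment_avoids[OF i(1,2) k on(1) i(4)] r by blast
  then have 1: "reach ?H (dq (qs k) w) s x"
    by (rule reach_trans[OF r(3)]) (use i(6) le in linarith)
  have "reach ?H 2 x y"
    using star_reach[of x y "qs k" "Hs k"] i(5) j(4) miss_clustered[OF k w] qs_Q[OF k] H0_Hs by simp
  with 1 have 2: "reach ?H (dq (qs k) w + 2) s y" by (rule reach_trans) simp
  have "reach ?H (dq (qs j) (vs j) - dq (qs j) y) y (vs j)"
    using bought_segment_avoids[OF j(1,2) k on_path.refl on(2)] j(3) by blast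
  with 2 have 3: "reach ?H (dq (qs k) (vs k) + 2) s (vs j)"
    by (rule reach_trans) (use j(6) le in linarith)
  have "reach ?H 2 (vs j) (vs k)"
    using star_reach[OF j(5) miss_clustered[OF j(2) vs_miss[OF j(2)]] qs_Q[OF k] H0_Hs] .
  with 3 have "reach ?H (dq (qs k) (vs k) + 4) s (vs k)" by (rule reach_trans) simp
  then show False using k unfolding buys_def by blast
qed

end


section \<open>Counting the added edges\<close>

lemma exists_small_residue_class:
  fixes f :: "nat \<Rightarrow> nat"
  assumes "finite A" "0 < L"
  shows "\<exists>c<L. L * card {x \<in> A. f x mod L = c} \<le> card A"
proof (rule ccontr)
  assume "\<not> ?thesis"
  then have a: "\<And>c. c < L \<Longrightarrow> card A < L * card {x \<in> A. f x mod L = c}" by (auto simp: not_le)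
  have "(\<Union>c<L. {x \<in> A. f x mod L = c}) = A" using assms(2) by auto
  moreover have "card (\<Union>c<L. {x \<in> A. f x mod L = c}) = (\<Sum>c<L. card {x \<in> A. f x mod L = c})"
    using assms(1) by (intro card_UN_disjoint) auto
  ultimately have "L * card A = (\<Sum>c<L. L * card {x \<in> A. f x mod L = c})"
    by (simp add: sum_distrib_left)
  also have "\<dots> > (\<Sum>c<L. card A)"
    using a assms(2) by (intro sum_strict_mono) auto
  finally show False by simp
qed

context augmentation
begin

definition clusters :: "nat set" where
  "clusters = cl ` {..<n} - {0}"

lemma added_le:
  assumes "0 < L"
  obtains R :: "nat set" where "finite R" "L * card R \<le> n"
    "card (Hs (length evs) - H0) \<le> 3 * (card R * card clusters) + 5 * (card clusters * card clusters)"
proof -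
  obtain c where c: "c < L" "L * card {x \<in> {..<n}. dep x mod L = c} \<le> n"
    using exists_small_residue_class[of "{..<n}" L dep] assms by auto
  define R where "R = {x \<in> {..<n}. dep x mod L = c}"
  have "\<exists>r. r \<in> R \<and> dep (qs k) \<le> dep r \<and> on_path (qs k) r (vs k) \<and>
      reach (Hs k - {tree (qs k)}) (dq (qs k) r) s r \<and> (\<forall>w\<in>miss k. on_path (qs k) r w)" if k: "buys k" for k
  proof -
    let ?d = "dep (qs k)"
    \<comment> \<open>The least level that is at least \<open>?d\<close> and has residue
      \<open>c\<close>. Adding \<open>L\<close> first keeps the truncated subtraction exact.\<close>
    define l where "l = ?d + (c + L - ?d mod L) mod L"
    have "?d mod L < L" using assms by simp
    have "l mod L = (?d + (c + L - ?d mod L)) mod L" unfolding l_def by (simp add: mod_simps)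
    also have "\<dots> = (?d mod L + (c + L - ?d mod L)) mod L" by (simp add: mod_simps)
    also have "?d mod L + (c + L - ?d mod L) = c + L" using \<open>?d mod L < L\<close> by linarith
    also have "(c + L) mod L = c" using c(1) by simp
    finally have lc: "l mod L = c" .
    have "l < ?d + L" unfolding l_def using assms by simp
    moreover have "?d \<le> l" unfolding l_def by simp
    ultimately obtain r where r: "on_path (qs k) r (vs k)" "dep r = l"
        "reach (Hs k - {tree (qs k)}) (dq (qs k) r) s r" "\<forall>w\<in>miss k. on_path (qs k) r w"
      using anchor_exists[OF k] by blast
    then have "dep r < n" using dq_dep_less on_path_less buys_dq[OF k] by blast
    then have "r \<in> R" unfolding R_def using dep_vertex r(2) lc by simp
    then show ?thesis using r \<open>?d \<le> l\<close> by blast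
  qed
  then obtain rr where rr: "\<And>k. buys k \<Longrightarrow> rr k \<in> R \<and> dep (qs k) \<le> dep (rr k) \<and> on_path (qs k) (rr k) (vs k) \<and>
      reach (Hs k - {tree (qs k)}) (dq (qs k) (rr k)) s (rr k) \<and> (\<forall>w\<in>miss k. on_path (qs k) (rr k) w)"
    by metis
  define pre where "pre = (\<lambda>(k, w). dq (qs k) w - dq (qs k) (rr k))"
  define suf where "suf = (\<lambda>(k, w). dq (qs k) (vs k) - dq (qs k) w)"
  define g1 where "g1 = (\<lambda>(k, w). (rr k, cl w))"
  define g2 where "g2 = (\<lambda>(k, w :: nat). (cl w, cl (vs k)))"
  define X where "X = {(k, w). buys k \<and> w \<in> miss k}"
  \<comment> \<open>\<open>X1\<close> and \<open>X2\<close> collect the missing edges that beat all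
    earlier events in the length of the segment before or after them. Members of the same event are
    not compared, since one path may enter a cluster several times.\<close>
  define X1 where "X1 = {x \<in> X. \<forall>y\<in>X. fst y < fst x \<longrightarrow> g1 y = g1 x \<longrightarrow> pre x < pre y}"
  define X2 where "X2 = {x \<in> X. \<forall>y\<in>X. fst y < fst x \<longrightarrow> g2 y = g2 x \<longrightarrow> suf x < suf y}"
  have missn: "w < n" if "buys k" "w \<in> miss k" for k w using dep_vertex miss_dep that by blast
  have "X \<subseteq> {..<length evs} \<times> {..<n}" unfolding X_def using missn by (auto simp: buys_def)
  then have finX: "finite X" by (rule finite_subset) simp
  have clK: "cl w \<in> clusters" if "buys k" "w \<in> miss k" for k w
    unfolding clusters_def using missn that miss_clustered by auto
  have finR: "finite R" and finK: "finite clusters" unfolding R_def clusters_def by auto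
  have same: "x = y" if xy: "x \<in> X" "y \<in> X" "fst x = fst y" and d: "dq (qs (fst x)) (snd x) = dq (qs (fst x)) (snd y)" for x y
  proof -
    have "on_path (qs (fst x)) (snd x) (vs (fst x))" "on_path (qs (fst x)) (snd y) (vs (fst x))" "buys (fst x)"
      using xy unfolding X_def miss_def by auto
    then have "snd x = snd y" using on_path_inj buys_dq d by metis
    then show ?thesis using xy(3) by (rule prod_eqI[rotated])
  qed
  have le: "dq (qs k) (rr k) \<le> dq (qs k) w \<and> dq (qs k) w \<le> dq (qs k) (vs k)" if "buys k" "w \<in> miss k" for k w
    using on_path_le rr miss_dq buys_dq that unfolding miss_def by blast
  \<comment> \<open>If neither record were broken, the earlier entries \<open>y\<close> and
    \<open>z\<close> responsible for this would supply the two old pieces that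
    \<open>no_shortcut\<close> excludes.\<close>
  have X12: "X \<subseteq> X1 \<union> X2"
  proof
    fix x assume x: "x \<in> X"
    show "x \<in> X1 \<union> X2"
    proof (rule ccontr)
      assume "x \<notin> X1 \<union> X2"
      then obtain y z where y: "y \<in> X" "fst y < fst x" "g1 y = g1 x" "pre y \<le> pre x"
        and z: "z \<in> X" "fst z < fst x" "g2 z = g2 x" "suf z \<le> suf x"
        using x unfolding X1_def X2_def by (auto simp: not_less)
      obtain k w i a j b where xyz: "x = (k, w)" "y = (i, a)" "z = (j, b)" by (metis surj_pair)
      show False
        using no_shortcut[of k w "rr k" i a j b] rr[of k] rr[of i] x y z
        unfolding xyz X_def g1_def g2_def pre_def suf_def by auto
    qed
  qed
  \<comment> \<open>Against an earlier event the value is smaller by the definition of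
    \<open>X1\<close>; against the same or a later event \<open>pre_window\<close> applies.\<close>
  have pw: "pre x \<le> pre y + 2" if "x \<in> X1" "y \<in> X1" "g1 x = g1 y" for x y
  proof (cases "fst y < fst x")
    case True
    then show ?thesis using that unfolding X1_def by fastforce
  next
    case False
    obtain i a k w where xy: "x = (i, a)" "y = (k, w)" by (metis surj_pair)
    show ?thesis using pre_window[of i a k w "rr k"] rr[of i] rr[of k] that False
      unfolding xy X1_def X_def g1_def pre_def by auto
  qed
  have sw: "suf x \<le> suf y + 4" if "x \<in> X2" "y \<in> X2" "g2 x = g2 y" for x y
  proof (cases "fst y < fst x")
    case True
    then show ?thesis using that unfolding X2_def by fastforce
  next
    case False
    obtain i a k w where xy: "x = (i, a)" "y = (k, w)" by (metis surj_pair)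
    show ?thesis using suf_window[of i a k w] that False
      unfolding xy X2_def X_def g2_def suf_def by auto
  qed
  \<comment> \<open>Equal keys and equal values force the same event, because of two events the
    later one has the strictly smaller value. Within one event the value determines the distance
    from \<open>s\<close> and hence the vertex.\<close>
  have "card X1 \<le> Suc 2 * card (R \<times> clusters)"
  proof (rule window_card[of _ _ g1 pre])
    fix x y assume xy: "x \<in> X1" "y \<in> X1" "g1 x = g1 y" "pre x = pre y"
    then have "fst x = fst y"
      unfolding X1_def using nat_neq_iff[of "fst x" "fst y"] by auto
    moreover have "x \<in> X" "y \<in> X" using xy unfolding X1_def by auto
    ultimately show "x = y"
      using xy(4) le[of "fst x" "snd x"] le[of "fst y" "snd y"] same[of x y]
      unfolding X_def pre_def by (auto simp: case_prod_unfold)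
  qed (use finR finK finX clK rr pw in \<open>auto simp: X1_def X_def g1_def\<close>)
  moreover have "card X2 \<le> Suc 4 * card (clusters \<times> clusters)"
  proof (rule window_card[of _ _ g2 suf])
    fix x y assume xy: "x \<in> X2" "y \<in> X2" "g2 x = g2 y" "suf x = suf y"
    then have "fst x = fst y"
      unfolding X2_def using nat_neq_iff[of "fst x" "fst y"] by auto
    moreover have "x \<in> X" "y \<in> X" using xy unfolding X2_def by auto
    ultimately show "x = y"
      using xy(4) le[of "fst x" "snd x"] le[of "fst y" "snd y"] same[of x y]
      unfolding X_def suf_def by (auto simp: case_prod_unfold)
  qed (use finK finX clK vs_miss sw in \<open>auto simp: X2_def X_def g2_def\<close>)
  moreover have "card X \<le> card X1 + card X2"
  proof -
    have "card X \<le> card (X1 \<union> X2)"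
      using X12 finX by (intro card_mono) (auto simp: X1_def X2_def)
    then show ?thesis using card_Un_le[of X1 X2] by linarith
  qed
  moreover have "card (Hs (length evs) - H0) \<le> card X"
  proof (rule surj_card_le[OF finX, of _ "\<lambda>(k, w). {pr (qs k) w, w}"])
    have "Hs m - H0 \<subseteq> (\<lambda>(k, w). {pr (qs k) w, w}) ` X" for m
    proof (induction m)
      case 0
      then show ?case by (simp add: Hs_0)
    next
      case (Suc m)
      show ?case
      proof (cases "buys m")
        case bm: True
        show ?thesis
        proof
          fix e assume e: "e \<in> Hs (Suc m) - H0"
          show "e \<in> (\<lambda>(k, w). {pr (qs k) w, w}) ` X"
          proof (cases "e \<in> Hs m")
            case True
            then have "e \<in> Hs m - H0" using e by simp
            then show ?thesis by (rule subsetD[OF Suc.IH])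
          next
            case False
            then have "e \<in> {{pr (qs m) y, y} | y. on_path (qs m) y (vs m) \<and> y \<noteq> s}"
              using e unfolding Hs_buys[OF bm] by simp
            then obtain y where y: "e = {pr (qs m) y, y}" "on_path (qs m) y (vs m)" "y \<noteq> s" by auto
            then have "(m, y) \<in> X" using False bm unfolding X_def miss_def by simp
            then show ?thesis by (rule rev_image_eqI) (simp add: y(1))
          qed
        qed
      next
        case False
        then show ?thesis using Suc Hs_not_buys[OF False] by simp
      qed
    qed
    then show "Hs (length evs) - H0 \<subseteq> (\<lambda>(k, w). {pr (qs k) w, w}) ` X" .
  qed
  ultimately have "card (Hs (length evs) - H0) \<le> 3 * (card R * card clusters) + 5 * (card clusters * card clusters)"
    by (simp add: card_cartesian_product)
  then show ?thesis by (rule that[OF finR c(2)[folded R_def]])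
qed

text \<open>Induction along the canonical path. If the last edge is present in the end, the walk to
  \<open>pr q v\<close> is extended by it and the error does not grow. Otherwise the event for
  \<open>(q, v)\<close> added nothing although the last edge was missing, so \<open>v\<close> was
  close enough at that time.\<close>

lemma final_tree_edge:
  assumes q: "q \<in> Q"
  shows "dq q v < n \<Longrightarrow> reach (Hs (length evs) - {tree q}) (dq q v + 4) s v"
proof (induction "dq q v" arbitrary: v rule: less_induct)
  case less
  let ?H = "Hs (length evs)"
  show ?case
  proof (cases "v = s")
    case False
    have v: "v < n" using dep_vertex dq_dep_less less.prems by blast
    obtain k where k: "k < length evs" "evs ! k = (q, v)"
      using evs_complete[OF q v] by (auto simp: in_set_conv_nth)
    have sub: "Hs k \<subseteq> ?H" "Hs (Suc k) \<subseteq> ?H" using Hs_mono k by auto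
    show ?thesis
    proof (cases "{pr q v, v} \<in> ?H")
      case True
      have d: "Suc (dq q (pr q v)) = dq q v" "dq q (pr q v) < n"
        using pr_dist pr_less False less.prems by blast+
      then have "reach (?H - {tree q}) (dq q (pr q v) + 4) s (pr q v)" using less.hyps by simp
      moreover have "reach (?H - {tree q}) 1 (pr q v) v"
        using True pr_E[OF False less.prems] by (intro reach_edge) blast
      ultimately show ?thesis by (rule reach_trans) (use d in simp)
    next
      case nin: False
      then have "{pr q v, v} \<notin> Hs k" using sub by blast
      moreover have "\<not> buys k"
      proof
        assume "buys k"
        from Hs_buys[OF this] have "{pr q v, v} \<in> Hs (Suc k)" using k False on_path.refl by auto
        then show False using nin sub by blast
      qed
      ultimately have "reach (Hs k - {tree q}) (dq q v + 4) s v"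
        using k False less.prems unfolding buys_def by auto
      then show ?thesis by (rule reach_mono) (use sub in auto)
    qed
  qed simp
qed

text \<open>If \<open>e\<close> is not a tree edge, the tree inside \<open>H0\<close> survives and
  gives exact distances.\<close>

lemma final_stretch:
  assumes r: "reach (E - {e}) k s v"
  shows "reach (Hs (length evs) - {e}) (k + 4) s v"
proof (cases "\<exists>q\<in>Q. e = tree q")
  case True
  then obtain q where q: "q \<in> Q" "e = tree q" by blast
  have "dq q v \<le> k" "dq q v < n" using r q dq_less sdist_le by auto
  then show ?thesis using reach_mono[OF final_tree_edge[OF q(1), of v] order_refl] q(2) by simp
next
  case False
  have rE: "reach E k s v" using r by (rule reach_mono) auto
  have dv: "dep v < n" "dep v \<le> k" using dep_less[OF rE] sdist_le[OF rE] by auto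
  have "reach (Hs (length evs) - {e}) (dep v - dep s) s v"
  proof (rule tree_path[OF desc_source[OF dv(1)] dv(1)])
    fix x assume "desc s x" "desc x v" "x \<noteq> s"
    then have "x \<in> Q" using desc_Q dv(1) by blast
    then show "tree x \<in> Hs (length evs) - {e}" using False tree_H0 H0_Hs by blast
  qed
  then show ?thesis by (rule reach_mono) (use dv in auto)
qed

end


section \<open>For-programs and their running time\<close>

text \<open>The only loop runs \<open>n\<close> times, and \<open>wf_prog\<close> protects its bound
  and counter. Termination and polynomial time thus follow from the syntax, and correctness can be
  shown for the functional meaning \<open>run\<close>.\<close>

datatype prog =
    Put string "aexp list" aexp
  | Then prog prog (infixr \<open>;;\<close> 60)
  | Cond bexp prog
  | For string prog

definition put :: "store \<Rightarrow> string \<Rightarrow> nat list \<Rightarrow> nat \<Rightarrow> store" where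
  "put \<sigma> x is a = \<sigma>(x := (\<sigma> x)(is := a))"

lemma put_apply: "put \<sigma> x is a y js = (if y = x \<and> js = is then a else \<sigma> y js)"
  by (simp add: put_def)

lemma put_other: "y \<noteq> x \<Longrightarrow> put \<sigma> x is a y = \<sigma> y"
  by (simp add: put_def)

primrec run :: "prog \<Rightarrow> store \<Rightarrow> store" where
  "run (Put x es a) = (\<lambda>\<sigma>. put \<sigma> x (map (\<lambda>e. aval e \<sigma>) es) (aval a \<sigma>))"
| "run (c1 ;; c2) = (\<lambda>\<sigma>. run c2 (run c1 \<sigma>))"
| "run (Cond b c) = (\<lambda>\<sigma>. if bval b \<sigma> then run c \<sigma> else \<sigma>)"
| "run (For x c) = (\<lambda>\<sigma>. ((\<lambda>\<tau>. put (run c \<tau>) x [] (Suc (run c \<tau> x []))) ^^ (\<sigma> ''n'' [])) (put \<sigma> x [] 0))"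

primrec compile :: "prog \<Rightarrow> com" where
  "compile (Put x es a) = Assign x es a"
| "compile (c1 ;; c2) = Seq (compile c1) (compile c2)"
| "compile (Cond b c) = If b (compile c) Skip"
| "compile (For x c) = Seq (Assign x [] (Const 0))
     (While (Less (Read x []) (Read ''n'' []))
       (Seq (compile c) (Assign x [] (Plus (Read x []) (Const 1)))))"

primrec writes :: "prog \<Rightarrow> string set" where
  "writes (Put x es a) = {x}"
| "writes (c1 ;; c2) = writes c1 \<union> writes c2"
| "writes (Cond b c) = writes c"
| "writes (For x c) = insert x (writes c)"

primrec wf_prog :: "prog \<Rightarrow> bool" where
  "wf_prog (Put x es a) \<longleftrightarrow> x \<noteq> ''n''"
| "wf_prog (c1 ;; c2) \<longleftrightarrow> wf_prog c1 \<and> wf_prog c2"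
| "wf_prog (Cond b c) \<longleftrightarrow> wf_prog c"
| "wf_prog (For x c) \<longleftrightarrow> x \<noteq> ''n'' \<and> x \<notin> writes c \<and> wf_prog c"

lemma run_frame: "y \<notin> writes c \<Longrightarrow> run c \<sigma> y = \<sigma> y"
proof (induction c arbitrary: \<sigma>)
  case (For x c)
  have "((\<lambda>\<tau>. put (run c \<tau>) x [] (Suc (run c \<tau> x []))) ^^ m) \<tau> y = \<tau> y" for m \<tau>
    using For by (induction m) (simp_all add: put_other)
  then show ?case using For.prems by (simp add: put_other)
qed (simp_all add: put_other)

lemma wf_writes: "wf_prog c \<Longrightarrow> ''n'' \<notin> writes c"
  by (induction c) auto

text \<open>\<open>step\<close> receives the counter value and the frame of the body as facts, so an
  invariant needs to mention only the arrays that change. \<open>indep\<close> accounts for the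
  updates of the counter between two rounds.\<close>

lemma For_rule:
  assumes wf: "wf_prog (For x c)" and base: "I 0 \<sigma>"
    and step: "\<And>i \<tau>. i < \<sigma> ''n'' [] \<Longrightarrow> \<tau> x [] = i \<Longrightarrow> (\<And>y. y \<noteq> x \<Longrightarrow> y \<notin> writes c \<Longrightarrow> \<tau> y = \<sigma> y) \<Longrightarrow>
      I i \<tau> \<Longrightarrow> I (Suc i) (run c \<tau>)"
    and indep: "\<And>i \<tau> a. I i \<tau> \<Longrightarrow> I i (put \<tau> x [] a)"
  shows "I (\<sigma> ''n'' []) (run (For x c) \<sigma>)"
proof -
  let ?f = "\<lambda>\<tau>. put (run c \<tau>) x [] (Suc (run c \<tau> x []))"
  have "I m ((?f ^^ m) (put \<sigma> x [] 0)) \<and> (?f ^^ m) (put \<sigma> x [] 0) x [] = m \<and>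
    (\<forall>y. y \<noteq> x \<longrightarrow> y \<notin> writes c \<longrightarrow> (?f ^^ m) (put \<sigma> x [] 0) y = \<sigma> y)" if "m \<le> \<sigma> ''n'' []" for m
    using that
  proof (induction m)
    case 0
    have "I 0 (put \<sigma> x [] 0)" using base by (rule indep)
    then show ?case by (simp add: put_other) (simp add: put_def)
  next
    case (Suc m)
    define \<tau> where "\<tau> = (?f ^^ m) (put \<sigma> x [] 0)"
    have IH: "I m \<tau>" "\<tau> x [] = m" "\<And>y. y \<noteq> x \<Longrightarrow> y \<notin> writes c \<Longrightarrow> \<tau> y = \<sigma> y"
      using Suc unfolding \<tau>_def by auto
    then have "I (Suc m) (run c \<tau>)" using step[of m \<tau>] Suc.prems by simp
    moreover have "run c \<tau> x [] = m" using IH(2) run_frame[of x c \<tau>] wf by simp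
    moreover have "(?f ^^ Suc m) (put \<sigma> x [] 0) = ?f \<tau>" unfolding \<tau>_def by simp
    moreover have "I (Suc m) (?f \<tau>)" using \<open>I (Suc m) (run c \<tau>)\<close> by (rule indep)
    moreover have "?f \<tau> x [] = Suc m" using \<open>run c \<tau> x [] = m\<close> by (simp add: put_def)
    moreover have "?f \<tau> y = \<sigma> y" if "y \<noteq> x" "y \<notin> writes c" for y
      using that IH(3) run_frame by (metis put_other)
    ultimately show ?case by presburger
  qed
  then show ?thesis by simp
qed

text \<open>One polynomial has to serve all stores, so it is built by recursion on the program; that
  \<open>n\<close> is never overwritten lets the bounds of consecutive parts be added.\<close>

lemma exec_compile:
  "wf_prog c \<Longrightarrow> \<exists>p :: nat poly. \<forall>\<sigma>. \<exists>t. exec (compile c) \<sigma> t (run c \<sigma>) \<and> t \<le> poly p (\<sigma> ''n'' [])"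
proof (induction c)
  case (Put x es a)
  have "exec (compile (Put x es a)) \<sigma> (1 + sum_list (map acost es) + acost a) (run (Put x es a) \<sigma>)" for \<sigma>
    using exec.Assign[of x es a \<sigma>] by (simp add: put_def)
  then show ?case by (intro exI[of _ "[:1 + sum_list (map acost es) + acost a:]"]) fastforce
next
  case (Then c1 c2)
  then obtain p1 p2 :: "nat poly" where
    p1: "\<And>\<sigma>. \<exists>t. exec (compile c1) \<sigma> t (run c1 \<sigma>) \<and> t \<le> poly p1 (\<sigma> ''n'' [])" and
    p2: "\<And>\<sigma>. \<exists>t. exec (compile c2) \<sigma> t (run c2 \<sigma>) \<and> t \<le> poly p2 (\<sigma> ''n'' [])"
    by auto
  show ?case
  proof (intro exI[of _ "p1 + p2"] allI)
    fix \<sigma>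
    obtain t1 t2 where t: "exec (compile c1) \<sigma> t1 (run c1 \<sigma>)" "t1 \<le> poly p1 (\<sigma> ''n'' [])"
      "exec (compile c2) (run c1 \<sigma>) t2 (run c2 (run c1 \<sigma>))" "t2 \<le> poly p2 (run c1 \<sigma> ''n'' [])"
      using p1 p2 by meson
    have "run c1 \<sigma> ''n'' = \<sigma> ''n''" using Then.prems wf_writes run_frame by simp
    then show "\<exists>t. exec (compile (c1 ;; c2)) \<sigma> t (run (c1 ;; c2) \<sigma>) \<and> t \<le> poly (p1 + p2) (\<sigma> ''n'' [])"
      using exec.Seq[OF t(1,3)] t(2,4) by (intro exI[of _ "t1 + t2"]) simp
  qed
next
  case (Cond b c)
  then obtain p :: "nat poly" where
    p: "\<And>\<sigma>. \<exists>t. exec (compile c) \<sigma> t (run c \<sigma>) \<and> t \<le> poly p (\<sigma> ''n'' [])"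
    by auto
  show ?case
  proof (intro exI[of _ "p + [:2 + bcost b:]"] allI)
    fix \<sigma>
    obtain t where t: "exec (compile c) \<sigma> t (run c \<sigma>)" "t \<le> poly p (\<sigma> ''n'' [])"
      using p by blast
    show "\<exists>t. exec (compile (Cond b c)) \<sigma> t (run (Cond b c) \<sigma>) \<and> t \<le> poly (p + [:2 + bcost b:]) (\<sigma> ''n'' [])"
    proof (cases "bval b \<sigma>")
      case True
      then show ?thesis using exec.IfTrue[OF True t(1), of Skip] t(2) by (intro exI[of _ "1 + bcost b + t"]) simp
    next
      case False
      then show ?thesis using exec.IfFalse[OF False exec.Skip, of "compile c"]
        by (intro exI[of _ "1 + bcost b + 1"]) simp
    qed
  qed
next
  case (For x c)
  then obtain p :: "nat poly" where
    p: "\<And>\<sigma>. \<exists>t. exec (compile c) \<sigma> t (run c \<sigma>) \<and> t \<le> poly p (\<sigma> ''n'' [])"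
    by auto
  let ?b = "Less (Read x []) (Read ''n'' [])"
  let ?w = "While ?b (Seq (compile c) (Assign x [] (Plus (Read x []) (Const 1))))"
  let ?f = "\<lambda>\<tau>. put (run c \<tau>) x [] (Suc (run c \<tau> x []))"
  have wf: "x \<noteq> ''n''" "x \<notin> writes c" "''n'' \<notin> writes c" using For.prems wf_writes by auto
  \<comment> \<open>Generalised to \<open>m\<close> remaining rounds. The 8 pays for a successful
    test and the increment, 4 each; the separate 4 is the final failing test.\<close>
  have loop: "\<exists>t. exec ?w \<sigma> t ((?f ^^ m) \<sigma>) \<and> t \<le> 4 + m * (poly p (\<sigma> ''n'' []) + 8)"
    if "\<sigma> x [] + m = \<sigma> ''n'' []" for m \<sigma>
    using that
  proof (induction m arbitrary: \<sigma>)
    case 0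
    then have "exec ?w \<sigma> (1 + bcost ?b) \<sigma>" by (intro exec.WhileFalse) simp
    then show ?case by (intro exI[of _ "1 + bcost ?b"]) simp
  next
    case (Suc m)
    obtain t where t: "exec (compile c) \<sigma> t (run c \<sigma>)" "t \<le> poly p (\<sigma> ''n'' [])" using p by blast
    have "exec (Assign x [] (Plus (Read x []) (Const 1))) (run c \<sigma>) 4 (?f \<sigma>)"
      using exec.Assign[of x "[]" "Plus (Read x []) (Const 1)" "run c \<sigma>"]
      by (simp add: put_def numeral_eq_Suc)
    then have body: "exec (Seq (compile c) (Assign x [] (Plus (Read x []) (Const 1)))) \<sigma> (t + 4) (?f \<sigma>)"
      using t(1) by (rule exec.Seq[rotated])
    have f: "?f \<sigma> x [] = Suc (\<sigma> x [])" "?f \<sigma> ''n'' = \<sigma> ''n''"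
      using wf run_frame[of x c \<sigma>] run_frame[of "''n''" c \<sigma>] by (simp_all add: put_apply put_other)
    then obtain t' where t': "exec ?w (?f \<sigma>) t' ((?f ^^ m) (?f \<sigma>))" "t' \<le> 4 + m * (poly p (\<sigma> ''n'' []) + 8)"
      using Suc.IH[of "?f \<sigma>"] Suc.prems by auto
    have e: "exec ?w \<sigma> (1 + bcost ?b + (t + 4) + t') ((?f ^^ m) (?f \<sigma>))"
      using Suc.prems by (intro exec.WhileTrue[OF _ body t'(1)]) simp
    have "(?f ^^ Suc m) \<sigma> = (?f ^^ m) (?f \<sigma>)"
      by (simp add: funpow_Suc_right del: funpow.simps)
    then have "exec ?w \<sigma> (1 + bcost ?b + (t + 4) + t') ((?f ^^ Suc m) \<sigma>)" using e by (simp only:)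
    moreover have "1 + bcost ?b + (t + 4) + t' \<le> 4 + Suc m * (poly p (\<sigma> ''n'' []) + 8)"
      using t(2) t'(2) by simp
    ultimately show ?case by blast
  qed
  \<comment> \<open>The 6 consists of the initial assignment (2) and the final test (4).\<close>
  show ?case
  proof (intro exI[of _ "[:6:] + [:0, 1:] * (p + [:8:])"] allI)
    fix \<sigma>
    let ?s = "put \<sigma> x [] 0"
    have 1: "exec (Assign x [] (Const 0)) \<sigma> 2 ?s"
      using exec.Assign[of x "[]" "Const 0" \<sigma>] by (simp add: put_def numeral_eq_Suc)
    have n: "?s ''n'' = \<sigma> ''n''" using wf by (simp add: put_other)
    have "?s x [] + \<sigma> ''n'' [] = ?s ''n'' []" using wf by (simp add: put_apply)
    from loop[of ?s "\<sigma> ''n'' []", OF this] obtain t where t: "exec ?w ?s t ((?f ^^ (\<sigma> ''n'' [])) ?s)"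
      "t \<le> 4 + \<sigma> ''n'' [] * (poly p (?s ''n'' []) + 8)" by blast
    then show "\<exists>t. exec (compile (For x c)) \<sigma> t (run (For x c) \<sigma>) \<and>
        t \<le> poly ([:6:] + [:0, 1:] * (p + [:8:])) (\<sigma> ''n'' [])"
      using exec.Seq[OF 1 t(1)] n by (intro exI[of _ "2 + t"]) simp
  qed
qed


section \<open>Programs for distances and predecessors\<close>

declare run.simps(4) [simp del]

abbreviation V :: "string \<Rightarrow> aexp" where "V x \<equiv> Read x []"

definition matrix :: "store \<Rightarrow> string \<Rightarrow> nat \<Rightarrow> nat set set \<Rightarrow> bool" where
  "matrix \<sigma> X n F \<longleftrightarrow> (\<forall>u<n. \<forall>v<n. \<sigma> X [u, v] = (if {u, v} \<in> F then 1 else 0))"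

lemma matrix_cong: "\<sigma> X = \<tau> X \<Longrightarrow> matrix \<sigma> X n F = matrix \<tau> X n F"
  by (simp add: matrix_def)

text \<open>The deleted edge is given by the scalars \<open>p\<close> and \<open>q\<close>, so the
  same code treats a graph and all its versions with one edge deleted.\<close>

definition edge_test :: "string \<Rightarrow> aexp \<Rightarrow> aexp \<Rightarrow> bexp" where
  "edge_test X u v = Conj (Equal (Read X [u, v]) (Const 1))
     (Conj (Neg (Conj (Equal u (V ''p'')) (Equal v (V ''q''))))
           (Neg (Conj (Equal u (V ''q'')) (Equal v (V ''p'')))))"

lemma bval_edge_test:
  assumes "matrix \<sigma> X n F" "aval u \<sigma> < n" "aval v \<sigma> < n"
  shows "bval (edge_test X u v) \<sigma> \<longleftrightarrow> {aval u \<sigma>, aval v \<sigma>} \<in> F - {{\<sigma> ''p'' [], \<sigma> ''q'' []}}"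
  using assms by (auto simp: edge_test_def matrix_def doubleton_eq_iff)

definition relax :: "string \<Rightarrow> string \<Rightarrow> prog" where
  "relax X D = Cond (Conj (edge_test X (V ''a'') (V ''b''))
       (Less (Plus (Read D [V ''a'']) (Const 1)) (Read D [V ''b''])))
     (Put D [V ''b''] (Plus (Read D [V ''a'']) (Const 1)))"

lemma writes_relax [simp]: "writes (relax X D) = {D}"
  by (simp add: relax_def)

lemma wf_relax [simp]: "wf_prog (relax X D) \<longleftrightarrow> D \<noteq> ''n''"
  by (simp add: relax_def)

definition distances :: "string \<Rightarrow> string \<Rightarrow> prog" where
  "distances X D =
     For ''a'' (Put D [V ''a''] (Plus (V ''n'') (Const 5))) ;;
     Put D [V ''s''] (Const 0) ;;
     For ''k'' (For ''a'' (For ''b'' (relax X D)))"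

text \<open>The invariant of Bellman-Ford after \<open>k\<close> full rounds, with \<open>S\<close>
  the pairs already treated in the next round. It consists of bounds instead of equations because
  updates happen in place and values may run ahead of the round.\<close>

definition relaxed :: "nat \<Rightarrow> nat \<Rightarrow> nat set set \<Rightarrow> nat \<Rightarrow> (nat \<times> nat) set \<Rightarrow> (nat \<Rightarrow> nat) \<Rightarrow> bool" where
  "relaxed n s F k S d \<longleftrightarrow>
     (\<forall>v<n. d v = n + 5 \<or> d v < n + 5 \<and> reach F (d v) s v) \<and>
     (\<forall>v<n. \<forall>m\<le>k. reach F m s v \<longrightarrow> d v \<le> m) \<and>
     (\<forall>(u, v)\<in>S. \<forall>m\<le>k. reach F m s u \<longrightarrow> {u, v} \<in> F \<longrightarrow> d v \<le> Suc m)"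

lemma relaxed_step:
  assumes "relaxed n s F k S d" "u < n" "v < n"
  shows "relaxed n s F k (insert (u, v) S) (if {u, v} \<in> F \<and> d u + 1 < d v then d(v := d u + 1) else d)"
    (is "relaxed n s F k _ ?d")
  unfolding relaxed_def
proof (intro conjI allI impI ballI)
  fix w assume w: "w < n"
  show "?d w = n + 5 \<or> ?d w < n + 5 \<and> reach F (?d w) s w"
  proof (cases "{u, v} \<in> F \<and> d u + 1 < d v \<and> w = v")
    case True
    moreover have "d v \<le> n + 5" "d u = n + 5 \<or> reach F (d u) s u"
      using assms unfolding relaxed_def by fastforce+
    \<comment> \<open>The default \<open>n + 5\<close> is never propagated: a strict improvement of
      a value that is at most \<open>n + 5\<close> forces \<open>d u < n + 5\<close>.\<close>
    ultimately have "reach F (d u) s u" "d u + 1 < n + 5" by linarith+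
    then show ?thesis using True reach_trans[OF _ reach_edge[of u v F] order_refl] by auto
  qed (use assms w in \<open>auto simp: relaxed_def\<close>)
next
  fix w m assume "w < n" "m \<le> k" "reach F m s w"
  then have "d w \<le> m" using assms unfolding relaxed_def by blast
  then show "?d w \<le> m" by auto
next
  fix x assume x: "x \<in> insert (u, v) S"
  show "case x of (u, v) \<Rightarrow> \<forall>m\<le>k. reach F m s u \<longrightarrow> {u, v} \<in> F \<longrightarrow> ?d v \<le> Suc m"
  proof (cases "x = (u, v)")
    case True
    have "?d v \<le> Suc m" if "m \<le> k" "reach F m s u" "{u, v} \<in> F" for m
    proof -
      have "d u \<le> m" using that assms unfolding relaxed_def by blast
      then show ?thesis using that by auto
    qed
    then show ?thesis using True by simp
  next
    case False
    obtain y z where yz: "x = (y, z)" by (metis surj_pair)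
    have "d z \<le> Suc m" if "m \<le> k" "reach F m s y" "{y, z} \<in> F" for m
      using x False yz that assms(1) unfolding relaxed_def by blast
    then show ?thesis unfolding yz by fastforce
  qed
qed

lemma relaxed_round:
  assumes "relaxed n s F k ({..<n} \<times> {..<n}) d" "\<And>e. e \<in> F \<Longrightarrow> e \<subseteq> {..<n}"
  shows "relaxed n s F (Suc k) {} d"
proof -
  have "d v \<le> m" if v: "v < n" "m \<le> Suc k" "reach F m s v" for v m
  proof (cases "\<exists>j\<le>k. j \<le> m \<and> reach F j s v")
    case True
    then obtain j where "j \<le> k" "j \<le> m" "reach F j s v" by blast
    moreover from this have "d v \<le> j" using assms(1) v(1) unfolding relaxed_def by blast
    ultimately show ?thesis by simp
  next
    case False
    then have m: "m = Suc k" using v by (metis le_Suc_eq order_refl)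
    then obtain w where w: "reach F k s w" "{w, v} \<in> F"
      using reach_SucE[of F k s v] v(3) False by auto
    have "w < n" using assms(2)[OF w(2)] by simp
    then show ?thesis using w m v(1) assms(1) unfolding relaxed_def by blast
  qed
  then show ?thesis using assms(1) unfolding relaxed_def by blast
qed

text \<open>\<open>n\<close> rounds suffice because finite distances are below \<open>n\<close>. A
  value other than the default is the length of a walk, which gives the converse inequality.\<close>

lemma relaxed_sdist:
  assumes r: "relaxed n s F n {} d" and F: "\<And>e. e \<in> F \<Longrightarrow> e \<subseteq> {..<n}" and sv: "s < n" "v < n"
  shows "d v = sdist n s F v"
proof (cases "\<exists>k. reach F k s v")
  case True
  then have less: "sdist n s F v < n" using sdist_less[OF F sv(1)] by blast
  then have "reach F (sdist n s F v) s v" by (intro reach_sdist) simp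
  then have le: "d v \<le> sdist n s F v" using r less sv(2) unfolding relaxed_def by simp
  then have "d v \<noteq> n + 5" using less by simp
  then have "reach F (d v) s v" using r sv(2) unfolding relaxed_def by blast
  then show ?thesis using sdist_le le by (simp add: le_antisym)
next
  case False
  then show ?thesis using r sv(2) unfolding relaxed_def sdist_def by auto
qed

lemma writes_distances [simp]: "writes (distances X D) = {''a'', ''b'', ''k'', D}"
  by (auto simp: distances_def)

lemma wf_distances [simp]:
  "D \<notin> {''n'', ''a'', ''b'', ''k''} \<Longrightarrow> wf_prog (distances X D)"
  by (auto simp: distances_def)

lemma run_distances:
  assumes D0: "D \<notin> {''n'', ''s'', ''p'', ''q'', ''a'', ''b'', ''k''}"
    and X: "X \<notin> {D, ''a'', ''b'', ''k''}"
    and M: "matrix \<sigma> X n F" and n: "\<sigma> ''n'' [] = n" and s: "\<sigma> ''s'' [] = s" "s < n"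
    and F: "\<And>e. e \<in> F \<Longrightarrow> e \<subseteq> {..<n}" and v: "v < n"
  shows "run (distances X D) \<sigma> D [v] = sdist n s (F - {{\<sigma> ''p'' [], \<sigma> ''q'' []}}) v"
proof -
  have D: "D \<notin> {''n'', ''s'', ''p'', ''q'', ''a'', ''b'', ''k''}"
    "''n'' \<noteq> D" "''s'' \<noteq> D" "''p'' \<noteq> D" "''q'' \<noteq> D" "''a'' \<noteq> D" "''b'' \<noteq> D" "''k'' \<noteq> D"
    using D0 by auto
  let ?F = "F - {{\<sigma> ''p'' [], \<sigma> ''q'' []}}"
  let ?arr = "\<lambda>\<tau> v. \<tau> D [v]"
  have F': "e \<in> ?F \<Longrightarrow> e \<subseteq> {..<n}" for e using F by blast
  define \<sigma>1 where "\<sigma>1 = run (For ''a'' (Put D [V ''a''] (Plus (V ''n'') (Const 5)))) \<sigma>"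
  define \<sigma>2 where "\<sigma>2 = run (Put D [V ''s''] (Const 0)) \<sigma>1"
  have "\<forall>v < \<sigma> ''n'' []. \<sigma>1 D [v] = n + 5"
    unfolding \<sigma>1_def
    by (rule For_rule[where I = "\<lambda>i \<tau>. \<forall>v<i. \<tau> D [v] = n + 5"])
       (use D n in \<open>auto simp: put_def less_Suc_eq\<close>)
  then have init: "\<sigma>1 D [v] = n + 5" if "v < n" for v using that n by simp
  have same1: "\<sigma>1 y = \<sigma> y" if "y \<notin> {D, ''a''}" for y
    unfolding \<sigma>1_def using that by (intro run_frame) auto
  have same2: "\<sigma>2 y = \<sigma> y" if "y \<notin> {D, ''a''}" for y
    unfolding \<sigma>2_def using that same1 by (simp add: put_other)
  have "\<sigma>2 D [v] = (if v = s then 0 else n + 5)" if "v < n" for v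
    unfolding \<sigma>2_def using init[OF that] same1[of "''s''"] D s by (auto simp: put_def)
  then have start: "relaxed n s ?F 0 {} (?arr \<sigma>2)"
    unfolding relaxed_def by (auto simp: reach_0)
  have "relaxed n s ?F (\<sigma>2 ''n'' []) {} (?arr (run (For ''k'' (For ''a'' (For ''b'' (relax X D)))) \<sigma>2))"
  proof (rule For_rule[where I = "\<lambda>k \<tau>. relaxed n s ?F k {} (?arr \<tau>)"])
    fix k \<tau> assume k: "relaxed n s ?F k {} (?arr \<tau>)"
      and "\<And>y. y \<noteq> ''k'' \<Longrightarrow> y \<notin> writes (For ''a'' (For ''b'' (relax X D))) \<Longrightarrow> \<tau> y = \<sigma>2 y"
    then have same3: "\<tau> y = \<sigma> y" if "y \<notin> {D, ''a'', ''b'', ''k''}" for y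
      using that same2 by auto
    have "relaxed n s ?F k ({..<\<tau> ''n'' []} \<times> {..<n}) (?arr (run (For ''a'' (For ''b'' (relax X D))) \<tau>))"
    proof (rule For_rule[where I = "\<lambda>a \<tau>. relaxed n s ?F k ({..<a} \<times> {..<n}) (?arr \<tau>)"])
      fix a \<tau>' assume a: "relaxed n s ?F k ({..<a} \<times> {..<n}) (?arr \<tau>')" "a < \<tau> ''n'' []" "\<tau>' ''a'' [] = a"
        and "\<And>y. y \<noteq> ''a'' \<Longrightarrow> y \<notin> writes (For ''b'' (relax X D)) \<Longrightarrow> \<tau>' y = \<tau> y"
      then have same4: "\<tau>' y = \<sigma> y" if "y \<notin> {D, ''a'', ''b'', ''k''}" for y
        using that same3 by auto
      have an: "a < n" using a(2) same3 n D by simp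
      have "relaxed n s ?F k ({..<a} \<times> {..<n} \<union> {a} \<times> {..<\<tau>' ''n'' []}) (?arr (run (For ''b'' (relax X D)) \<tau>'))"
      proof (rule For_rule[where I = "\<lambda>b \<tau>. relaxed n s ?F k ({..<a} \<times> {..<n} \<union> {a} \<times> {..<b}) (?arr \<tau>)"])
        fix b \<tau>'' assume b: "relaxed n s ?F k ({..<a} \<times> {..<n} \<union> {a} \<times> {..<b}) (?arr \<tau>'')"
            "b < \<tau>' ''n'' []" "\<tau>'' ''b'' [] = b"
          and same: "\<And>y. y \<noteq> ''b'' \<Longrightarrow> y \<notin> writes (relax X D) \<Longrightarrow> \<tau>'' y = \<tau>' y"
        have same5: "\<tau>'' y = \<sigma> y" if "y \<notin> {D, ''a'', ''b'', ''k''}" for y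
          using that same same4 by auto
        have ta: "\<tau>'' ''a'' [] = a" using same[of "''a''"] a(3) D by auto
        have bn: "b < n" using b(2) same4 n D by simp
        have "matrix \<tau>'' X n F" using M same5 X matrix_cong by metis
        then have test: "bval (edge_test X (V ''a'') (V ''b'')) \<tau>'' \<longleftrightarrow> {a, b} \<in> ?F"
          using bval_edge_test[of \<tau>'' X n F "V ''a''" "V ''b''"] ta b(3) an bn same5 D by simp
        have "?arr (run (relax X D) \<tau>'') =
            (if {a, b} \<in> ?F \<and> ?arr \<tau>'' a + 1 < ?arr \<tau>'' b then (?arr \<tau>'')(b := ?arr \<tau>'' a + 1) else ?arr \<tau>'')"
          unfolding relax_def using test ta b(3) by (auto simp: put_def fun_eq_iff)
        then have "relaxed n s ?F k (insert (a, b) ({..<a} \<times> {..<n} \<union> {a} \<times> {..<b})) (?arr (run (relax X D) \<tau>''))"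
          using relaxed_step[OF b(1) an bn] by simp
        moreover have "insert (a, b) ({..<a} \<times> {..<n} \<union> {a} \<times> {..<b}) = {..<a} \<times> {..<n} \<union> {a} \<times> {..<Suc b}"
          by auto
        ultimately show "relaxed n s ?F k ({..<a} \<times> {..<n} \<union> {a} \<times> {..<Suc b}) (?arr (run (relax X D) \<tau>''))"
          by simp
      qed (use a D in \<open>simp_all add: put_other\<close>)
      moreover have "\<tau>' ''n'' [] = n" using same4[of "''n''"] n D by simp
      then have "{..<a} \<times> {..<n} \<union> {a} \<times> {..<\<tau>' ''n'' []} = {..<Suc a} \<times> {..<n}" by auto
      ultimately show "relaxed n s ?F k ({..<Suc a} \<times> {..<n}) (?arr (run (For ''b'' (relax X D)) \<tau>'))"
        by simp
    qed (use k D in \<open>simp_all add: put_other\<close>)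
    moreover have "\<tau> ''n'' [] = n" using same3 n D by simp
    ultimately show "relaxed n s ?F (Suc k) {} (?arr (run (For ''a'' (For ''b'' (relax X D))) \<tau>))"
      using F' by (intro relaxed_round) simp_all
  qed (use start D in \<open>simp_all add: put_other\<close>)
  moreover have "\<sigma>2 ''n'' [] = n" using same2 n D by simp
  ultimately have "relaxed n s ?F n {} (?arr (run (distances X D) \<sigma>))"
    unfolding distances_def \<sigma>1_def \<sigma>2_def by simp
  from relaxed_sdist[OF this F' s(2) v] show ?thesis .
qed

text \<open>\<open>Max\<close> matches the program, which scans \<open>u\<close> in increasing order
  and lets every hit overwrite the previous one.\<close>

definition pred_of :: "nat \<Rightarrow> nat set set \<Rightarrow> (nat \<Rightarrow> nat) \<Rightarrow> nat \<Rightarrow> nat" where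
  "pred_of n F d v = Max {u. u < n \<and> {u, v} \<in> F \<and> Suc (d u) = d v}"

lemma pred_of:
  assumes "\<exists>u<n. {u, v} \<in> F \<and> Suc (d u) = d v"
  shows "pred_of n F d v < n" "{pred_of n F d v, v} \<in> F" "Suc (d (pred_of n F d v)) = d v"
proof -
  have "pred_of n F d v \<in> {u. u < n \<and> {u, v} \<in> F \<and> Suc (d u) = d v}"
    unfolding pred_of_def using assms by (intro Max_in) auto
  then show "pred_of n F d v < n" "{pred_of n F d v, v} \<in> F" "Suc (d (pred_of n F d v)) = d v" by auto
qed

lemma sdist_pred:
  assumes F: "\<And>e. e \<in> F \<Longrightarrow> e \<subseteq> {..<n}" and v: "v \<noteq> s" "sdist n s F v < n"
  shows "\<exists>u<n. {u, v} \<in> F \<and> Suc (sdist n s F u) = sdist n s F v"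
proof -
  have r: "reach F (sdist n s F v) s v" using v(2) by (intro reach_sdist) simp
  obtain k where k: "sdist n s F v = Suc k" using v(1) sdist_eq_0 by (metis not0_implies_Suc)
  then have "\<not> reach F k s v" using sdist_le[of F k s v n] by auto
  then obtain w where w: "reach F k s w" "{w, v} \<in> F" using r k reach_SucE by metis
  have "sdist n s F w \<le> k" using sdist_le w(1) by blast
  moreover have "reach F (sdist n s F w) s w" using calculation v(2) k by (intro reach_sdist) simp
  then have "reach F (sdist n s F w + 1) s v" using reach_trans reach_edge[OF w(2)] order_refl by metis
  then have "Suc k \<le> sdist n s F w + 1" using sdist_le k by metis
  ultimately show ?thesis using w(2) F[OF w(2)] k by (intro exI[of _ w]) auto
qed

definition predecessors :: "string \<Rightarrow> string \<Rightarrow> prog" where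
  "predecessors D R = For ''a'' (For ''b''
     (Cond (Conj (edge_test ''G'' (V ''b'') (V ''a''))
                 (Equal (Plus (Read D [V ''b'']) (Const 1)) (Read D [V ''a''])))
       (Put R [V ''a''] (V ''b''))))"

lemma writes_predecessors [simp]: "writes (predecessors D R) = {''a'', ''b'', R}"
  by (auto simp: predecessors_def)

lemma wf_predecessors [simp]: "R \<notin> {''n'', ''a'', ''b''} \<Longrightarrow> wf_prog (predecessors D R)"
  by (auto simp: predecessors_def)

lemma run_predecessors:
  assumes R0: "R \<notin> {''n'', ''G'', ''p'', ''q'', ''a'', ''b''}" and D: "D \<notin> {R, ''a'', ''b''}"
    and M: "matrix \<sigma> ''G'' n F" and n: "\<sigma> ''n'' [] = n"
    and d: "\<And>v. v < n \<Longrightarrow> \<sigma> D [v] = d v" and v: "v < n"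
    and ex: "\<exists>u<n. {u, v} \<in> F - {{\<sigma> ''p'' [], \<sigma> ''q'' []}} \<and> Suc (d u) = d v"
  shows "run (predecessors D R) \<sigma> R [v] = pred_of n (F - {{\<sigma> ''p'' [], \<sigma> ''q'' []}}) d v"
proof -
  have R: "R \<notin> {''n'', ''G'', ''p'', ''q'', ''a'', ''b''}"
    "''n'' \<noteq> R" "''G'' \<noteq> R" "''p'' \<noteq> R" "''q'' \<noteq> R" "''a'' \<noteq> R" "''b'' \<noteq> R"
    using R0 by auto
  define P where "P = (\<lambda>u v. {u, v} \<in> F - {{\<sigma> ''p'' [], \<sigma> ''q'' []}} \<and> Suc (d u) = d v)"
  \<comment> \<open>Nothing is claimed for a vertex without a predecessor, where the array keeps its
    old entry.\<close>
  define good where "good = (\<lambda>m v \<tau>. (\<exists>u<m. P u v) \<longrightarrow> \<tau> R [v] = Max {u. u < m \<and> P u v})"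
  let ?c = "Cond (Conj (edge_test ''G'' (V ''b'') (V ''a''))
                 (Equal (Plus (Read D [V ''b'']) (Const 1)) (Read D [V ''a''])))
       (Put R [V ''a''] (V ''b''))"
  have good_put: "good m v (put \<tau> x [] c) = good m v \<tau>" if "x \<noteq> R" for m v \<tau> x c
    using that unfolding good_def by (simp add: put_def)
  have "\<forall>v<\<sigma> ''n'' []. good n v (run (For ''a'' (For ''b'' ?c)) \<sigma>)"
  proof (rule For_rule[where I = "\<lambda>a \<tau>. \<forall>v<a. good n v \<tau>"])
    fix a \<tau> assume a: "a < \<sigma> ''n'' []" "\<tau> ''a'' [] = a" "\<forall>v<a. good n v \<tau>"
      and same1: "\<And>y. y \<noteq> ''a'' \<Longrightarrow> y \<notin> writes (For ''b'' ?c) \<Longrightarrow> \<tau> y = \<sigma> y"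
    have "(\<forall>v<a. good n v (run (For ''b'' ?c) \<tau>)) \<and> good (\<tau> ''n'' []) a (run (For ''b'' ?c) \<tau>)"
    proof (rule For_rule[where I = "\<lambda>b \<tau>. (\<forall>v<a. good n v \<tau>) \<and> good b a \<tau>"])
      fix b \<tau>' assume b: "b < \<tau> ''n'' []" "\<tau>' ''b'' [] = b" "(\<forall>v<a. good n v \<tau>') \<and> good b a \<tau>'"
        and same2: "\<And>y. y \<noteq> ''b'' \<Longrightarrow> y \<notin> writes ?c \<Longrightarrow> \<tau>' y = \<tau> y"
      have same: "\<tau>' y = \<sigma> y" if "y \<notin> {''a'', ''b'', R}" for y using same1 same2 that by simp
      have ta: "\<tau>' ''a'' [] = a" using same2[of "''a''"] a(2) R by auto
      have ab: "a < n" "b < n" using a(1) b(1) n same1[of "''n''"] R by auto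
      have "matrix \<tau>' ''G'' n F" using M same[of "''G''"] R by (simp add: matrix_def)
      then have "bval (edge_test ''G'' (V ''b'') (V ''a'')) \<tau>' \<longleftrightarrow> {b, a} \<in> F - {{\<sigma> ''p'' [], \<sigma> ''q'' []}}"
        using bval_edge_test[of \<tau>' "''G''" n F "V ''b''" "V ''a''"] ta b(2) ab same R by simp
      then have run_c: "run ?c \<tau>' = (if P b a then put \<tau>' R [a] b else \<tau>')"
        using ta b(2) ab same[of D] D d unfolding P_def by auto
      have "Max {u. u < Suc b \<and> P u a} = b" if "P b a"
        using that by (intro Max_eqI) auto
      moreover have "{u. u < Suc b \<and> P u a} = {u. u < b \<and> P u a}" if "\<not> P b a"
        using that less_Suc_eq by auto
      ultimately have "good (Suc b) a (run ?c \<tau>')"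
        using b(3) unfolding run_c good_def by (auto simp: put_def less_Suc_eq)
      moreover have "\<forall>v<a. good n v (run ?c \<tau>')"
        using b(3) unfolding run_c good_def by (auto simp: put_def)
      ultimately show "(\<forall>v<a. good n v (run ?c \<tau>')) \<and> good (Suc b) a (run ?c \<tau>')" by blast
    qed (use a R good_put in \<open>auto simp: good_def edge_test_def\<close>)
    moreover have "\<tau> ''n'' [] = n" using same1[of "''n''"] R n by auto
    ultimately show "\<forall>v<Suc a. good n v (run (For ''b'' ?c) \<tau>)" by (auto simp: less_Suc_eq)
  qed (use R good_put in auto)
  then show ?thesis using n v ex unfolding predecessors_def good_def pred_of_def P_def by simp
qed


section \<open>The clustering and the size of the structure\<close>

locale graph_input =
  fixes n s :: nat and E :: "nat set set"
  assumes edge_sub: "\<And>e. e \<in> E \<Longrightarrow> e \<subseteq> {..<n}" and edge_card: "\<And>e. e \<in> E \<Longrightarrow> card e = 2"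
    and source_less: "s < n"
begin

definition par :: "nat \<Rightarrow> nat" where
  "par v = (if v = s then s else pred_of n E (sdist n s E) v)"

definition pr :: "nat \<Rightarrow> nat \<Rightarrow> nat" where
  "pr q v = (let F = E - {tree_edge par q}; d = sdist n s F in
     if v \<noteq> q \<and> Suc (d (par v)) = d v then par v else pred_of n F d v)"

lemma par_props:
  assumes "v \<noteq> s" "sdist n s E v < n"
  shows "{par v, v} \<in> E" "Suc (sdist n s E (par v)) = sdist n s E v"
  using pred_of[OF sdist_pred[OF edge_sub assms]] assms(1) unfolding par_def by auto

lemma sdist_delete_le:
  assumes "sdist n s (E - {e}) v < n" shows "sdist n s E v \<le> sdist n s (E - {e}) v"
proof -
  have "reach (E - {e}) (sdist n s (E - {e}) v) s v" using assms by (intro reach_sdist) simp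
  then show ?thesis by (intro sdist_le) (auto elim: reach_mono)
qed

text \<open>If the edges agreed, \<open>v\<close> and \<open>q\<close> would be parents of each
  other. Here \<open>q\<close> is arbitrary, so its reachability is derived from that of
  \<open>v\<close>; then each of the two would be one level deeper than the other.\<close>

lemma par_edge_neq:
  assumes v: "v \<noteq> s" "sdist n s E v < n" "v \<noteq> q"
  shows "{par v, v} \<noteq> tree_edge par q"
proof
  assume eq: "{par v, v} = tree_edge par q"
  then have p: "v = par q" "q = par v" using v(3) unfolding tree_edge_def by (auto simp: doubleton_eq_iff)
  then have d: "Suc (sdist n s E q) = sdist n s E v" using par_props(2)[OF v(1,2)] by simp
  have "q \<noteq> s" using p(1) v(1) unfolding par_def by metis
  then have "Suc (sdist n s E (par q)) = sdist n s E q" using d v(2) by (intro par_props) simp_all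
  then show False using d unfolding p(1)[symmetric] by simp
qed

lemma pr_props:
  assumes v: "v \<noteq> s" "sdist n s (E - {tree_edge par q}) v < n"
  shows "{pr q v, v} \<in> E - {tree_edge par q}"
    "Suc (sdist n s (E - {tree_edge par q}) (pr q v)) = sdist n s (E - {tree_edge par q}) v"
proof -
  let ?F = "E - {tree_edge par q}" and ?d = "sdist n s (E - {tree_edge par q})"
  have dv: "sdist n s E v < n" using sdist_delete_le v(2) by fastforce
  have "{pr q v, v} \<in> ?F \<and> Suc (?d (pr q v)) = ?d v"
  proof (cases "v \<noteq> q \<and> Suc (?d (par v)) = ?d v")
    case True
    then show ?thesis
      using par_props(1)[OF v(1) dv] par_edge_neq[OF v(1) dv] by (auto simp: pr_def Let_def)
  next
    case False
    have "\<exists>u<n. {u, v} \<in> ?F \<and> Suc (?d u) = ?d v"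
      by (rule sdist_pred) (use edge_sub v in auto)
    from pred_of[OF this] show ?thesis using False by (auto simp: pr_def Let_def)
  qed
  then show "{pr q v, v} \<in> ?F" "Suc (?d (pr q v)) = ?d v" by blast+
qed

sublocale replacement_paths n s E par pr
proof
  show "pr q v = par v" if "v \<noteq> q" "Suc (sdist n s (E - {tree_edge par q}) (par v)) = sdist n s (E - {tree_edge par q}) v" for q v
    using that by (simp add: pr_def)
qed (use edge_sub source_less par_props pr_props in \<open>auto simp: par_def\<close>)

section \<open>The cube root of \<open>n\<close>, rounded up\<close>

definition L :: nat where "L = (LEAST l. n \<le> l * l * l)"

lemma L_cube: "n \<le> L * L * L"
  unfolding L_def by (rule LeastI[of _ n]) (cases n; simp)

lemma L_least: "l < L \<Longrightarrow> l * l * l < n"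
  unfolding L_def using not_less_Least[of l "\<lambda>l. n \<le> l * l * l"] by (simp add: not_le)

lemma L_pos: "0 < L"
  using L_cube source_less by (cases L) auto

text \<open>By minimality \<open>(L - 1)^3 < n\<close>, and \<open>L <= 2 (L - 1)\<close> unless
  \<open>L = 1\<close>; this is the origin of the factor 8.\<close>

lemma L_cube_le: "L * L * L \<le> 8 * n"
proof (cases "L = 1")
  case True
  then show ?thesis using source_less by simp
next
  case False
  then obtain l where l: "L = Suc l" "0 < l" using L_pos by (cases L) auto
  then have "l * l * l < n" using L_least by simp
  moreover have "Suc l \<le> 2 * l" using l by simp
  then have "Suc l * Suc l * Suc l \<le> (2 * l) * (2 * l) * (2 * l)" by (intro mult_le_mono)
  ultimately show ?thesis using l by simp
qed

section \<open>Greedy clustering by stars of non-tree edges\<close>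

definition trees :: "nat set set" where
  "trees = tree ` Q"

definition candidates :: "nat \<Rightarrow> (nat \<Rightarrow> nat) \<Rightarrow> nat set" where
  "candidates z c = {x. x < n \<and> c x = 0 \<and> {z, x} \<in> E \<and> {z, x} \<notin> trees}"

definition cluster_step :: "nat \<Rightarrow> (nat \<Rightarrow> nat) \<Rightarrow> nat \<Rightarrow> nat" where
  "cluster_step z c = (if card (candidates z c) < L then c
     else (\<lambda>x. if x \<in> candidates z c then Suc z else c x))"

text \<open>The value \<open>0\<close> marks unclustered vertices; the cluster with centre \<open>z\<close> has label \<open>Suc z\<close>.\<close>

definition cl :: "nat \<Rightarrow> nat" where
  "cl = fold cluster_step [0..<n] (\<lambda>_. 0)"

text \<open>The invariant after the centres below \<open>z\<close>. The second clause persists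
  because labels are never withdrawn, so candidate sets only shrink. It will bound the non-tree
  edges with an unclustered end, and the third clause will bound the number of clusters.\<close>

definition clustering :: "nat \<Rightarrow> (nat \<Rightarrow> nat) \<Rightarrow> bool" where
  "clustering z c \<longleftrightarrow>
     (\<forall>x. c x \<noteq> 0 \<longrightarrow> x < n \<and> {c x - 1, x} \<in> E \<and> {c x - 1, x} \<notin> trees) \<and>
     (\<forall>y<z. card (candidates y c) \<le> L) \<and>
     (\<forall>k\<in>c ` {..<n}. k \<noteq> 0 \<longrightarrow> L \<le> card {x. x < n \<and> c x = k})"

lemma clustering_step:
  assumes c: "clustering z c" shows "clustering (Suc z) (cluster_step z c)"
proof (cases "card (candidates z c) < L")
  case True
  then have "cluster_step z c = c" unfolding cluster_step_def by simp
  then show ?thesis using c True less_Suc_eq unfolding clustering_def by auto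
next
  case False
  define c' where "c' = (\<lambda>x. if x \<in> candidates z c then Suc z else c x)"
  have step: "cluster_step z c = c'" using False unfolding cluster_step_def c'_def by simp
  have fin: "finite (candidates y d)" for y d unfolding candidates_def by simp
  have old: "c' x = c x" if "c x \<noteq> 0" for x using that unfolding c'_def candidates_def by simp
  have "x < n \<and> {c' x - 1, x} \<in> E \<and> {c' x - 1, x} \<notin> trees" if "c' x \<noteq> 0" for x
    using that c unfolding c'_def clustering_def by (cases "x \<in> candidates z c") (auto simp: candidates_def)
  moreover have "card (candidates y c') \<le> L" if "y < Suc z" for y
  proof (cases "y = z")
    case True
    have "candidates z c' = {}" unfolding c'_def by (auto simp: candidates_def)
    then show ?thesis using True by simp
  next
    case False
    have "candidates y c' \<subseteq> candidates y c" using old unfolding candidates_def by fastforce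
    then have "card (candidates y c') \<le> card (candidates y c)" using fin by (intro card_mono)
    moreover have "card (candidates y c) \<le> L" using False that c unfolding clustering_def by simp
    ultimately show ?thesis by simp
  qed
  moreover have "L \<le> card {x. x < n \<and> c' x = k}" if k: "k \<in> c' ` {..<n}" "k \<noteq> 0" for k
  proof (cases "k \<in> c ` {..<n}")
    case True
    then have "L \<le> card {x. x < n \<and> c x = k}" using c k(2) unfolding clustering_def by blast
    also have "\<dots> \<le> card {x. x < n \<and> c' x = k}"
      using old k(2) by (intro card_mono) auto
    finally show ?thesis .
  next
    case nin: False
    then have "k = Suc z" using k(1) unfolding c'_def by (auto split: if_splits)
    then have "candidates z c \<subseteq> {x. x < n \<and> c' x = k}" unfolding c'_def by (auto simp: candidates_def)
    then have "card (candidates z c) \<le> card {x. x < n \<and> c' x = k}" by (intro card_mono) auto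
    then show ?thesis using False by simp
  qed
  ultimately show ?thesis unfolding step clustering_def by blast
qed

lemma clustering_cl: "clustering n cl"
proof -
  have "clustering z (fold cluster_step [0..<z] (\<lambda>_. 0))" for z
  proof (induction z)
    case 0
    show ?case by (simp add: clustering_def)
  next
    case (Suc z)
    then show ?case by (simp add: clustering_step)
  qed
  then show ?thesis unfolding cl_def .
qed

lemma cl_props:
  "cl x \<noteq> 0 \<Longrightarrow> x < n \<and> {cl x - 1, x} \<in> E \<and> {cl x - 1, x} \<notin> trees"
  "y < n \<Longrightarrow> card (candidates y cl) \<le> L"
  "k \<in> cl ` {..<n} \<Longrightarrow> k \<noteq> 0 \<Longrightarrow> L \<le> card {x. x < n \<and> cl x = k}"
  using clustering_cl unfolding clustering_def by blast+

section \<open>The initial structure and the list of events\<close>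

definition linked :: "nat \<Rightarrow> nat \<Rightarrow> bool" where
  "linked u v \<longleftrightarrow> cl u = 0 \<or> cl v = 0 \<or> cl v = Suc u \<or> cl u = Suc v"

definition H1 :: "nat set set" where
  "H1 = trees \<union> {{u, v} | u v. {u, v} \<in> E \<and> linked u v}"

definition bottoms :: "nat \<Rightarrow> nat set set" where
  "bottoms q = {{pr q w, w} | w. dq q w < n \<and> w \<noteq> s \<and> dep w \<le> dep q + L}"

definition H0 :: "nat set set" where
  "H0 = H1 \<union> (\<Union>q\<in>Q. bottoms q)"

text \<open>Row \<open>i\<close> belongs to \<open>dep q = n - 1 - i\<close>, so increasing rows
  have decreasing depth. The test \<open>0 < dep q\<close> excludes the source.\<close>

definition evs_at :: "nat \<Rightarrow> nat \<Rightarrow> (nat \<times> nat) list" where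
  "evs_at i q = (if dep q + i + 1 = n \<and> 0 < dep q then map (Pair q) [0..<n] else [])"

definition evs :: "(nat \<times> nat) list" where
  "evs = concat (map (\<lambda>i. concat (map (evs_at i) [0..<n])) [0..<n])"

lemma evs_mem: "(q, v) \<in> set (concat (map (evs_at i) [0..<n])) \<Longrightarrow> q \<in> Q \<and> dep q + i + 1 = n"
  by (auto simp: evs_at_def split: if_splits)

lemma evs_pairwise: "sorted_wrt (\<lambda>x y. dep (fst y) \<le> dep (fst x)) evs"
proof -
  have "sorted_wrt (\<lambda>x y. dep (fst y) \<le> dep (fst x)) (concat (map (\<lambda>i. concat (map (evs_at i) [0..<n])) [0..<m]))" for m
  proof (induction m)
    case (Suc m)
    have mem: "dep (fst y) \<le> dep (fst x)"
      if "x \<in> set (concat (map (evs_at i) [0..<n]))" "y \<in> set (concat (map (evs_at m) [0..<n]))" "i \<le> m" for x y i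
      using evs_mem[of "fst x" "snd x" i] evs_mem[of "fst y" "snd y" m] that by simp
    have "sorted_wrt (\<lambda>x y. dep (fst y) \<le> dep (fst x)) (concat (map (evs_at m) [0..<n]))"
      unfolding sorted_wrt_iff_nth_less using mem[OF nth_mem nth_mem order_refl] by simp
    moreover have "dep (fst y) \<le> dep (fst x)"
      if xy: "x \<in> set (concat (map (\<lambda>i. concat (map (evs_at i) [0..<n])) [0..<m]))"
        "y \<in> set (concat (map (evs_at m) [0..<n]))" for x y
    proof -
      obtain i where "i < m" "x \<in> set (concat (map (evs_at i) [0..<n]))" using xy(1) by fastforce
      then show ?thesis using mem[of x i y] xy(2) by simp
    qed
    ultimately show ?case using Suc by (simp add: sorted_wrt_append)
  qed simp
  then show ?thesis unfolding evs_def .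
qed

sublocale augmentation n s E par pr L cl H0 evs
proof
  show "H0 \<subseteq> E" unfolding H0_def H1_def bottoms_def trees_def using tree_E pr_props(1) by auto
  show "tree q \<in> H0" if "q \<in> Q" for q using that unfolding H0_def H1_def trees_def by blast
  show "{u, v} \<in> H0" if "{u, v} \<in> E" "cl u = 0" for u v
    using that unfolding H0_def H1_def linked_def by blast
  show "{cl v - 1, v} \<in> H0" if "cl v \<noteq> 0" for v
  proof -
    have "linked (cl v - 1) v" using that unfolding linked_def by simp
    then show ?thesis using cl_props(1)[OF that] unfolding H0_def H1_def by blast
  qed
  show "{cl v - 1, v} \<noteq> tree q" if "cl v \<noteq> 0" "q \<in> Q" for v q
    using cl_props(1)[OF that(1)] that(2) unfolding trees_def by blast
  show "{pr q w, w} \<in> H0" if "q \<in> Q" "dq q w < n" "w \<noteq> s" "dep w \<le> dep q + L" for q w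
    using that unfolding H0_def bottoms_def by blast
  show "q \<in> Q" if "(q, v) \<in> set evs" for q v
    using that evs_mem unfolding evs_def by fastforce
  show "dep (fst (evs ! j)) \<le> dep (fst (evs ! i))" if "i < j" "j < length evs" for i j
    using evs_pairwise that by (simp add: sorted_wrt_iff_nth_less)
  show "(q, v) \<in> set evs" if "q \<in> Q" "v < n" for q v
  proof -
    have d: "0 < dep q" "dep q < n" "q < n" using that dep_vertex by (auto simp: sdist_eq_0 intro: gr0I)
    then have "dep q + (n - 1 - dep q) + 1 = n" by simp
    then have "(q, v) \<in> set (evs_at (n - 1 - dep q) q)" using that d unfolding evs_at_def by simp
    then have "(q, v) \<in> set (concat (map (evs_at (n - 1 - dep q)) [0..<n]))"
      using d by (auto intro!: bexI[of _ q])
    moreover have "n - 1 - dep q \<in> {..<n}" using d by simp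
    ultimately show ?thesis unfolding evs_def by fastforce
  qed
qed

definition spanner :: "nat set set" where
  "spanner = fold (augment n s E par pr) evs H0"

lemma spanner_Hs: "spanner = Hs (length evs)"
  unfolding spanner_def Hs_def by simp

section \<open>Counting the edges of the structure\<close>

lemma finite_E: "finite E"
  by (rule finite_subset[of _ "Pow {..<n}"]) (use edge_sub in auto)

lemma Q_less: "Q \<subseteq> {..<n}" using dep_vertex by auto

lemma card_trees: "card trees \<le> n" "finite trees"
proof -
  have "card trees \<le> card Q" unfolding trees_def using Q_less finite_subset by (intro card_image_le) blast
  then show "card trees \<le> n" using card_mono[OF _ Q_less] by simp
  show "finite trees" unfolding trees_def using Q_less finite_subset by blast
qed

text \<open>An edge of \<open>H1\<close> outside the tree is either a star edge, charged to its
  leaf, or has an unclustered end and is charged to the other end, which has at most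
  \<open>L\<close> candidates left.\<close>

lemma card_H1: "card H1 \<le> 2 * n + n * L"
proof -
  let ?S = "(\<lambda>x. {cl x - 1, x}) ` {..<n}"
  let ?P = "Sigma {..<n} (\<lambda>z. candidates z cl)"
  have finc: "finite (candidates z cl)" for z unfolding candidates_def by simp
  have "H1 \<subseteq> trees \<union> (?S \<union> (\<lambda>(z, x). {z, x}) ` ?P)"
  proof
    fix e assume e: "e \<in> H1"
    show "e \<in> trees \<union> (?S \<union> (\<lambda>(z, x). {z, x}) ` ?P)"
    proof (cases "e \<in> trees")
      case False
      then obtain u v where uv: "e = {u, v}" "{u, v} \<in> E" "linked u v" using e unfolding H1_def by blast
      then have "u < n" "v < n" using edge_sub by auto
      consider "cl u = 0" | "cl v = 0" | "cl v = Suc u" | "cl u = Suc v"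
        using uv(3) unfolding linked_def by (elim disjE) simp_all
      then have "e \<in> ?S \<or> e \<in> (\<lambda>(z, x). {z, x}) ` ?P"
      proof cases
        case 1
        have "(v, u) \<in> ?P"
          using 1 False uv \<open>u < n\<close> \<open>v < n\<close> unfolding candidates_def by (simp add: insert_commute)
        then have "e \<in> (\<lambda>(z, x). {z, x}) ` ?P" by (rule rev_image_eqI) (simp add: uv(1) insert_commute)
        then show ?thesis ..
      next
        case 2
        have "(u, v) \<in> ?P"
          using 2 False uv \<open>u < n\<close> \<open>v < n\<close> unfolding candidates_def by simp
        then have "e \<in> (\<lambda>(z, x). {z, x}) ` ?P" by (rule rev_image_eqI) (simp add: uv(1))
        then show ?thesis ..
      next
        case 3
        then have "e = {cl v - 1, v}" using uv(1) by simp
        then show ?thesis using \<open>v < n\<close> by blast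
      next
        case 4
        then have "e = {cl u - 1, u}" using uv(1) by (simp add: insert_commute)
        then show ?thesis using \<open>u < n\<close> by blast
      qed
      then show ?thesis by blast
    qed simp
  qed
  then have "card H1 \<le> card (trees \<union> (?S \<union> (\<lambda>(z, x). {z, x}) ` ?P))"
    using finc card_trees by (intro card_mono) auto
  also have "\<dots> \<le> card trees + (card ?S + card ((\<lambda>(z, x). {z, x}) ` ?P))"
    by (meson card_Un_le add_left_mono order_trans)
  also have "card ?S \<le> n" using card_image_le[of "{..<n}"] by (metis card_lessThan finite_lessThan)
  also have "card ((\<lambda>(z, x). {z, x}) ` ?P) \<le> card ?P" using finc by (intro card_image_le) auto
  also have "card ?P = (\<Sum>z<n. card (candidates z cl))" using finc by simp
  also have "\<dots> \<le> (\<Sum>z<n. L)" using cl_props(2) by (intro sum_mono) simp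
  finally show ?thesis using card_trees by simp
qed

text \<open>A last edge entering a vertex outside the subtree of \<open>q\<close> is a tree edge.
  Inside, \<open>q\<close> is the \<open>k\<close>-th ancestor of \<open>w\<close> for some
  \<open>k <= L\<close>, so each \<open>w\<close> contributes at most \<open>Suc L\<close> further
  edges.\<close>

lemma card_H0: "card H0 \<le> 3 * n + 2 * (n * L)"
proof -
  let ?B = "(\<lambda>(w, k). {pr ((par ^^ k) w) w, w}) ` ({..<n} \<times> {..L})"
  have "bottoms q \<subseteq> H1 \<union> ?B" if q: "q \<in> Q" for q
  proof
    fix e assume "e \<in> bottoms q"
    then obtain w where w: "e = {pr q w, w}" "dq q w < n" "w \<noteq> s" "dep w \<le> dep q + L"
      unfolding bottoms_def by blast
    then have dw: "dep w < n" using dq_dep_less by blast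
    show "e \<in> H1 \<union> ?B"
    proof (cases "desc q w")
      case False
      then have "e = tree w" using outside_pr[OF q dw] w unfolding tree_edge_def by simp
      then show ?thesis using w dw unfolding H1_def trees_def by blast
    next
      case True
      then obtain k where k: "(par ^^ k) w = q" unfolding desc_def by blast
      \<comment> \<open>Climbing loses one level per step since \<open>s\<close>, a fixed point of
        \<open>par\<close>, is not met on the way to \<open>q\<close>.\<close>
      have dk: "dep ((par ^^ j) w) + j = dep w" if "j \<le> k" for j
        using that
      proof (induction j)
        case (Suc j)
        let ?x = "(par ^^ j) w"
        have "?x \<noteq> s"
        proof
          assume "?x = s"
          then have "(par ^^ (k - j)) s = q" using k Suc.prems
            by (metis Suc_leD funpow_add le_add_diff_inverse2 o_apply)
          then show False using q by (simp add: par_fix)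
        qed
        moreover have "dep ?x < n" using Suc dw by simp
        ultimately show ?case using par_dep[of ?x] Suc by simp
      qed simp
      from dk[of k] have "k \<le> L" using k w(4) by simp
      then have "(w, k) \<in> {..<n} \<times> {..L}" using dep_vertex[OF dw] by simp
      then have "e \<in> ?B" by (rule rev_image_eqI) (simp add: k w(1))
      then show ?thesis by blast
    qed
  qed
  then have sub: "H0 \<subseteq> H1 \<union> ?B" unfolding H0_def by blast
  have "H1 \<subseteq> E" using H0_sub unfolding H0_def by blast
  then have "finite H1" using finite_E finite_subset by blast
  then have "card H0 \<le> card (H1 \<union> ?B)" by (intro card_mono[OF _ sub] finite_UnI) simp_all
  also have "\<dots> \<le> card H1 + card ?B" by (rule card_Un_le)
  also have "card ?B \<le> card ({..<n} \<times> {..L})" by (rule card_image_le) simp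
  also have "\<dots> = n * Suc L" by (simp only: card_cartesian_product card_lessThan card_atMost)
  finally show ?thesis using card_H1 by simp
qed

lemma card_clusters: "L * card clusters \<le> n"
proof -
  have fin: "finite clusters" unfolding clusters_def by simp
  have "card clusters * L \<le> (\<Sum>k\<in>clusters. card {x. x < n \<and> cl x = k})"
    using cl_props(3) sum_mono[of clusters "\<lambda>_. L"] unfolding clusters_def by simp
  also have "\<dots> = card (\<Union>k\<in>clusters. {x. x < n \<and> cl x = k})"
    using fin by (intro card_UN_disjoint[symmetric]) auto
  also have "\<dots> \<le> card {..<n}" by (intro card_mono) auto
  finally show ?thesis by (simp add: mult.commute)
qed

text \<open>The added edges contribute \<open>3 + 5\<close> and the initial ones
  \<open>3 + 2\<close> multiples of \<open>n * L\<close>.\<close>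

lemma card_spanner: "card spanner \<le> 13 * (n * L)"
proof -
  obtain R :: "nat set" where R: "L * card R \<le> n"
    "card (spanner - H0) \<le> 3 * (card R * card clusters) + 5 * (card clusters * card clusters)"
    using added_le[OF L_pos] unfolding spanner_Hs by blast
  \<comment> \<open>From \<open>L * b <= n <= L^3\<close> follows \<open>b <= L * L\<close>;
    multiply this by \<open>L * a <= n\<close> and cancel one \<open>L\<close>.\<close>
  have "a * b \<le> n * L" if "L * a \<le> n" "L * b \<le> n" for a b
  proof -
    have "L * b \<le> L * (L * L)" using that(2) L_cube[unfolded mult.assoc] by (rule order_trans)
    then have "b \<le> L * L" using L_pos by simp
    then have "(L * a) * b \<le> n * (L * L)" using that(1) by (intro mult_le_mono)
    then have "L * (a * b) \<le> L * (n * L)" by (simp add: mult_ac)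
    then show ?thesis using L_pos by simp
  qed
  then have "card R * card clusters \<le> n * L" "card clusters * card clusters \<le> n * L"
    using R card_clusters by blast+
  moreover have "card spanner \<le> card (spanner - H0) + card H0"
  proof -
    have "finite H0" "finite spanner"
      using H0_sub Hs_E finite_E finite_subset unfolding spanner_Hs by blast+
    then have "card spanner \<le> card ((spanner - H0) \<union> H0)" by (intro card_mono) auto
    then show ?thesis using card_Un_le[of "spanner - H0" H0] by linarith
  qed
  moreover have "n \<le> n * L" using L_pos by simp
  ultimately show ?thesis using R(2) card_H0 by linarith
qed

end


section \<open>The program\<close>

definition add_edge :: "aexp \<Rightarrow> aexp \<Rightarrow> prog" where
  "add_edge u v = Put ''H'' [u, v] (Const 1) ;; Put ''H'' [v, u] (Const 1)"

lemma writes_add_edge [simp]: "writes (add_edge u v) = {''H''}"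
  by (simp add: add_edge_def)

lemma wf_add_edge [simp]: "wf_prog (add_edge u v)"
  by (simp add: add_edge_def)

text \<open>The index expressions are evaluated again after the first assignment, so their values
  must not depend on \<open>H\<close>.\<close>

lemma run_add_edge:
  assumes "matrix \<sigma> ''H'' n F"
    and "\<And>is c. aval u (put \<sigma> ''H'' is c) = aval u \<sigma>" "\<And>is c. aval v (put \<sigma> ''H'' is c) = aval v \<sigma>"
  shows "matrix (run (add_edge u v) \<sigma>) ''H'' n (insert {aval u \<sigma>, aval v \<sigma>} F)"
proof -
  have run: "run (add_edge u v) \<sigma> =
      put (put \<sigma> ''H'' [aval u \<sigma>, aval v \<sigma>] 1) ''H'' [aval v \<sigma>, aval u \<sigma>] 1"
    by (simp add: add_edge_def assms(2,3))
  show ?thesis unfolding run matrix_def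
  proof (intro allI impI)
    fix x y assume "x < n" "y < n"
    then have old: "\<sigma> ''H'' [x, y] = (if {x, y} \<in> F then 1 else 0)"
      using assms(1) unfolding matrix_def by simp
    have iff: "{x, y} = {aval u \<sigma>, aval v \<sigma>} \<longleftrightarrow>
        [x, y] = [aval u \<sigma>, aval v \<sigma>] \<or> [x, y] = [aval v \<sigma>, aval u \<sigma>]"
      by (simp add: doubleton_eq_iff)
    show "put (put \<sigma> ''H'' [aval u \<sigma>, aval v \<sigma>] 1) ''H'' [aval v \<sigma>, aval u \<sigma>] 1 ''H'' [x, y] =
        (if {x, y} \<in> insert {aval u \<sigma>, aval v \<sigma>} F then 1 else 0)"
      unfolding put_apply insert_iff iff old by argo
  qed
qed

text \<open>Arrays: \<open>d\<close> and \<open>par\<close> hold the depths and parents in the tree, \<open>e\<close> and \<open>r\<close> the distances and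
  predecessors avoiding the current edge \<open>{p, q}\<close> in \<open>G\<close>, and \<open>h\<close> the distances avoiding it in \<open>H\<close>.
  Initially \<open>p = q = 0\<close>, so that nothing is avoided.\<close>

definition cube_step :: prog where
  "cube_step = Cond (Less (V ''L3'') (V ''n''))
     (Put ''L3'' [] (Plus (V ''L3'') (Plus (V ''L2'') (Plus (V ''L2'') (Plus (V ''L2'')
        (Plus (V ''L'') (Plus (V ''L'') (Plus (V ''L'') (Const 1)))))))) ;;
      Put ''L2'' [] (Plus (V ''L2'') (Plus (V ''L'') (Plus (V ''L'') (Const 1)))) ;;
      Put ''L'' [] (Plus (V ''L'') (Const 1)))"

definition cube_root :: prog where
  "cube_root = For ''i'' cube_step"

text \<open>The source has no predecessor, so its parent is written explicitly.\<close>

definition search_tree :: prog where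
  "search_tree = distances ''G'' ''d'' ;; predecessors ''d'' ''par'' ;; Put ''par'' [V ''s''] (V ''s'') ;;
     For ''v'' (Cond (Conj (Less (Const 0) (Read ''d'' [V ''v''])) (Less (Read ''d'' [V ''v'']) (V ''n'')))
       (add_edge (Read ''par'' [V ''v'']) (V ''v'')))"

definition candidate_test :: bexp where
  "candidate_test = Conj (Equal (Read ''cl'' [V ''a'']) (Const 0))
     (Conj (Equal (Read ''G'' [V ''z'', V ''a'']) (Const 1)) (Equal (Read ''H'' [V ''z'', V ''a'']) (Const 0)))"

definition count_candidates :: prog where
  "count_candidates = For ''a'' (Cond candidate_test (Put ''cnt'' [] (Plus (V ''cnt'') (Const 1))))"

definition mark_candidates :: prog where
  "mark_candidates = For ''a'' (Cond candidate_test (Put ''cl'' [V ''a''] (Plus (V ''z'') (Const 1))))"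

definition form_clusters :: prog where
  "form_clusters = For ''z'' (Put ''cnt'' [] (Const 0) ;; count_candidates ;;
     Cond (Neg (Less (V ''cnt'') (V ''L''))) mark_candidates)"

text \<open>Boolean expressions have no disjunction; the alternatives of \<open>linked\<close> are
  expressed by De Morgan's law.\<close>

definition linked_test :: bexp where
  "linked_test = Conj (Equal (Read ''G'' [V ''a'', V ''b'']) (Const 1))
     (Neg (Conj (Neg (Equal (Read ''cl'' [V ''a'']) (Const 0)))
          (Conj (Neg (Equal (Read ''cl'' [V ''b'']) (Const 0)))
          (Conj (Neg (Equal (Read ''cl'' [V ''b'']) (Plus (V ''a'') (Const 1))))
                (Neg (Equal (Read ''cl'' [V ''a'']) (Plus (V ''b'') (Const 1))))))))"

definition add_linked :: prog where
  "add_linked = For ''a'' (For ''b'' (Cond linked_test (add_edge (V ''a'') (V ''b''))))"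

text \<open>The last loop imposes the preference for tree edges on the predecessors found before
  it.\<close>

definition avoid_tree_edge :: prog where
  "avoid_tree_edge = Put ''p'' [] (Read ''par'' [V ''q'']) ;; distances ''G'' ''e'' ;; predecessors ''e'' ''r'' ;;
     For ''a'' (Cond (Conj (Neg (Equal (V ''a'') (V ''q'')))
         (Equal (Plus (Read ''e'' [Read ''par'' [V ''a'']]) (Const 1)) (Read ''e'' [V ''a''])))
       (Put ''r'' [V ''a''] (Read ''par'' [V ''a''])))"

definition bottom_test :: bexp where
  "bottom_test = Conj (Less (Const 0) (Read ''e'' [V ''w''])) (Conj (Less (Read ''e'' [V ''w'']) (V ''n''))
     (Neg (Less (Plus (Read ''d'' [V ''q'']) (V ''L'')) (Read ''d'' [V ''w'']))))"

definition add_bottoms :: prog where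
  "add_bottoms = For ''q'' (Cond (Conj (Less (Const 0) (Read ''d'' [V ''q''])) (Less (Read ''d'' [V ''q'']) (V ''n'')))
     (avoid_tree_edge ;; For ''w'' (Cond bottom_test (add_edge (Read ''r'' [V ''w'']) (V ''w'')))))"

text \<open>The loop always runs \<open>n\<close> times; once the source is reached, where
  \<open>e\<close> is 0, the remaining rounds are idle.\<close>

definition add_path :: prog where
  "add_path = Put ''w'' [] (V ''v'') ;;
     For ''j'' (Cond (Less (Const 0) (Read ''e'' [V ''w'']))
       (add_edge (Read ''r'' [V ''w'']) (V ''w'') ;; Put ''w'' [] (Read ''r'' [V ''w''])))"

definition visit :: prog where
  "visit = Cond (Conj (Less (Const 0) (Read ''e'' [V ''v''])) (Conj (Less (Read ''e'' [V ''v'']) (V ''n''))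
       (Equal (Read ''H'' [Read ''r'' [V ''v''], V ''v'']) (Const 0))))
     (distances ''H'' ''h'' ;;
      Cond (Less (Plus (Read ''e'' [V ''v'']) (Const 4)) (Read ''h'' [V ''v''])) add_path)"

definition augment_all :: prog where
  "augment_all = For ''i'' (For ''q'' (Cond (Conj (Equal (Plus (Read ''d'' [V ''q'']) (Plus (V ''i'') (Const 1))) (V ''n''))
       (Less (Const 0) (Read ''d'' [V ''q''])))
     (avoid_tree_edge ;; For ''v'' visit)))"

definition spanner_prog :: prog where
  "spanner_prog = cube_root ;; search_tree ;; form_clusters ;; add_linked ;; add_bottoms ;; augment_all"

lemma writes_avoid_tree_edge [simp]: "writes avoid_tree_edge = {''p'', ''a'', ''b'', ''k'', ''e'', ''r''}"
  by (auto simp: avoid_tree_edge_def)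

lemma wf_avoid_tree_edge [simp]: "wf_prog avoid_tree_edge"
  by (simp add: avoid_tree_edge_def)

lemma writes_add_path [simp]: "writes add_path = {''w'', ''j'', ''H''}"
  by (auto simp: add_path_def)

lemma wf_add_path [simp]: "wf_prog add_path"
  by (simp add: add_path_def)

lemma writes_visit [simp]: "writes visit = {''a'', ''b'', ''k'', ''h'', ''w'', ''j'', ''H''}"
  by (auto simp: visit_def)

lemma wf_visit [simp]: "wf_prog visit"
  by (simp add: visit_def)

lemma wf_spanner_prog: "wf_prog spanner_prog"
  by (simp add: spanner_prog_def cube_root_def cube_step_def search_tree_def form_clusters_def count_candidates_def
      mark_candidates_def add_linked_def add_bottoms_def augment_all_def)

lemma run_Cond: "bval b \<sigma> = P \<Longrightarrow> run (Cond b c) \<sigma> = (if P then run c \<sigma> else \<sigma>)"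
  by simp

context graph_input
begin

section \<open>The program computes the structure defined above\<close>

definition input_ok :: "store \<Rightarrow> bool" where
  "input_ok \<sigma> \<longleftrightarrow> \<sigma> ''n'' [] = n \<and> \<sigma> ''s'' [] = s \<and> matrix \<sigma> ''G'' n E"

definition tree_ok :: "store \<Rightarrow> bool" where
  "tree_ok \<sigma> \<longleftrightarrow> (\<forall>v<n. \<sigma> ''d'' [v] = dep v) \<and> (\<forall>v<n. dep v < n \<longrightarrow> \<sigma> ''par'' [v] = par v)"

definition known :: "store \<Rightarrow> bool" where
  "known \<sigma> \<longleftrightarrow> input_ok \<sigma> \<and> tree_ok \<sigma> \<and> \<sigma> ''L'' [] = L"

lemma input_ok_cong: "input_ok \<sigma> \<Longrightarrow> \<tau> ''n'' = \<sigma> ''n'' \<Longrightarrow> \<tau> ''s'' = \<sigma> ''s'' \<Longrightarrow> \<tau> ''G'' = \<sigma> ''G'' \<Longrightarrow> input_ok \<tau>"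
  unfolding input_ok_def matrix_def by simp

lemma known_cong:
  "known \<sigma> \<Longrightarrow>
    \<tau> ''n'' = \<sigma> ''n'' \<Longrightarrow> \<tau> ''s'' = \<sigma> ''s'' \<Longrightarrow> \<tau> ''G'' = \<sigma> ''G'' \<Longrightarrow>
    \<tau> ''d'' = \<sigma> ''d'' \<Longrightarrow> \<tau> ''par'' = \<sigma> ''par'' \<Longrightarrow> \<tau> ''L'' = \<sigma> ''L'' \<Longrightarrow> known \<tau>"
  unfolding known_def tree_ok_def input_ok_def matrix_def by simp

lemma known_n: "known \<sigma> \<Longrightarrow> \<sigma> ''n'' [] = n"
  unfolding known_def input_ok_def by simp

text \<open>Square and cube of \<open>l\<close> are carried along and updated by the binomial
  formulas, since the machine cannot multiply. Each round either increases \<open>l\<close> or finds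
  that \<open>l * l * l\<close> has reached \<open>n\<close>.\<close>

lemma run_cube_root:
  assumes "\<sigma> ''n'' [] = n" "\<sigma> ''L'' [] = 0" "\<sigma> ''L2'' [] = 0" "\<sigma> ''L3'' [] = 0"
  shows "run cube_root \<sigma> ''L'' [] = L"
proof -
  let ?I = "\<lambda>i \<tau>. let l = \<tau> ''L'' [] in \<tau> ''L2'' [] = l * l \<and> \<tau> ''L3'' [] = l * l * l \<and>
      (\<forall>m<l. m * m * m < n) \<and> (i \<le> l \<or> n \<le> l * l * l)"
  have "?I (\<sigma> ''n'' []) (run cube_root \<sigma>)"
    unfolding cube_root_def
  proof (rule For_rule[where I = ?I])
    fix i \<tau> assume I: "?I i \<tau>" and same: "\<And>y. y \<noteq> ''i'' \<Longrightarrow> y \<notin> writes cube_step \<Longrightarrow> \<tau> y = \<sigma> y"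
    have "\<tau> ''n'' [] = n" using same[of "''n''"] assms(1) by (simp add: cube_step_def)
    then show "?I (Suc i) (run cube_step \<tau>)"
      using I by (auto simp: cube_step_def put_def Let_def less_Suc_eq algebra_simps)
  qed (use assms in \<open>auto simp: cube_step_def put_def Let_def\<close>)
  then have l: "n \<le> run cube_root \<sigma> ''L'' [] \<or> n \<le> run cube_root \<sigma> ''L'' [] * run cube_root \<sigma> ''L'' [] * run cube_root \<sigma> ''L'' []"
    "\<forall>m<run cube_root \<sigma> ''L'' []. m * m * m < n" using assms(1) by (auto simp: Let_def)
  define l where "l = run cube_root \<sigma> ''L'' []"
  have "n \<le> l * l * l"
  proof -
    \<comment> \<open>Covers the case in which \<open>l\<close> grew in all \<open>n\<close> rounds,
      so that \<open>n <= l\<close>.\<close>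
    have "l \<le> l * l * l" by (cases l) auto
    then show ?thesis using l(1) unfolding l_def[symmetric] by linarith
  qed
  then show ?thesis unfolding L_def l_def[symmetric]
    by (intro Least_equality[symmetric]) (use l(2) in \<open>auto simp: l_def not_le[symmetric]\<close>)
qed

lemma run_search_tree:
  assumes i: "input_ok \<sigma>" and pq: "\<sigma> ''p'' [] = 0" "\<sigma> ''q'' [] = 0" and H: "matrix \<sigma> ''H'' n {}"
  shows "tree_ok (run search_tree \<sigma>)" "matrix (run search_tree \<sigma>) ''H'' n trees"
proof -
  define \<sigma>1 where "\<sigma>1 = run (distances ''G'' ''d'') \<sigma>"
  define \<sigma>2 where "\<sigma>2 = run (predecessors ''d'' ''par'') \<sigma>1"
  define \<sigma>3 where "\<sigma>3 = run (Put ''par'' [V ''s''] (V ''s'')) \<sigma>2"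
  let ?c = "Cond (Conj (Less (Const 0) (Read ''d'' [V ''v''])) (Less (Read ''d'' [V ''v'']) (V ''n'')))
       (add_edge (Read ''par'' [V ''v'']) (V ''v''))"
  have run: "run search_tree \<sigma> = run (For ''v'' ?c) \<sigma>3"
    unfolding search_tree_def \<sigma>1_def \<sigma>2_def \<sigma>3_def by simp
  have s1: "\<sigma>1 y = \<sigma> y" if "y \<notin> {''a'', ''b'', ''k'', ''d''}" for y
    unfolding \<sigma>1_def using that by (intro run_frame) simp
  have s2: "\<sigma>2 y = \<sigma>1 y" if "y \<notin> {''a'', ''b'', ''par''}" for y
    unfolding \<sigma>2_def using that by (intro run_frame) simp
  have s3: "\<sigma>3 y = \<sigma>2 y" if "y \<noteq> ''par''" for y
    unfolding \<sigma>3_def using that by (simp add: put_other)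
  \<comment> \<open>The pair \<open>p = q = 0\<close> denotes a singleton, which is no edge.\<close>
  have "{0 :: nat, 0} \<notin> E" using edge_card by fastforce
  then have E0: "E - {{\<sigma> ''p'' [], \<sigma> ''q'' []}} = E" using pq by simp
  have d1: "\<sigma>1 ''d'' [v] = dep v" if "v < n" for v
  proof -
    have "run (distances ''G'' ''d'') \<sigma> ''d'' [v] = sdist n s (E - {{\<sigma> ''p'' [], \<sigma> ''q'' []}}) v"
      by (rule run_distances) (use i that edge_sub source_less in \<open>auto simp: input_ok_def\<close>)
    then show ?thesis unfolding \<sigma>1_def E0 .
  qed
  have p2: "\<sigma>2 ''par'' [v] = pred_of n E dep v" if v: "v < n" "v \<noteq> s" "dep v < n" for v
  proof -
    have "\<sigma>1 ''p'' = \<sigma> ''p''" "\<sigma>1 ''q'' = \<sigma> ''q''" using s1 by simp_all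
    then have E1: "E - {{\<sigma>1 ''p'' [], \<sigma>1 ''q'' []}} = E" using E0 by (simp only:)
    have "input_ok \<sigma>1" using i by (rule input_ok_cong) (simp_all add: s1)
    then have "run (predecessors ''d'' ''par'') \<sigma>1 ''par'' [v] =
        pred_of n (E - {{\<sigma>1 ''p'' [], \<sigma>1 ''q'' []}}) dep v"
      by (intro run_predecessors)
        (use d1 v sdist_pred[OF edge_sub v(2,3)] in \<open>simp_all add: input_ok_def E1\<close>)
    then show ?thesis unfolding \<sigma>2_def E1 .
  qed
  have s3': "\<sigma>3 ''n'' [] = n" "\<sigma>3 ''H'' = \<sigma> ''H''" "\<sigma>3 ''d'' = \<sigma>1 ''d''" "\<sigma>2 ''s'' [] = s"
    using s1 s2 s3 i unfolding input_ok_def by simp_all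
  have p3: "\<sigma>3 ''par'' [v] = par v" if "v < n" "dep v < n" for v
    using p2[OF that(1) _ that(2)] s3'(4) unfolding \<sigma>3_def par_def by (auto simp: put_def)
  have t3: "tree_ok \<sigma>3" unfolding tree_ok_def using d1 p3 s3' by simp
  have s4: "run (For ''v'' ?c) \<sigma>3 y = \<sigma>3 y" if "y \<notin> {''v'', ''H''}" for y
    using that by (intro run_frame) simp
  show "tree_ok (run search_tree \<sigma>)"
    using t3 s4 unfolding run tree_ok_def by simp
  let ?S = "\<lambda>i. tree ` {v \<in> Q. v < i}"
  have "matrix (run (For ''v'' ?c) \<sigma>3) ''H'' n (?S (\<sigma>3 ''n'' []))"
  proof (rule For_rule[where I = "\<lambda>i \<tau>. matrix \<tau> ''H'' n (?S i)"])
    fix v \<tau> assume v: "v < \<sigma>3 ''n'' []" "\<tau> ''v'' [] = v" "matrix \<tau> ''H'' n (?S v)"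
      and same: "\<And>y. y \<noteq> ''v'' \<Longrightarrow> y \<notin> writes ?c \<Longrightarrow> \<tau> y = \<sigma>3 y"
    have vn: "v < n" using v s3' by simp
    have t: "\<tau> ''n'' [] = n" "\<tau> ''d'' [v] = dep v" "dep v < n \<Longrightarrow> \<tau> ''par'' [v] = par v"
      using same s3' vn t3 unfolding tree_ok_def by simp_all
    have test: "bval (Conj (Less (Const 0) (Read ''d'' [V ''v''])) (Less (Read ''d'' [V ''v'']) (V ''n''))) \<tau> \<longleftrightarrow> v \<in> Q"
      using t v by (auto simp: sdist_eq_0 intro: gr0I)
    show "matrix (run ?c \<tau>) ''H'' n (?S (Suc v))"
    proof (cases "v \<in> Q")
      case True
      then have S: "?S (Suc v) = insert {par v, v} (?S v)" by (auto simp: less_Suc_eq tree_edge_def)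
      have "matrix (run (add_edge (Read ''par'' [V ''v'']) (V ''v'')) \<tau>) ''H'' n
          (insert {aval (Read ''par'' [V ''v'']) \<tau>, aval (V ''v'') \<tau>} (?S v))"
        by (rule run_add_edge[OF v(3)]) (simp_all add: put_other)
      moreover have "aval (Read ''par'' [V ''v'']) \<tau> = par v" using True t v(2) by simp
      ultimately show ?thesis using True v(2) unfolding S run_Cond[OF test] by simp
    next
      case False
      then have "?S (Suc v) = ?S v" by (auto simp: less_Suc_eq)
      then show ?thesis using v(3) unfolding run_Cond[OF test] if_not_P[OF False] by simp
    qed
  qed (use H s3' in \<open>simp_all add: matrix_def put_other\<close>)
  moreover have "?S n = trees" unfolding trees_def using dep_vertex by auto
  ultimately show "matrix (run search_tree \<sigma>) ''H'' n trees" unfolding run s3' by simp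
qed

lemma bval_candidate_test:
  assumes "matrix \<tau> ''G'' n E" "matrix \<tau> ''H'' n trees" "\<tau> ''z'' [] = z" "z < n" "\<tau> ''a'' [] = a" "a < n"
    and "\<tau> ''cl'' [a] = c a"
  shows "bval candidate_test \<tau> \<longleftrightarrow> a \<in> candidates z c"
  using assms by (simp add: candidate_test_def candidates_def matrix_def)

lemma candidates_less: "x \<in> candidates z c \<Longrightarrow> x < n"
  by (simp add: candidates_def)

lemma run_form_clusters:
  assumes k: "known \<sigma>" and H: "matrix \<sigma> ''H'' n trees" and c0: "\<And>x. x < n \<Longrightarrow> \<sigma> ''cl'' [x] = 0" and x: "x < n"
  shows "run form_clusters \<sigma> ''cl'' [x] = cl x"
proof -
  let ?c = "\<lambda>z. fold cluster_step [0..<z] (\<lambda>_. 0)"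
  let ?body = "Put ''cnt'' [] (Const 0) ;; count_candidates ;;
     Cond (Neg (Less (V ''cnt'') (V ''L''))) mark_candidates"
  have "\<forall>x<n. run (For ''z'' ?body) \<sigma> ''cl'' [x] = ?c (\<sigma> ''n'' []) x"
  proof (rule For_rule[where I = "\<lambda>z \<tau>. \<forall>x<n. \<tau> ''cl'' [x] = ?c z x"])
    fix z \<tau> assume z: "z < \<sigma> ''n'' []" "\<tau> ''z'' [] = z" and cz: "\<forall>x<n. \<tau> ''cl'' [x] = ?c z x"
      and same: "\<And>y. y \<noteq> ''z'' \<Longrightarrow> y \<notin> writes ?body \<Longrightarrow> \<tau> y = \<sigma> y"
    let ?A = "candidates z (?c z)"
    have zn: "z < n" using z known_n[OF k] by simp
    define \<tau>1 where "\<tau>1 = run (Put ''cnt'' [] (Const 0)) \<tau>"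
    define \<tau>2 where "\<tau>2 = run count_candidates \<tau>1"
    have t1: "\<tau>1 y = \<tau> y" if "y \<noteq> ''cnt''" for y unfolding \<tau>1_def using that by (simp add: put_other)
    have t2: "\<tau>2 y = \<tau>1 y" if "y \<notin> {''a'', ''cnt''}" for y
      unfolding \<tau>2_def using that by (intro run_frame) (simp add: count_candidates_def)
    have st: "\<tau> y = \<sigma> y" if "y \<in> {''n'', ''G'', ''H'', ''L''}" for y
      using that same[of y] by (auto simp: count_candidates_def mark_candidates_def)
    have mat: "matrix \<tau> ''G'' n E" "matrix \<tau> ''H'' n trees"
      using k H st unfolding known_def input_ok_def matrix_def by auto
    have nn: "\<tau>1 ''n'' [] = n" "\<tau>2 ''n'' [] = n" "\<tau>2 ''L'' [] = L"
      using t1 t2 st k unfolding known_def input_ok_def by simp_all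
    have "\<tau>2 ''cnt'' [] = card (?A \<inter> {..<\<tau>1 ''n'' []})"
      unfolding \<tau>2_def count_candidates_def
    proof (rule For_rule[where I = "\<lambda>a \<tau>. \<tau> ''cnt'' [] = card (?A \<inter> {..<a})"])
      fix a \<rho> assume a: "a < \<tau>1 ''n'' []" "\<rho> ''a'' [] = a" "\<rho> ''cnt'' [] = card (?A \<inter> {..<a})"
        and s: "\<And>y. y \<noteq> ''a'' \<Longrightarrow> y \<notin> writes (Cond candidate_test (Put ''cnt'' [] (Plus (V ''cnt'') (Const 1)))) \<Longrightarrow> \<rho> y = \<tau>1 y"
      have an: "a < n" using a nn by simp
      have "matrix \<rho> ''G'' n E" "matrix \<rho> ''H'' n trees" "\<rho> ''z'' [] = z" "\<rho> ''cl'' [a] = ?c z a"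
        using mat s t1 z cz an unfolding matrix_def by simp_all
      then have "bval candidate_test \<rho> \<longleftrightarrow> a \<in> ?A" using bval_candidate_test zn a(2) an by blast
      moreover have "?A \<inter> {..<Suc a} = (if a \<in> ?A then insert a (?A \<inter> {..<a}) else ?A \<inter> {..<a})"
        by (auto simp: less_Suc_eq)
      ultimately show "run (Cond candidate_test (Put ''cnt'' [] (Plus (V ''cnt'') (Const 1)))) \<rho> ''cnt'' [] = card (?A \<inter> {..<Suc a})"
        using a(3) by (simp add: put_def)
    qed (simp_all add: \<tau>1_def put_def)
    moreover have "?A \<inter> {..<n} = ?A" using candidates_less by auto
    ultimately have cnt: "\<tau>2 ''cnt'' [] = card ?A" unfolding nn by simp
    have step: "?c (Suc z) = cluster_step z (?c z)" by simp
    show "\<forall>x<n. run ?body \<tau> ''cl'' [x] = ?c (Suc z) x"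
    proof (cases "card ?A < L")
      case True
      then have "run ?body \<tau> = \<tau>2" using cnt nn unfolding \<tau>1_def \<tau>2_def by simp
      moreover have "?c (Suc z) = ?c z" unfolding step using cluster_step_def[of z "?c z"] True by simp
      ultimately show ?thesis using cz t1 t2 by simp
    next
      case False
      then have r: "run ?body \<tau> = run mark_candidates \<tau>2" using cnt nn unfolding \<tau>1_def \<tau>2_def by simp
      have "\<forall>x<n. run mark_candidates \<tau>2 ''cl'' [x] = (if x < \<tau>2 ''n'' [] \<and> x \<in> ?A then Suc z else ?c z x)"
        unfolding mark_candidates_def
      proof (rule For_rule[where I = "\<lambda>a \<tau>. \<forall>x<n. \<tau> ''cl'' [x] = (if x < a \<and> x \<in> ?A then Suc z else ?c z x)"])
        fix a \<rho> assume a: "a < \<tau>2 ''n'' []" "\<rho> ''a'' [] = a"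
            "\<forall>x<n. \<rho> ''cl'' [x] = (if x < a \<and> x \<in> ?A then Suc z else ?c z x)"
          and s: "\<And>y. y \<noteq> ''a'' \<Longrightarrow> y \<notin> writes (Cond candidate_test (Put ''cl'' [V ''a''] (Plus (V ''z'') (Const 1)))) \<Longrightarrow> \<rho> y = \<tau>2 y"
        have an: "a < n" using a nn by simp
        have "matrix \<rho> ''G'' n E" "matrix \<rho> ''H'' n trees" and zz: "\<rho> ''z'' [] = z"
          using mat s t1 t2 z unfolding matrix_def by simp_all
        moreover have "\<rho> ''cl'' [a] = ?c z a" using a(3) an by simp
        ultimately have "bval candidate_test \<rho> \<longleftrightarrow> a \<in> ?A" using bval_candidate_test zn a(2) an by blast
        then show "\<forall>x<n. run (Cond candidate_test (Put ''cl'' [V ''a''] (Plus (V ''z'') (Const 1)))) \<rho> ''cl'' [x]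
            = (if x < Suc a \<and> x \<in> ?A then Suc z else ?c z x)"
          using a(2,3) zz by (auto simp: put_def less_Suc_eq)
      qed (use cz t1 t2 in \<open>simp_all add: put_other\<close>)
      moreover have "cluster_step z (?c z) = (\<lambda>x. if x \<in> ?A then Suc z else ?c z x)"
        using cluster_step_def[of z "?c z"] False by simp
      ultimately show ?thesis unfolding r step nn by simp
    qed
  qed (use c0 in \<open>simp_all add: put_other count_candidates_def mark_candidates_def\<close>)
  then show ?thesis using x known_n[OF k] unfolding form_clusters_def cl_def by simp
qed

lemma run_add_linked:
  assumes k: "known \<sigma>" and H: "matrix \<sigma> ''H'' n trees" and c: "\<And>x. x < n \<Longrightarrow> \<sigma> ''cl'' [x] = cl x"
  shows "matrix (run add_linked \<sigma>) ''H'' n H1"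
proof -
  let ?c = "Cond linked_test (add_edge (V ''a'') (V ''b''))"
  let ?T = "\<lambda>u b. {{u, v} | v. v < b \<and> {u, v} \<in> E \<and> linked u v}"
  let ?S = "\<lambda>a. trees \<union> (\<Union>u<a. ?T u n)"
  have n: "\<sigma> ''n'' [] = n" and G: "matrix \<sigma> ''G'' n E" using k unfolding known_def input_ok_def by auto
  have "matrix (run (For ''a'' (For ''b'' ?c)) \<sigma>) ''H'' n (?S (\<sigma> ''n'' []))"
  proof (rule For_rule[where I = "\<lambda>a \<tau>. matrix \<tau> ''H'' n (?S a)"])
    fix a \<tau> assume a: "a < \<sigma> ''n'' []" "\<tau> ''a'' [] = a" "matrix \<tau> ''H'' n (?S a)"
      and same: "\<And>y. y \<noteq> ''a'' \<Longrightarrow> y \<notin> writes (For ''b'' ?c) \<Longrightarrow> \<tau> y = \<sigma> y"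
    have nt: "\<tau> ''n'' [] = n" using same n by simp
    have "matrix (run (For ''b'' ?c) \<tau>) ''H'' n (?S a \<union> ?T a (\<tau> ''n'' []))"
    proof (rule For_rule[where I = "\<lambda>b \<tau>. matrix \<tau> ''H'' n (?S a \<union> ?T a b)"])
      fix b \<rho> assume b: "b < \<tau> ''n'' []" "\<rho> ''b'' [] = b" "matrix \<rho> ''H'' n (?S a \<union> ?T a b)"
        and s: "\<And>y. y \<noteq> ''b'' \<Longrightarrow> y \<notin> writes ?c \<Longrightarrow> \<rho> y = \<tau> y"
      have ab: "a < n" "b < n" using a b n nt by auto
      have "\<rho> ''a'' [] = a" "\<rho> ''G'' [a, b] = (if {a, b} \<in> E then 1 else 0)" "\<rho> ''cl'' [a] = cl a" "\<rho> ''cl'' [b] = cl b"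
        using same s a(2) ab G c unfolding matrix_def by simp_all
      note v = this b(2)
      have test: "bval linked_test \<rho> \<longleftrightarrow> {a, b} \<in> E \<and> linked a b"
        unfolding linked_test_def linked_def using v by auto
      show "matrix (run ?c \<rho>) ''H'' n (?S a \<union> ?T a (Suc b))"
      proof (cases "{a, b} \<in> E \<and> linked a b")
        case True
        then have S: "?S a \<union> ?T a (Suc b) = insert {a, b} (?S a \<union> ?T a b)" by (auto simp: less_Suc_eq)
        have "matrix (run (add_edge (V ''a'') (V ''b'')) \<rho>) ''H'' n (insert {aval (V ''a'') \<rho>, aval (V ''b'') \<rho>} (?S a \<union> ?T a b))"
          by (rule run_add_edge[OF b(3)]) (simp_all add: put_other)
        then show ?thesis using True v unfolding S run_Cond[OF test] by simp
      next
        case False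
        then have "?T a (Suc b) = ?T a b" by (auto simp: less_Suc_eq)
        then show ?thesis using b(3) unfolding run_Cond[OF test] if_not_P[OF False] by simp
      qed
    qed (use a in \<open>simp_all add: put_other matrix_def\<close>)
    moreover have "?S a \<union> ?T a n = ?S (Suc a)" unfolding lessThan_Suc by blast
    ultimately show "matrix (run (For ''b'' ?c) \<tau>) ''H'' n (?S (Suc a))" unfolding nt by simp
  qed (use H in \<open>simp_all add: put_other matrix_def\<close>)
  moreover have "?S n = H1"
  proof -
    have "(\<Union>u<n. ?T u n) = {{u, v} | u v. {u, v} \<in> E \<and> linked u v}" using edge_less by auto
    then show ?thesis unfolding H1_def by simp
  qed
  ultimately show ?thesis unfolding add_linked_def n by simp
qed

definition detour_ok :: "nat \<Rightarrow> store \<Rightarrow> bool" where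
  "detour_ok q \<sigma> \<longleftrightarrow> \<sigma> ''p'' [] = par q \<and> \<sigma> ''q'' [] = q \<and> (\<forall>v<n. \<sigma> ''e'' [v] = dq q v) \<and>
     (\<forall>v<n. v \<noteq> s \<longrightarrow> dq q v < n \<longrightarrow> \<sigma> ''r'' [v] = pr q v)"

lemma detour_ok_cong: "detour_ok q \<sigma> \<Longrightarrow>
    \<tau> ''p'' = \<sigma> ''p'' \<Longrightarrow> \<tau> ''q'' = \<sigma> ''q'' \<Longrightarrow> \<tau> ''e'' = \<sigma> ''e'' \<Longrightarrow> \<tau> ''r'' = \<sigma> ''r'' \<Longrightarrow> detour_ok q \<tau>"
  unfolding detour_ok_def by simp

lemma run_avoid_tree_edge:
  assumes k: "known \<sigma>" and q: "q \<in> Q" "\<sigma> ''q'' [] = q"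
  shows "detour_ok q (run avoid_tree_edge \<sigma>)"
proof -
  define \<sigma>1 where "\<sigma>1 = run (Put ''p'' [] (Read ''par'' [V ''q''])) \<sigma>"
  define \<sigma>2 where "\<sigma>2 = run (distances ''G'' ''e'') \<sigma>1"
  define \<sigma>3 where "\<sigma>3 = run (predecessors ''e'' ''r'') \<sigma>2"
  let ?c = "Cond (Conj (Neg (Equal (V ''a'') (V ''q'')))
         (Equal (Plus (Read ''e'' [Read ''par'' [V ''a'']]) (Const 1)) (Read ''e'' [V ''a''])))
       (Put ''r'' [V ''a''] (Read ''par'' [V ''a'']))"
  have run: "run avoid_tree_edge \<sigma> = run (For ''a'' ?c) \<sigma>3"
    unfolding avoid_tree_edge_def \<sigma>1_def \<sigma>2_def \<sigma>3_def by simp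
  have qn: "q < n" using q dep_vertex by blast
  have s1: "\<sigma>1 y = \<sigma> y" if "y \<noteq> ''p''" for y
    unfolding \<sigma>1_def using that by (simp add: put_other)
  have s2: "\<sigma>2 y = \<sigma>1 y" if "y \<notin> {''a'', ''b'', ''k'', ''e''}" for y
    unfolding \<sigma>2_def using that by (intro run_frame) simp
  have s3: "\<sigma>3 y = \<sigma>2 y" if "y \<notin> {''a'', ''b'', ''r''}" for y
    unfolding \<sigma>3_def using that by (intro run_frame) simp
  have p1: "\<sigma>1 ''p'' [] = par q" using k q qn unfolding \<sigma>1_def known_def tree_ok_def by (simp add: put_def)
  have k1: "known \<sigma>1" using k by (rule known_cong) (simp_all add: s1)
  have k2: "known \<sigma>2" using k1 by (rule known_cong) (simp_all add: s2)
  have k3: "known \<sigma>3" using k2 by (rule known_cong) (simp_all add: s3)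
  have pq: "{\<sigma>1 ''p'' [], \<sigma>1 ''q'' []} = tree q" "{\<sigma>2 ''p'' [], \<sigma>2 ''q'' []} = tree q"
    using p1 q(2) s1 s2 unfolding tree_edge_def by simp_all
  have e2: "\<sigma>2 ''e'' [v] = dq q v" if "v < n" for v
  proof -
    have "run (distances ''G'' ''e'') \<sigma>1 ''e'' [v] = sdist n s (E - {{\<sigma>1 ''p'' [], \<sigma>1 ''q'' []}}) v"
      by (rule run_distances) (use k1 that edge_sub source_less in \<open>auto simp: known_def input_ok_def\<close>)
    then show ?thesis unfolding \<sigma>2_def pq .
  qed
  have r3: "\<sigma>3 ''r'' [v] = pred_of n (E - {tree q}) (dq q) v" if v: "v < n" "v \<noteq> s" "dq q v < n" for v
  proof -
    have "\<exists>u<n. {u, v} \<in> E - {tree q} \<and> Suc (dq q u) = dq q v"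
      by (rule sdist_pred) (use edge_sub v in auto)
    then have "run (predecessors ''e'' ''r'') \<sigma>2 ''r'' [v] =
        pred_of n (E - {{\<sigma>2 ''p'' [], \<sigma>2 ''q'' []}}) (dq q) v"
      by (intro run_predecessors) (use e2 v k2 in \<open>simp_all add: known_def input_ok_def pq\<close>)
    then show ?thesis unfolding \<sigma>3_def pq .
  qed
  have n3: "\<sigma>3 ''n'' [] = n" using known_n[OF k3] by blast
  have "\<forall>v<n. v \<noteq> s \<longrightarrow> dq q v < n \<longrightarrow> run (For ''a'' ?c) \<sigma>3 ''r'' [v] =
      (if v < \<sigma>3 ''n'' [] then pr q v else pred_of n (E - {tree q}) (dq q) v)"
  proof (rule For_rule[where I = "\<lambda>a \<tau>. \<forall>v<n. v \<noteq> s \<longrightarrow> dq q v < n \<longrightarrow>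
      \<tau> ''r'' [v] = (if v < a then pr q v else pred_of n (E - {tree q}) (dq q) v)"])
    fix a \<tau> assume a: "a < \<sigma>3 ''n'' []" "\<tau> ''a'' [] = a"
        "\<forall>v<n. v \<noteq> s \<longrightarrow> dq q v < n \<longrightarrow> \<tau> ''r'' [v] = (if v < a then pr q v else pred_of n (E - {tree q}) (dq q) v)"
      and same: "\<And>y. y \<noteq> ''a'' \<Longrightarrow> y \<notin> writes ?c \<Longrightarrow> \<tau> y = \<sigma>3 y"
    have an: "a < n" using a n3 by simp
    have "run ?c \<tau> ''r'' [a] = pr q a" if "a \<noteq> s" "dq q a < n"
    proof -
      have da: "dep a < n" using that dq_dep_less by blast
      then have pn: "par a < n" using par_reach dep_vertex by blast
      have "\<tau> ''par'' [a] = par a" using same k3 an da unfolding known_def tree_ok_def by simp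
      moreover have "\<tau> ''e'' [a] = dq q a" "\<tau> ''e'' [par a] = dq q (par a)"
        using same s3 e2 an pn by simp_all
      moreover have "\<tau> ''q'' [] = q" using same s1 s2 s3 q(2) by simp
      moreover have "\<tau> ''r'' [a] = pred_of n (E - {tree q}) (dq q) a" using a(3) an that by simp
      ultimately show ?thesis using a(2) by (auto simp: put_def pr_def Let_def)
    qed
    moreover have "run ?c \<tau> ''r'' [v] = \<tau> ''r'' [v]" if "v \<noteq> a" for v
      using that a(2) by (simp add: put_def)
    ultimately show "\<forall>v<n. v \<noteq> s \<longrightarrow> dq q v < n \<longrightarrow>
        run ?c \<tau> ''r'' [v] = (if v < Suc a then pr q v else pred_of n (E - {tree q}) (dq q) v)"
      using a(3) by (metis less_Suc_eq)
  qed (use r3 in \<open>simp_all add: put_other\<close>)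
  then have r: "\<forall>v<n. v \<noteq> s \<longrightarrow> dq q v < n \<longrightarrow> run (For ''a'' ?c) \<sigma>3 ''r'' [v] = pr q v"
    unfolding n3 by simp
  have s4: "run (For ''a'' ?c) \<sigma>3 y = \<sigma>3 y" if "y \<notin> {''a'', ''r''}" for y
    using that by (intro run_frame) simp
  show ?thesis unfolding run detour_ok_def using r s4 s3 s2 s1 e2 p1 q(2) by simp
qed

lemma avoid_tree_edge_frame:
  assumes "known \<sigma>"
  shows "known (run avoid_tree_edge \<sigma>)" "run avoid_tree_edge \<sigma> ''H'' = \<sigma> ''H''"
  by (rule known_cong[OF assms]; simp add: run_frame) (simp add: run_frame)

lemma run_add_bottoms:
  assumes k: "known \<sigma>" and H: "matrix \<sigma> ''H'' n H1"
  shows "matrix (run add_bottoms \<sigma>) ''H'' n H0"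
proof -
  let ?w = "Cond bottom_test (add_edge (Read ''r'' [V ''w'']) (V ''w''))"
  let ?c = "Cond (Conj (Less (Const 0) (Read ''d'' [V ''q''])) (Less (Read ''d'' [V ''q'']) (V ''n'')))
     (avoid_tree_edge ;; For ''w'' ?w)"
  let ?S = "\<lambda>i. H1 \<union> (\<Union>q\<in>{q\<in>Q. q < i}. bottoms q)"
  let ?T = "\<lambda>q i. {{pr q w, w} | w. w < i \<and> dq q w < n \<and> w \<noteq> s \<and> dep w \<le> dep q + L}"
  have n: "\<sigma> ''n'' [] = n" using known_n[OF k] by blast
  have "matrix (run (For ''q'' ?c) \<sigma>) ''H'' n (?S (\<sigma> ''n'' []))"
  proof (rule For_rule[where I = "\<lambda>i \<tau>. matrix \<tau> ''H'' n (?S i)"])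
    fix q \<tau> assume q: "q < \<sigma> ''n'' []" "\<tau> ''q'' [] = q" "matrix \<tau> ''H'' n (?S q)"
      and same: "\<And>y. y \<noteq> ''q'' \<Longrightarrow> y \<notin> writes ?c \<Longrightarrow> \<tau> y = \<sigma> y"
    have k1: "known \<tau>" using k by (rule known_cong) (simp_all add: same)
    have qn: "q < n" using q n by simp
    have d: "\<tau> ''d'' [q] = dep q" "\<tau> ''n'' [] = n"
      using k1 qn unfolding known_def tree_ok_def input_ok_def by simp_all
    have test: "bval (Conj (Less (Const 0) (Read ''d'' [V ''q''])) (Less (Read ''d'' [V ''q'']) (V ''n''))) \<tau> \<longleftrightarrow> q \<in> Q"
      using d q(2) by (auto simp: sdist_eq_0 intro: gr0I)
    show "matrix (run ?c \<tau>) ''H'' n (?S (Suc q))"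
    proof (cases "q \<in> Q")
      case True
      define \<tau>1 where "\<tau>1 = run avoid_tree_edge \<tau>"
      have D: "detour_ok q \<tau>1" unfolding \<tau>1_def using run_avoid_tree_edge k1 True q(2) by blast
      have k2: "known \<tau>1" and H1: "\<tau>1 ''H'' = \<tau> ''H''" unfolding \<tau>1_def using avoid_tree_edge_frame[OF k1] by auto
      have "matrix (run (For ''w'' ?w) \<tau>1) ''H'' n (?S q \<union> ?T q (\<tau>1 ''n'' []))"
      proof (rule For_rule[where I = "\<lambda>i \<tau>. matrix \<tau> ''H'' n (?S q \<union> ?T q i)"])
        fix w \<rho> assume w: "w < \<tau>1 ''n'' []" "\<rho> ''w'' [] = w" "matrix \<rho> ''H'' n (?S q \<union> ?T q w)"
          and s: "\<And>y. y \<noteq> ''w'' \<Longrightarrow> y \<notin> writes ?w \<Longrightarrow> \<rho> y = \<tau>1 y"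
        have wn: "w < n" using w known_n[OF k2] by simp
        have k3: "known \<rho>" using k2 by (rule known_cong) (simp_all add: s)
        have D3: "detour_ok q \<rho>" using D by (rule detour_ok_cong) (simp_all add: s)
        have v: "\<rho> ''e'' [w] = dq q w" "\<rho> ''d'' [q] = dep q" "\<rho> ''d'' [w] = dep w" "\<rho> ''q'' [] = q"
          "\<rho> ''n'' [] = n" "\<rho> ''L'' [] = L" "w \<noteq> s \<Longrightarrow> dq q w < n \<Longrightarrow> \<rho> ''r'' [w] = pr q w"
          using k3 D3 wn qn unfolding known_def tree_ok_def input_ok_def detour_ok_def by simp_all
        have test: "bval bottom_test \<rho> \<longleftrightarrow> dq q w < n \<and> w \<noteq> s \<and> dep w \<le> dep q + L"
          using v w(2) unfolding bottom_test_def by (auto simp: sdist_eq_0 not_less intro: gr0I)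
        show "matrix (run ?w \<rho>) ''H'' n (?S q \<union> ?T q (Suc w))"
        proof (cases "dq q w < n \<and> w \<noteq> s \<and> dep w \<le> dep q + L")
          case True
          then have S: "?S q \<union> ?T q (Suc w) = insert {pr q w, w} (?S q \<union> ?T q w)" by (auto simp: less_Suc_eq)
          have "matrix (run (add_edge (Read ''r'' [V ''w'']) (V ''w'')) \<rho>) ''H'' n
              (insert {aval (Read ''r'' [V ''w'']) \<rho>, aval (V ''w'') \<rho>} (?S q \<union> ?T q w))"
            by (rule run_add_edge[OF w(3)]) (simp_all add: put_other)
          then show ?thesis using True v w(2) unfolding S run_Cond[OF test] by simp
        next
          case False
          then have "?T q (Suc w) = ?T q w" by (auto simp: less_Suc_eq)
          then show ?thesis using w(3) unfolding run_Cond[OF test] if_not_P[OF False] by simp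
        qed
      qed (use q(3) H1 in \<open>simp_all add: put_other matrix_def\<close>)
      moreover have "?T q n = bottoms q"
        unfolding bottoms_def using dep_vertex dq_dep_less by blast
      moreover have "?S (Suc q) = ?S q \<union> bottoms q" using True by (auto simp: less_Suc_eq)
      ultimately have "matrix (run (For ''w'' ?w) \<tau>1) ''H'' n (?S (Suc q))"
        using known_n[OF k2] by simp
      then show ?thesis using True unfolding \<tau>1_def run_Cond[OF test] by simp
    next
      case False
      then have "?S (Suc q) = ?S q" by (auto simp: less_Suc_eq)
      then show ?thesis using q(3) unfolding run_Cond[OF test] if_not_P[OF False] by simp
    qed
  qed (use H in \<open>simp_all add: put_other matrix_def\<close>)
  moreover have "?S n = H0" unfolding H0_def using dep_vertex by auto
  ultimately show ?thesis unfolding add_bottoms_def n by simp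
qed

lemma run_add_path:
  assumes k: "known \<sigma>" and D: "detour_ok q \<sigma>" and H: "matrix \<sigma> ''H'' n F"
    and v: "\<sigma> ''v'' [] = v" "dq q v < n"
  shows "matrix (run add_path \<sigma>) ''H'' n (F \<union> trace (pr q) (dq q v) v)"
proof -
  let ?c = "Cond (Less (Const 0) (Read ''e'' [V ''w'']))
       (add_edge (Read ''r'' [V ''w'']) (V ''w'') ;; Put ''w'' [] (Read ''r'' [V ''w'']))"
  define \<sigma>1 where "\<sigma>1 = run (Put ''w'' [] (V ''v'')) \<sigma>"
  \<comment> \<open>\<open>min\<close> freezes the state after \<open>dq q v\<close> steps, when the
    source has been reached.\<close>
  let ?m = "\<lambda>j. min j (dq q v)"
  let ?I = "\<lambda>j \<tau>. \<tau> ''w'' [] = (pr q ^^ ?m j) v \<and> matrix \<tau> ''H'' n (F \<union> trace (pr q) (?m j) v)"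
  have s1: "\<sigma>1 y = \<sigma> y" if "y \<noteq> ''w''" for y unfolding \<sigma>1_def using that by (simp add: put_other)
  have down: "dq q ((pr q ^^ m) v) + m = dq q v" if "m \<le> dq q v" for m
    using that
  proof (induction m)
    case (Suc m)
    let ?x = "(pr q ^^ m) v"
    have "?x \<noteq> s" using Suc by fastforce
    moreover have "dq q ?x < n" using Suc v(2) by simp
    ultimately show ?case using pr_dist[of ?x q] Suc by simp
  qed simp
  have "?I (\<sigma>1 ''n'' []) (run (For ''j'' ?c) \<sigma>1)"
  proof (rule For_rule[where I = ?I])
    fix j \<tau> assume I: "?I j \<tau>" and same: "\<And>y. y \<noteq> ''j'' \<Longrightarrow> y \<notin> writes ?c \<Longrightarrow> \<tau> y = \<sigma>1 y"
    define x where "x = (pr q ^^ ?m j) v"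
    have dx: "dq q x + ?m j = dq q v" unfolding x_def by (rule down) simp
    then have dxn: "dq q x < n" using v(2) by simp
    then have xn: "x < n" using dep_vertex dq_dep_less by blast
    have D2: "detour_ok q \<tau>" using D by (rule detour_ok_cong) (simp_all add: same s1)
    have val: "\<tau> ''w'' [] = x" "\<tau> ''e'' [x] = dq q x" "x \<noteq> s \<Longrightarrow> \<tau> ''r'' [x] = pr q x"
      using I D2 xn dxn unfolding x_def detour_ok_def by simp_all
    show "?I (Suc j) (run ?c \<tau>)"
    proof (cases "j < dq q v")
      case True
      then have m: "?m j = j" "?m (Suc j) = Suc j" by simp_all
      have pos: "0 < dq q x" using dx True by simp
      then have xs: "x \<noteq> s" by auto
      have M: "matrix (run (add_edge (Read ''r'' [V ''w'']) (V ''w'')) \<tau>) ''H'' n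
          (insert {aval (Read ''r'' [V ''w'']) \<tau>, aval (V ''w'') \<tau>} (F \<union> trace (pr q) j v))"
        by (rule run_add_edge) (use I m in \<open>simp_all add: put_other\<close>)
      have tr: "F \<union> trace (pr q) (Suc j) v = insert {pr q x, x} (F \<union> trace (pr q) j v)"
        unfolding trace_def x_def m by (auto simp: lessThan_Suc)
      define \<rho> where "\<rho> = run (add_edge (Read ''r'' [V ''w'']) (V ''w'')) \<tau>"
      have fr: "\<rho> y = \<tau> y" if "y \<noteq> ''H''" for y unfolding \<rho>_def using that by (intro run_frame) simp
      have r: "run ?c \<tau> = put \<rho> ''w'' [] (pr q x)" using val pos xs fr unfolding \<rho>_def by simp
      have "pr q x = (pr q ^^ Suc j) v" unfolding x_def m by simp
      then show ?thesis using M val xs unfolding r m tr \<rho>_def[symmetric]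
        by (simp add: put_apply put_other matrix_def)
    next
      case False
      then have "?m (Suc j) = ?m j" "dq q x = 0" using dx by simp_all
      then show ?thesis using I val by simp
    qed
  qed (use H v in \<open>simp_all add: \<sigma>1_def put_other matrix_def trace_def put_apply\<close>)
  moreover have "\<sigma>1 ''n'' [] = n" using s1 known_n[OF k] by simp
  ultimately show ?thesis using v(2) unfolding add_path_def \<sigma>1_def by simp
qed

lemma augment_sub:
  assumes "F \<subseteq> E" shows "augment n s E par pr x F \<subseteq> E"
proof -
  obtain q v where x: "x = (q, v)" by (metis surj_pair)
  have "trace (pr q) (dq q v) v \<subseteq> E" if "dq q v < n"
    using trace_eq[OF that] pr_E[of _ q] on_path_less[OF _ that] by auto
  then show ?thesis using assms unfolding x augment_def by simp
qed

lemma fold_augment_sub: "F \<subseteq> E \<Longrightarrow> fold (augment n s E par pr) xs F \<subseteq> E"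
  by (induction xs arbitrary: F) (simp_all add: augment_sub)

lemma run_visit:
  assumes k: "known \<sigma>" and D: "detour_ok q \<sigma>" and H: "matrix \<sigma> ''H'' n F" and F: "F \<subseteq> E"
    and v: "\<sigma> ''v'' [] = v" "v < n"
  shows "matrix (run visit \<sigma>) ''H'' n (augment n s E par pr (q, v) F)"
proof (cases "dq q v < n \<and> v \<noteq> s \<and> {pr q v, v} \<notin> F")
  case True
  then have "pr q v < n" using pr_E edge_less by blast
  then have go: "bval (Conj (Less (Const 0) (Read ''e'' [V ''v''])) (Conj (Less (Read ''e'' [V ''v'']) (V ''n''))
       (Equal (Read ''H'' [Read ''r'' [V ''v''], V ''v'']) (Const 0)))) \<sigma>"
    using True D H v known_n[OF k] unfolding detour_ok_def matrix_def by (auto simp: sdist_eq_0 intro: gr0I)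
  define \<sigma>1 where "\<sigma>1 = run (distances ''H'' ''h'') \<sigma>"
  have s1: "\<sigma>1 y = \<sigma> y" if "y \<notin> {''a'', ''b'', ''k'', ''h''}" for y
    unfolding \<sigma>1_def using that by (intro run_frame) simp
  have pq: "{\<sigma> ''p'' [], \<sigma> ''q'' []} = tree q" using D unfolding detour_ok_def tree_edge_def by simp
  have h: "\<sigma>1 ''h'' [v] = sdist n s (F - {tree q}) v"
  proof -
    have "run (distances ''H'' ''h'') \<sigma> ''h'' [v] = sdist n s (F - {{\<sigma> ''p'' [], \<sigma> ''q'' []}}) v"
      by (rule run_distances) (use H k F edge_sub source_less v(2) in \<open>auto simp: known_def input_ok_def\<close>)
    then show ?thesis unfolding \<sigma>1_def pq .
  qed
  have e: "\<sigma>1 ''e'' [v] = dq q v" "\<sigma>1 ''v'' [] = v" using s1 D v unfolding detour_ok_def by simp_all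
  \<comment> \<open>Since \<open>dq q v < n\<close>, the default \<open>n + 5\<close> exceeds
    \<open>dq q v + 4\<close>; so the numerical test also fires when \<open>v\<close> is cut off in
    the current structure.\<close>
  have iff: "dq q v + 4 < sdist n s (F - {tree q}) v \<longleftrightarrow> \<not> reach (F - {tree q}) (dq q v + 4) s v"
  proof
    assume "dq q v + 4 < sdist n s (F - {tree q}) v"
    then show "\<not> reach (F - {tree q}) (dq q v + 4) s v" using sdist_le[of "F - {tree q}" "dq q v + 4" s v n] by linarith
  next
    assume nr: "\<not> reach (F - {tree q}) (dq q v + 4) s v"
    show "dq q v + 4 < sdist n s (F - {tree q}) v"
    proof (rule ccontr)
      assume "\<not> ?thesis"
      then have le: "sdist n s (F - {tree q}) v \<le> dq q v + 4" by simp
      then have r: "reach (F - {tree q}) (sdist n s (F - {tree q}) v) s v"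
        using True by (intro reach_sdist) simp
      from reach_mono[OF r order_refl le] nr show False by (rule rev_notE)
    qed
  qed
  have run: "run visit \<sigma> = run (Cond (Less (Plus (Read ''e'' [V ''v'']) (Const 4)) (Read ''h'' [V ''v''])) add_path) \<sigma>1"
    unfolding visit_def \<sigma>1_def using go by (simp del: bval.simps)
  have H1: "matrix \<sigma>1 ''H'' n F" using H s1 unfolding matrix_def by simp
  show ?thesis
  proof (cases "dq q v + 4 < sdist n s (F - {tree q}) v")
    case t: True
    have "known \<sigma>1" using k by (rule known_cong) (simp_all add: s1)
    moreover have "detour_ok q \<sigma>1" using D by (rule detour_ok_cong) (simp_all add: s1)
    ultimately have "matrix (run add_path \<sigma>1) ''H'' n (F \<union> trace (pr q) (dq q v) v)"
      using run_add_path H1 e(2) True by blast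
    then show ?thesis using run t e h iff True by (simp add: augment_def)
  next
    case False
    then show ?thesis using run e h iff H1 by (simp add: augment_def)
  qed
next
  case False
  have "\<not> bval (Conj (Less (Const 0) (Read ''e'' [V ''v''])) (Conj (Less (Read ''e'' [V ''v'']) (V ''n''))
       (Equal (Read ''H'' [Read ''r'' [V ''v''], V ''v'']) (Const 0)))) \<sigma>"
  proof
    assume b: "bval (Conj (Less (Const 0) (Read ''e'' [V ''v''])) (Conj (Less (Read ''e'' [V ''v'']) (V ''n''))
       (Equal (Read ''H'' [Read ''r'' [V ''v''], V ''v'']) (Const 0)))) \<sigma>"
    then have vs: "v \<noteq> s" "dq q v < n"
      using D v known_n[OF k] unfolding detour_ok_def by auto
    then have "pr q v < n" using pr_E edge_less by blast
    then show False using b False vs D v H unfolding detour_ok_def matrix_def by (simp split: if_splits)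
  qed
  then show ?thesis using H False unfolding visit_def augment_def by (auto simp del: bval.simps)
qed

text \<open>The nested loops visit levels, tree edges and targets in the order of
  \<open>evs\<close>, so every invariant is a partial result of the same fold.\<close>

lemma run_augment_all:
  assumes k: "known \<sigma>" and H: "matrix \<sigma> ''H'' n H0"
  shows "matrix (run augment_all \<sigma>) ''H'' n spanner"
proof -
  let ?f = "fold (augment n s E par pr)"
  let ?c = "Cond (Conj (Equal (Plus (Read ''d'' [V ''q'']) (Plus (V ''i'') (Const 1))) (V ''n''))
       (Less (Const 0) (Read ''d'' [V ''q'']))) (avoid_tree_edge ;; For ''v'' visit)"
  let ?row = "\<lambda>i. concat (map (evs_at i) [0..<n])"
  have n: "\<sigma> ''n'' [] = n" using known_n[OF k] by blast
  have "matrix (run (For ''i'' (For ''q'' ?c)) \<sigma>) ''H'' n (?f (concat (map ?row [0..<\<sigma> ''n'' []])) H0)"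
  proof (rule For_rule[where I = "\<lambda>i \<tau>. matrix \<tau> ''H'' n (?f (concat (map ?row [0..<i])) H0)"])
    fix i \<tau> assume i: "i < \<sigma> ''n'' []" "\<tau> ''i'' [] = i" "matrix \<tau> ''H'' n (?f (concat (map ?row [0..<i])) H0)"
      and same: "\<And>y. y \<noteq> ''i'' \<Longrightarrow> y \<notin> writes (For ''q'' ?c) \<Longrightarrow> \<tau> y = \<sigma> y"
    define F where "F = ?f (concat (map ?row [0..<i])) H0"
    have FE: "F \<subseteq> E" unfolding F_def using fold_augment_sub H0_sub by blast
    have k1: "known \<tau>" using k by (rule known_cong) (simp_all add: same)
    have "matrix (run (For ''q'' ?c) \<tau>) ''H'' n (?f (concat (map (evs_at i) [0..<\<tau> ''n'' []])) F)"
    proof (rule For_rule[where I = "\<lambda>q \<tau>. matrix \<tau> ''H'' n (?f (concat (map (evs_at i) [0..<q])) F)"])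
      fix q \<rho> assume q: "q < \<tau> ''n'' []" "\<rho> ''q'' [] = q" "matrix \<rho> ''H'' n (?f (concat (map (evs_at i) [0..<q])) F)"
        and s: "\<And>y. y \<noteq> ''q'' \<Longrightarrow> y \<notin> writes ?c \<Longrightarrow> \<rho> y = \<tau> y"
      define F' where "F' = ?f (concat (map (evs_at i) [0..<q])) F"
      have FE': "F' \<subseteq> E" unfolding F'_def using fold_augment_sub FE by blast
      have k2: "known \<rho>" using k1 by (rule known_cong) (simp_all add: s)
      have qn: "q < n" using q(1) known_n[OF k1] by simp
      have d: "\<rho> ''d'' [q] = dep q" "\<rho> ''n'' [] = n" "\<rho> ''i'' [] = i"
        using k2 qn s[of "''i''"] i(2) unfolding known_def tree_ok_def input_ok_def by simp_all
      have test: "bval (Conj (Equal (Plus (Read ''d'' [V ''q'']) (Plus (V ''i'') (Const 1))) (V ''n''))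
         (Less (Const 0) (Read ''d'' [V ''q'']))) \<rho> \<longleftrightarrow> dep q + i + 1 = n \<and> 0 < dep q"
        using d q(2) by simp
      have "matrix (run ?c \<rho>) ''H'' n (?f (evs_at i q) F')"
      proof (cases "dep q + i + 1 = n \<and> 0 < dep q")
        case True
        then have qQ: "q \<in> Q" by auto
        define \<rho>1 where "\<rho>1 = run avoid_tree_edge \<rho>"
        have D: "detour_ok q \<rho>1" unfolding \<rho>1_def using run_avoid_tree_edge k2 qQ q(2) by blast
        have k3: "known \<rho>1" and H1: "\<rho>1 ''H'' = \<rho> ''H''" unfolding \<rho>1_def using avoid_tree_edge_frame[OF k2] by auto
        have "matrix (run (For ''v'' visit) \<rho>1) ''H'' n (?f (map (Pair q) [0..<\<rho>1 ''n'' []]) F')"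
        proof (rule For_rule[where I = "\<lambda>v \<tau>. matrix \<tau> ''H'' n (?f (map (Pair q) [0..<v]) F')"])
          fix v \<theta> assume v: "v < \<rho>1 ''n'' []" "\<theta> ''v'' [] = v" "matrix \<theta> ''H'' n (?f (map (Pair q) [0..<v]) F')"
            and s': "\<And>y. y \<noteq> ''v'' \<Longrightarrow> y \<notin> writes visit \<Longrightarrow> \<theta> y = \<rho>1 y"
          have "known \<theta>" using k3 by (rule known_cong) (simp_all add: s')
          moreover have "detour_ok q \<theta>" using D by (rule detour_ok_cong) (simp_all add: s')
          moreover have "v < n" using v(1) known_n[OF k3] by simp
          ultimately have "matrix (run visit \<theta>) ''H'' n (augment n s E par pr (q, v) (?f (map (Pair q) [0..<v]) F'))"
            using run_visit v(2,3) fold_augment_sub[OF FE'] by blast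
          then show "matrix (run visit \<theta>) ''H'' n (?f (map (Pair q) [0..<Suc v]) F')" by simp
        qed (use q(3) H1 in \<open>simp_all add: put_other matrix_def F'_def\<close>)
        then have "matrix (run (For ''v'' visit) \<rho>1) ''H'' n (?f (evs_at i q) F')"
          using True known_n[OF k3] unfolding evs_at_def by simp
        then show ?thesis using True unfolding \<rho>1_def run_Cond[OF test] by simp
      next
        case False
        then have "evs_at i q = []" unfolding evs_at_def by auto
        then show ?thesis using q(3) unfolding F'_def run_Cond[OF test] if_not_P[OF False] by simp
      qed
      then show "matrix (run ?c \<rho>) ''H'' n (?f (concat (map (evs_at i) [0..<Suc q])) F)"
        unfolding F'_def by (simp del: run.simps)
    qed (use i(3) in \<open>simp_all add: put_other matrix_def F_def\<close>)
    then have "matrix (run (For ''q'' ?c) \<tau>) ''H'' n (?f (?row i) F)" using known_n[OF k1] by simp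
    then show "matrix (run (For ''q'' ?c) \<tau>) ''H'' n (?f (concat (map ?row [0..<Suc i])) H0)"
      unfolding F_def by simp
  qed (use H in \<open>simp_all add: put_other matrix_def\<close>)
  then show ?thesis unfolding augment_all_def spanner_def evs_def n .
qed

end


section \<open>The theorem\<close>

context graph_input
begin

lemma run_spanner_prog:
  assumes i: "input_ok \<sigma>" and z: "\<And>x is. x \<notin> {''n'', ''s'', ''G''} \<Longrightarrow> \<sigma> x is = 0"
  shows "matrix (run spanner_prog \<sigma>) ''H'' n spanner"
proof -
  define \<sigma>1 where "\<sigma>1 = run cube_root \<sigma>"
  define \<sigma>2 where "\<sigma>2 = run search_tree \<sigma>1"
  define \<sigma>3 where "\<sigma>3 = run form_clusters \<sigma>2"
  define \<sigma>4 where "\<sigma>4 = run add_linked \<sigma>3"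
  define \<sigma>5 where "\<sigma>5 = run add_bottoms \<sigma>4"
  have f1: "\<sigma>1 y = \<sigma> y" if "y \<notin> {''i'', ''L'', ''L2'', ''L3''}" for y
    unfolding \<sigma>1_def using that by (intro run_frame) (simp add: cube_root_def cube_step_def)
  have f2: "\<sigma>2 y = \<sigma>1 y" if "y \<notin> {''a'', ''b'', ''k'', ''d'', ''par'', ''v'', ''H''}" for y
    unfolding \<sigma>2_def using that by (intro run_frame) (simp add: search_tree_def)
  have f3: "\<sigma>3 y = \<sigma>2 y" if "y \<notin> {''z'', ''cnt'', ''a'', ''cl''}" for y
    unfolding \<sigma>3_def using that
    by (intro run_frame) (simp add: form_clusters_def count_candidates_def mark_candidates_def)
  have f4: "\<sigma>4 y = \<sigma>3 y" if "y \<notin> {''a'', ''b'', ''H''}" for y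
    unfolding \<sigma>4_def using that by (intro run_frame) (simp add: add_linked_def)
  have f5: "\<sigma>5 y = \<sigma>4 y" if "y \<notin> {''q'', ''w'', ''p'', ''a'', ''b'', ''k'', ''e'', ''r'', ''H''}" for y
    unfolding \<sigma>5_def using that by (intro run_frame) (simp add: add_bottoms_def)
  have L1: "\<sigma>1 ''L'' [] = L"
    unfolding \<sigma>1_def using i z by (intro run_cube_root) (simp_all add: input_ok_def)
  have i1: "input_ok \<sigma>1" using i by (rule input_ok_cong) (simp_all add: f1)
  have t2: "tree_ok \<sigma>2" "matrix \<sigma>2 ''H'' n trees"
    unfolding \<sigma>2_def using i1 by (rule run_search_tree; simp add: f1 z matrix_def)+
  have "input_ok \<sigma>2" using i1 by (rule input_ok_cong) (simp_all add: f2)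
  then have k2: "known \<sigma>2" unfolding known_def using t2(1) L1 f2 by simp
  have "\<sigma>2 ''cl'' [x] = 0" for x using f1 f2 z by simp
  then have c3: "\<sigma>3 ''cl'' [x] = cl x" if "x < n" for x
    unfolding \<sigma>3_def using run_form_clusters k2 t2(2) that by blast
  have k3: "known \<sigma>3" using k2 by (rule known_cong) (simp_all add: f3)
  have "matrix \<sigma>3 ''H'' n trees" using t2(2) f3 by (simp add: matrix_def)
  then have H4: "matrix \<sigma>4 ''H'' n H1" unfolding \<sigma>4_def using run_add_linked k3 c3 by blast
  have k4: "known \<sigma>4" using k3 by (rule known_cong) (simp_all add: f4)
  have H5: "matrix \<sigma>5 ''H'' n H0" unfolding \<sigma>5_def using run_add_bottoms k4 H4 by blast
  have k5: "known \<sigma>5" using k4 by (rule known_cong) (simp_all add: f5)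
  have "matrix (run augment_all \<sigma>5) ''H'' n spanner" using run_augment_all k5 H5 by blast
  then show ?thesis
    unfolding spanner_prog_def \<sigma>5_def \<sigma>4_def \<sigma>3_def \<sigma>2_def \<sigma>1_def by simp
qed

lemma spanner_sub: "spanner \<subseteq> E"
  unfolding spanner_Hs by (rule Hs_E)

lemma ft_abfs_spanner: "ft_abfs 1 4 ({..<n}, E) s ({..<n}, spanner)"
  unfolding ft_abfs_def
proof (intro conjI ballI)
  show "spanning_subgraph ({..<n}, spanner) ({..<n}, E)"
    unfolding spanning_subgraph_def using spanner_sub by simp
next
  fix v e
  have sub: "\<And>x. x \<in> E - {e} \<Longrightarrow> x \<subseteq> {..<n}" "\<And>x. x \<in> spanner - {e} \<Longrightarrow> x \<subseteq> {..<n}"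
    using edge_sub spanner_sub by auto
  have s: "s \<in> {..<n}" using source_less by simp
  have "gdist s v ({..<n}, spanner - {e}) \<le> gdist s v ({..<n}, E - {e}) + enat 4"
  proof (cases "gdist s v ({..<n}, E - {e})")
    case (enat k)
    then have "reach (E - {e}) k s v" using gdist_le_iff[of "E - {e}", OF sub(1) s] by (metis order_refl)
    then have "reach (spanner - {e}) (k + 4) s v" unfolding spanner_Hs by (rule final_stretch)
    then have "gdist s v ({..<n}, spanner - {e}) \<le> enat (k + 4)"
      using gdist_le_iff[of "spanner - {e}", OF sub(2) s] by blast
    then show ?thesis using enat by simp
  qed simp
  then show "gdist s v (delete_edge ({..<n}, spanner) e)
      \<le> enat 1 * gdist s v (delete_edge ({..<n}, E) e) + enat 4"
    unfolding delete_edge_def one_enat_def[symmetric] by simp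
qed

text \<open>The cube bound gives \<open>L <= 2 * n powr (1 / 3)\<close>, and 26 is 13 times this
  2.\<close>

lemma card_spanner_real: "real (card spanner) \<le> 26 * real n powr (4 / 3)"
proof -
  have n: "0 < real n" using source_less by simp
  have "real L ^ 3 \<le> (2 * real n powr (1 / 3)) ^ 3"
  proof -
    have "(real n powr (1 / 3)) ^ 3 = real n" using n by (simp flip: powr_realpow add: powr_powr)
    then have "(2 * real n powr (1 / 3)) ^ 3 = 8 * real n" by (simp add: power_mult_distrib)
    moreover have "real (L * L * L) \<le> real (8 * n)" using L_cube_le by (simp only: of_nat_le_iff)
    ultimately show ?thesis by (simp add: power3_eq_cube)
  qed
  then have "real L \<le> 2 * real n powr (1 / 3)" by (rule power_le_imp_le_base[of _ 2, simplified]) simp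
  then have "13 * (real n * real L) \<le> 13 * (real n * (2 * real n powr (1 / 3)))" using n by simp
  also have "\<dots> = 26 * (real n powr 1 * real n powr (1 / 3))" using n by simp
  also have "real n powr 1 * real n powr (1 / 3) = real n powr (4 / 3)"
    unfolding powr_add[symmetric] by simp
  finally have "13 * (real n * real L) \<le> 26 * real n powr (4 / 3)" .
  moreover have "real (card spanner) \<le> real (13 * (n * L))" using card_spanner by (simp only: of_nat_le_iff)
  ultimately show ?thesis by simp
qed

end

theorem theorem5:
  "\<exists>(prog :: com) (p :: nat poly) (f :: nat \<Rightarrow> real).
     f \<in> O(\<lambda>n. real n powr (4 / 3)) \<and>
     (\<forall>(n :: nat) (G :: nat ugraph) (s :: nat).
        simple_graph G \<and> verts G = {..<n} \<and> s \<in> verts G \<longrightarrow>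
        (\<exists>(t :: nat) (\<tau> :: store) (H :: nat ugraph).
           exec prog (input_store G s) t \<tau> \<and> t \<le> poly p n \<and>
           outputs_graph \<tau> H \<and> ft_abfs 1 4 G s H \<and>
           real (card (edges H)) \<le> f n))"
proof -
  \<comment> \<open>The polynomial is fixed before any graph, so program and time bound are
    uniform.\<close>
  obtain p :: "nat poly" where
    p: "\<And>\<sigma>. \<exists>t. exec (compile spanner_prog) \<sigma> t (run spanner_prog \<sigma>) \<and> t \<le> poly p (\<sigma> ''n'' [])"
    using exec_compile[OF wf_spanner_prog] by blast
  define f where "f = (\<lambda>n. 26 * real n powr (4 / 3))"
  show ?thesis
  proof (intro exI[of _ "compile spanner_prog"] exI[of _ p] exI[of _ f] conjI allI impI)
    show "f \<in> O(\<lambda>n. real n powr (4 / 3))" unfolding f_def by simp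
  next
    fix n s :: nat and G :: "nat ugraph"
    assume a: "simple_graph G \<and> verts G = {..<n} \<and> s \<in> verts G"
    interpret graph_input n s "edges G"
      by unfold_locales (use a in \<open>auto simp: simple_graph_def\<close>)
    let ?\<sigma> = "input_store G s"
    have G: "G = ({..<n}, edges G)" using a by (metis prod.collapse)
    have "input_ok ?\<sigma>" unfolding input_ok_def matrix_def input_store_def adj_matrix_def using a by simp
    then have "matrix (run spanner_prog ?\<sigma>) ''H'' n spanner"
      by (rule run_spanner_prog) (simp add: input_store_def)
    then have "outputs_graph (run spanner_prog ?\<sigma>) ({..<n}, spanner)"
      unfolding outputs_graph_def adj_matrix_def matrix_def by simp
    moreover obtain t where "exec (compile spanner_prog) ?\<sigma> t (run spanner_prog ?\<sigma>)" "t \<le> poly p (?\<sigma> ''n'' [])"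
      using p by blast
    moreover have "?\<sigma> ''n'' [] = n" using a by (simp add: input_store_def)
    moreover have "ft_abfs 1 4 G s ({..<n}, spanner)" using ft_abfs_spanner G by metis
    moreover have "real (card (edges ({..<n}, spanner))) \<le> f n" unfolding f_def using card_spanner_real by simp
    ultimately show "\<exists>t \<tau> H. exec (compile spanner_prog) ?\<sigma> t \<tau> \<and> t \<le> poly p n \<and>
        outputs_graph \<tau> H \<and> ft_abfs 1 4 G s H \<and> real (card (edges H)) \<le> f n"
      by metis
  qed
qed

end
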